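(* Let $p$ be a prime, $s\ge 1$ an integer, $\beta_0,\dots,\beta_{p^s-1}\in\mathbb{C}$, and let $$m_0(\xi)=\frac1p\sum_{k=0}^{p^s-1}\beta_k\chi_p(k\xi),\qquad \xi\in\mathbb{Q}_p.$$ Suppose that $m_0(0)=1$, that $m_0\big(\frac{k}{p^s}\big)=0$ for all $k=1,\dots,p^s-1$ not divisible by $p$, and that $\big|m_0\big(\frac{k}{p^s}\big)\big|=1$ for all $k=1,\dots,p^s-1$ divisible by $p$. Let $\phi\in L^2(\mathbb{Q}_p)$ be a refinable function with mask $m_0$, that is, a function whose Fourier transform is $$\widehat\phi(\xi)=\widehat\phi(0)\prod_{j=1}^{\infty}m_0\Big(\frac{\xi}{p^{s-j}}\Big),\qquad \widehat\phi(0)\ne 0.$$ Then $\phi$ generates a multiresolution analysis: the spaces $$V_j=\overline{\mathrm{span}\{\phi(p^{-j}\cdot-a):a\in I_p\}},\qquad j\in\mathbb{Z},$$ form a multiresolution analysis in $L^2(\mathbb{Q}_p)$.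
   Context: $\mathbb{Q}_p$ is the field of $p$-adic numbers with Haar measure $dx$ normalized so that the unit disc $B_0(0)=\{x:|x|_p\le1\}$ has measure $1$. $\chi_p(x)=e^{2\pi i\{x\}_p}$, where $\{x\}_p$ is the fractional part of $x\in\mathbb{Q}_p$. The Fourier transform is $\widehat\varphi(\xi)=\int_{\mathbb{Q}_p}\chi_p(\xi x)\varphi(x)\,dx$ for locally constant compactly supported $\varphi$, extended to $L^2(\mathbb{Q}_p)$ in the standard way. A function $\phi$ with the Fourier transform given in the claim satisfies $\widehat\phi(\xi)=m_0\big(\frac{\xi}{p^{s-1}}\big)\widehat\phi(p\xi)$, which is the Fourier form of the refinement equation $\phi(x)=\sum_{k=0}^{p^s-1}\beta_k\phi\big(\frac1p x-\frac{k}{p^s}\big)$; solutions of such an equation are called refinable functions, and $m_0$ is called the mask. The set of shifts is $I_p=\{p^{-\gamma}(a_0+a_1p+\cdots+a_{\gamma-1}p^{\gamma-1}):\gamma\in\mathbb{N},\ a_j\in\{0,1,\dots,p-1\}\}\subset\mathbb{Q}_p$ (it contains $0$). Closures are taken in $L^2(\mathbb{Q}_p)$. A multiresolution analysis in $L^2(\mathbb{Q}_p)$ is a collection of closed subspaces $V_j\subset L^2(\mathbb{Q}_p)$, $j\in\mathbb{Z}$, such that: (a) $V_j\subset V_{j+1}$ for all $j$; (b) $\bigcup_{j}V_j$ is dense in $L^2(\mathbb{Q}_p)$; (c) $\bigcap_jV_j=\{0\}$; (d) $f(\cdot)\in V_j\iff f(p^{-1}\cdot)\in V_{j+1}$ for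 all $j$; (e) there is a function in $V_0$ whose shifts by all $a\in I_p$ form an orthonormal basis for $V_0$. *)

theory Defs
  imports
    "HOL-Analysis.Analysis"
    "HOL-Computational_Algebra.Primes"
    "HOL-Library.Function_Algebras"
begin

section \<open>The field of $p$-adic numbers\<close>

text \<open>
  The prime $p$ enters as the cardinality of a type \<open>'p\<close>, so that $\mathbb{Q}_p$ can be a type
  \<open>'p padic\<close>. A theorem with a free type variable of class \<open>prime_card\<close> is a theorem for every
  prime $p$.
\<close>

class prime_card =
  assumes prime_card: "prime CARD('a)"

text \<open>The $p$-adic absolute value on the rationals.\<close>

definition rat_pabs :: "nat \<Rightarrow> rat \<Rightarrow> real" where
  "rat_pabs p q = (if q = 0 then 0 else
     (let (a, b) = quotient_of q
      in real p powi (int (multiplicity (int p) b) - int (multiplicity (int p) a))))"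

lemma rat_pabs_0 [simp]: "rat_pabs p 0 = 0"
  by (simp add: rat_pabs_def)

lemma rat_pabs_frac:
  assumes p: "prime p" and ab: "a \<noteq> 0" "b \<noteq> 0"
  shows "rat_pabs p (of_int a / of_int b) =
    real p powi (int (multiplicity (int p) b) - int (multiplicity (int p) a))"
proof -
  define q :: rat where "q = of_int a / of_int b"
  obtain n d where nd: "quotient_of q = (n, d)" by force
  have d: "d > 0" using quotient_of_denom_pos[OF nd] .
  have qe: "q = of_int n / of_int d" using quotient_of_div[OF nd] .
  have q0: "q \<noteq> 0" using ab by (simp add: q_def)
  hence n: "n \<noteq> 0" using qe by auto
  have "(of_int (a * d) :: rat) = of_int (n * b)"
    using qe ab d unfolding q_def by (simp add: field_simps)
  hence eq: "a * d = n * b" by (simp only: of_int_eq_iff)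
  have pp: "prime_elem (int p)" using p by auto
  have "multiplicity (int p) (a * d) = multiplicity (int p) a + multiplicity (int p) d"
    by (rule prime_elem_multiplicity_mult_distrib) (use pp ab d in auto)
  moreover have "multiplicity (int p) (n * b) = multiplicity (int p) n + multiplicity (int p) b"
    by (rule prime_elem_multiplicity_mult_distrib) (use pp ab n in auto)
  ultimately have "int (multiplicity (int p) d) - int (multiplicity (int p) n)
    = int (multiplicity (int p) b) - int (multiplicity (int p) a)"
    using eq by simp
  thus ?thesis using q0 nd unfolding q_def rat_pabs_def by simp
qed

lemma rat_pabs_nonneg [simp]: "0 \<le> rat_pabs p q"
  by (simp add: rat_pabs_def split: prod.split)

lemma rat_frac_ex: "\<exists>a b. b \<noteq> 0 \<and> (q :: rat) = of_int a / of_int b"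
  using quotient_of_div[of q] quotient_of_denom_pos[of q] by (metis less_irrefl surj_pair)

lemma rat_pabs_eq_0_iff [simp]: "prime p \<Longrightarrow> rat_pabs p q = 0 \<longleftrightarrow> q = 0"
  by (auto simp: rat_pabs_def prime_gt_0_nat split: prod.splits)

lemma rat_pabs_mult:
  assumes p: "prime p"
  shows "rat_pabs p (x * y) = rat_pabs p x * rat_pabs p y"
proof (cases "x = 0 \<or> y = 0")
  case False
  obtain a b where x: "b \<noteq> 0" "x = of_int a / of_int b" using rat_frac_ex by blast
  obtain c d where y: "d \<noteq> 0" "y = of_int c / of_int d" using rat_frac_ex by blast
  have ac: "a \<noteq> 0" "c \<noteq> 0" using False x y by auto
  have pp: "prime_elem (int p)" using p by auto
  have "x * y = of_int (a * c) / of_int (b * d)" using x y by simp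
  hence "rat_pabs p (x * y) = real p powi (int (multiplicity (int p) (b * d)) - int (multiplicity (int p) (a * c)))"
    using rat_pabs_frac[OF p, of "a * c" "b * d"] ac x y by (metis mult_eq_0_iff)
  also have "multiplicity (int p) (b * d) = multiplicity (int p) b + multiplicity (int p) d"
    by (rule prime_elem_multiplicity_mult_distrib) (use pp x y in auto)
  also have "multiplicity (int p) (a * c) = multiplicity (int p) a + multiplicity (int p) c"
    by (rule prime_elem_multiplicity_mult_distrib) (use pp ac in auto)
  also have "int (multiplicity (int p) b + multiplicity (int p) d) - int (multiplicity (int p) a + multiplicity (int p) c)
     = (int (multiplicity (int p) b) - int (multiplicity (int p) a)) + (int (multiplicity (int p) d) - int (multiplicity (int p) c))"
    by simp
  also have "real p powi \<dots> = rat_pabs p x * rat_pabs p y"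
    using x y ac p by (simp add: rat_pabs_frac power_int_add prime_gt_0_nat)
  finally show ?thesis .
qed auto

lemma rat_pabs_1 [simp]: "rat_pabs p 1 = 1"
  by (simp add: rat_pabs_def)

lemma rat_pabs_minus [simp]: "prime p \<Longrightarrow> rat_pabs p (- x) = rat_pabs p x"
proof -
  assume p: "prime p"
  have "rat_pabs p (-1) * rat_pabs p (-1) = 1" by (simp flip: rat_pabs_mult[OF p])
  hence "rat_pabs p (-1) = 1"
    by (metis abs_of_nonneg rat_pabs_nonneg power2_eq_1_iff power2_eq_square abs_minus_cancel abs_one)
  thus ?thesis using rat_pabs_mult[OF p, of "-1" x] by simp
qed

lemma rat_pabs_inverse: "prime p \<Longrightarrow> rat_pabs p (inverse x) = inverse (rat_pabs p x)"
proof (cases "x = 0")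
  case False
  assume p: "prime p"
  have "rat_pabs p x * rat_pabs p (inverse x) = 1" using False by (simp flip: rat_pabs_mult[OF p])
  thus ?thesis by (metis inverse_unique)
qed auto

lemma rat_pabs_ultrametric:
  assumes p: "prime p"
  shows "rat_pabs p (x + y) \<le> max (rat_pabs p x) (rat_pabs p y)"
proof (cases "x = 0 \<or> y = 0 \<or> x + y = 0")
  case False
  obtain a b where x: "b \<noteq> 0" "x = of_int a / of_int b" using rat_frac_ex by blast
  obtain c d where y: "d \<noteq> 0" "y = of_int c / of_int d" using rat_frac_ex by blast
  have x': "x = of_int (a * d) / of_int (b * d)" and y': "y = of_int (c * b) / of_int (b * d)"
    using x y by auto
  define u v w where "u = a * d" and "v = c * b" and "w = b * d"
  have w: "w \<noteq> 0" using x y by (auto simp: w_def)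
  have e: "x = of_int u / of_int w" "y = of_int v / of_int w" "x + y = of_int (u + v) / of_int w"
    using x' y' by (auto simp: u_def v_def w_def add_divide_distrib)
  have nz: "u \<noteq> 0" "v \<noteq> 0" "u + v \<noteq> 0" using False e by auto
  have np: "\<not> is_unit (int p)" using p by (auto simp: prime_gt_1_nat dest: prime_gt_1_nat)
  let ?m = "min (multiplicity (int p) u) (multiplicity (int p) v)"
  have "int p ^ ?m dvd u + v"
    by (intro dvd_add multiplicity_dvd') auto
  hence m: "?m \<le> multiplicity (int p) (u + v)"
    by (intro multiplicity_geI) (use nz np in auto)
  have p1: "1 \<le> real p" using p prime_gt_0_nat[of p] by linarith
  have "real p powi (int (multiplicity (int p) w) - int (multiplicity (int p) (u + v)))
     \<le> real p powi (int (multiplicity (int p) w) - int ?m)"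
    by (rule power_int_increasing) (use m p1 in auto)
  also have "\<dots> \<le> max (real p powi (int (multiplicity (int p) w) - int (multiplicity (int p) u)))
    (real p powi (int (multiplicity (int p) w) - int (multiplicity (int p) v)))"
    by (auto simp: min_def)
  finally show ?thesis
    unfolding e(3) unfolding e(1,2) using nz w p by (simp add: rat_pabs_frac del: of_int_add)
qed (auto simp: max_def)

definition pcauchy :: "nat \<Rightarrow> (nat \<Rightarrow> rat) \<Rightarrow> bool" where
  "pcauchy p X \<longleftrightarrow> (\<forall>e>0. \<exists>N. \<forall>m\<ge>N. \<forall>n\<ge>N. rat_pabs p (X m - X n) < e)"

definition pvanishes :: "nat \<Rightarrow> (nat \<Rightarrow> rat) \<Rightarrow> bool" where
  "pvanishes p X \<longleftrightarrow> (\<lambda>n. rat_pabs p (X n)) \<longlonglongrightarrow> 0"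

context
  fixes p :: nat
  assumes p: "prime p"
begin

lemma rat_pabs_triangle: "rat_pabs p (x + y) \<le> rat_pabs p x + rat_pabs p y"
  using rat_pabs_ultrametric[OF p, of x y] rat_pabs_nonneg[of p x] rat_pabs_nonneg[of p y] by linarith

lemma rat_pabs_diff_commute: "rat_pabs p (x - y) = rat_pabs p (y - x)"
  using rat_pabs_minus[OF p, of "x - y"] by simp

lemma rat_pabs_triangle3: "\<bar>rat_pabs p x - rat_pabs p y\<bar> \<le> rat_pabs p (x - y)"
  using rat_pabs_triangle[of "x - y" y] rat_pabs_triangle[of "y - x" x] rat_pabs_diff_commute[of x y] by simp

lemma pvanishes_const [simp]: "pvanishes p (\<lambda>n. c) \<longleftrightarrow> c = 0"
  using p by (simp add: pvanishes_def tendsto_const_iff)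

lemma pvanishes_add: "pvanishes p X \<Longrightarrow> pvanishes p Y \<Longrightarrow> pvanishes p (\<lambda>n. X n + Y n)"
  unfolding pvanishes_def
  by (rule tendsto_sandwich[OF _ _ tendsto_const tendsto_add_zero, of _ _ "\<lambda>n. rat_pabs p (X n)" "\<lambda>n. rat_pabs p (Y n)"])
     (auto intro!: always_eventually rat_pabs_triangle)

lemma pvanishes_minus: "pvanishes p (\<lambda>n. - X n) \<longleftrightarrow> pvanishes p X"
  using p by (simp add: pvanishes_def)

lemma pvanishes_diff_commute: "pvanishes p (\<lambda>n. X n - Y n) \<longleftrightarrow> pvanishes p (\<lambda>n. Y n - X n)"
  using pvanishes_minus[of "\<lambda>n. X n - Y n"] by simp

lemma pcauchy_const [simp]: "pcauchy p (\<lambda>n. c)"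
  by (simp add: pcauchy_def)

lemma pcauchy_minus: "pcauchy p X \<Longrightarrow> pcauchy p (\<lambda>n. - X n)"
proof -
  have "- a - - b = - (a - b)" for a b :: rat by simp
  thus "pcauchy p X \<Longrightarrow> pcauchy p (\<lambda>n. - X n)"
    unfolding pcauchy_def using rat_pabs_minus[OF p] by metis
qed

lemma pcauchy_add:
  assumes "pcauchy p X" "pcauchy p Y" shows "pcauchy p (\<lambda>n. X n + Y n)"
  unfolding pcauchy_def
proof (intro allI impI)
  fix e :: real assume e: "e > 0"
  obtain M N where M: "\<And>m n. m \<ge> M \<Longrightarrow> n \<ge> M \<Longrightarrow> rat_pabs p (X m - X n) < e"
    and N: "\<And>m n. m \<ge> N \<Longrightarrow> n \<ge> N \<Longrightarrow> rat_pabs p (Y m - Y n) < e"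
    using assms e unfolding pcauchy_def by metis
  show "\<exists>N. \<forall>m\<ge>N. \<forall>n\<ge>N. rat_pabs p (X m + Y m - (X n + Y n)) < e"
  proof (intro exI[of _ "max M N"] allI impI)
    fix m n assume "max M N \<le> m" "max M N \<le> n"
    hence "rat_pabs p (X m - X n) < e" "rat_pabs p (Y m - Y n) < e" using M N by auto
    hence "rat_pabs p ((X m - X n) + (Y m - Y n)) < e"
      using rat_pabs_ultrametric[OF p, of "X m - X n" "Y m - Y n"] by linarith
    thus "rat_pabs p (X m + Y m - (X n + Y n)) < e" by (simp add: algebra_simps)
  qed
qed

lemma pcauchy_Cauchy_abs: "pcauchy p X \<Longrightarrow> Cauchy (\<lambda>n. rat_pabs p (X n))"
  unfolding Cauchy_def pcauchy_def dist_real_def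
  using rat_pabs_triangle3 by (meson order_le_less_trans)

lemma pcauchy_convergent_abs: "pcauchy p X \<Longrightarrow> convergent (\<lambda>n. rat_pabs p (X n))"
  using pcauchy_Cauchy_abs Cauchy_convergent_iff by blast

lemma pcauchy_bounded: "pcauchy p X \<Longrightarrow> \<exists>B>0. \<forall>n. rat_pabs p (X n) < B"
proof -
  assume "pcauchy p X"
  hence "Bseq (\<lambda>n. rat_pabs p (X n))" using pcauchy_Cauchy_abs Cauchy_Bseq by blast
  then obtain K where "K > 0" "\<forall>n. norm (rat_pabs p (X n)) \<le> K" by (auto elim: BseqE)
  hence "rat_pabs p (X n) < K + 1" for n by (metis abs_of_nonneg add.commute add_strict_increasing rat_pabs_nonneg real_norm_def zero_less_one)
  thus ?thesis using \<open>K > 0\<close> by (intro exI[of _ "K + 1"]) auto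
qed

lemma pvanishes_mult_bounded:
  assumes "pcauchy p X" "pvanishes p Y" shows "pvanishes p (\<lambda>n. X n * Y n)"
  using assms pcauchy_convergent_abs[OF assms(1)]
  by (auto simp: pvanishes_def rat_pabs_mult[OF p] convergent_def intro: tendsto_eq_intros)

lemma pcauchy_mult:
  assumes X: "pcauchy p X" and Y: "pcauchy p Y" shows "pcauchy p (\<lambda>n. X n * Y n)"
  unfolding pcauchy_def
proof (intro allI impI)
  fix e :: real assume e: "e > 0"
  obtain A where A: "A > 0" "\<And>n. rat_pabs p (X n) < A" using pcauchy_bounded[OF X] by blast
  obtain B where B: "B > 0" "\<And>n. rat_pabs p (Y n) < B" using pcauchy_bounded[OF Y] by blast
  have "e / B > 0" "e / A > 0" using e A B by auto
  then obtain M N where M: "\<And>m n. m \<ge> M \<Longrightarrow> n \<ge> M \<Longrightarrow> rat_pabs p (X m - X n) < e / B"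
    and N: "\<And>m n. m \<ge> N \<Longrightarrow> n \<ge> N \<Longrightarrow> rat_pabs p (Y m - Y n) < e / A"
    using X Y unfolding pcauchy_def by metis
  show "\<exists>N. \<forall>m\<ge>N. \<forall>n\<ge>N. rat_pabs p (X m * Y m - X n * Y n) < e"
  proof (intro exI[of _ "max M N"] allI impI)
    fix m n assume mn: "max M N \<le> m" "max M N \<le> n"
    have "rat_pabs p ((X m - X n) * Y m) < (e / B) * B"
      unfolding rat_pabs_mult[OF p] using M[of m n] B e mn by (intro mult_strict_mono) auto
    moreover have "rat_pabs p (X n * (Y m - Y n)) < A * (e / A)"
      unfolding rat_pabs_mult[OF p] using N[of m n] A e mn by (intro mult_strict_mono) auto
    moreover have "X m * Y m - X n * Y n = (X m - X n) * Y m + X n * (Y m - Y n)"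
      by (simp add: algebra_simps)
    ultimately show "rat_pabs p (X m * Y m - X n * Y n) < e"
      using rat_pabs_ultrametric[OF p, of "(X m - X n) * Y m" "X n * (Y m - Y n)"] A(1) B(1) by simp
  qed
qed

lemma pcauchy_not_vanishes:
  assumes X: "pcauchy p X" and nz: "\<not> pvanishes p X"
  shows "\<exists>b>0. \<exists>k. \<forall>n\<ge>k. b < rat_pabs p (X n)"
proof -
  obtain L where L: "(\<lambda>n. rat_pabs p (X n)) \<longlonglongrightarrow> L" using pcauchy_convergent_abs[OF X] by (auto simp: convergent_def)
  have "L \<ge> 0" using L by (rule LIMSEQ_le_const) auto
  hence "L > 0" using nz L by (auto simp: pvanishes_def less_le)
  hence "\<forall>\<^sub>F n in sequentially. L / 2 < rat_pabs p (X n)" using L by (intro order_tendstoD) auto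
  thus ?thesis using \<open>L > 0\<close> by (intro exI[of _ "L/2"]) (simp add: eventually_sequentially)
qed

lemma rat_pabs_inverse_diff:
  assumes "x \<noteq> 0" "y \<noteq> 0"
  shows "rat_pabs p (inverse x - inverse y) = rat_pabs p (x - y) * inverse (rat_pabs p x) * inverse (rat_pabs p y)"
proof -
  have "inverse x - inverse y = (y - x) * inverse x * inverse y" using assms by (simp add: field_simps)
  thus ?thesis using rat_pabs_diff_commute[of x y] by (simp add: rat_pabs_mult[OF p] rat_pabs_inverse[OF p])
qed

lemma rat_pabs_inverse_diff_le:
  assumes "b > 0" "c > 0" "b < rat_pabs p x" "c < rat_pabs p y"
  shows "rat_pabs p (inverse x - inverse y) \<le> rat_pabs p (x - y) * (inverse b * inverse c)"
proof -
  have "x \<noteq> 0" "y \<noteq> 0" using assms by auto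
  moreover have "inverse (rat_pabs p x) \<le> inverse b" "inverse (rat_pabs p y) \<le> inverse c"
    using assms by (auto intro!: le_imp_inverse_le)
  ultimately show ?thesis using assms
    by (auto simp: rat_pabs_inverse_diff mult.assoc intro!: mult_left_mono mult_mono)
qed

lemma pcauchy_inverse:
  assumes X: "pcauchy p X" and nz: "\<not> pvanishes p X"
  shows "pcauchy p (\<lambda>n. inverse (X n))"
  unfolding pcauchy_def
proof (intro allI impI)
  fix e :: real assume e: "e > 0"
  obtain b k where b: "b > 0" "\<And>n. n \<ge> k \<Longrightarrow> b < rat_pabs p (X n)" using pcauchy_not_vanishes[OF X nz] by blast
  obtain M where M: "\<And>m n. m \<ge> M \<Longrightarrow> n \<ge> M \<Longrightarrow> rat_pabs p (X m - X n) < e * (b * b)"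
    using X e b unfolding pcauchy_def by (metis mult_pos_pos)
  show "\<exists>N. \<forall>m\<ge>N. \<forall>n\<ge>N. rat_pabs p (inverse (X m) - inverse (X n)) < e"
  proof (intro exI[of _ "max M k"] allI impI)
    fix m n assume mn: "max M k \<le> m" "max M k \<le> n"
    have "rat_pabs p (inverse (X m) - inverse (X n)) \<le> rat_pabs p (X m - X n) * (inverse b * inverse b)"
      using b mn by (intro rat_pabs_inverse_diff_le) auto
    also have "\<dots> < e * (b * b) * (inverse b * inverse b)"
      using M[of m n] mn b by (intro mult_strict_right_mono) auto
    also have "\<dots> = e" using b(1) by (simp add: field_simps)
    finally show "rat_pabs p (inverse (X m) - inverse (X n)) < e" .
  qed
qed

lemma pvanishes_diff_inverse:
  assumes X: "pcauchy p X" "\<not> pvanishes p X" and Y: "pcauchy p Y" "\<not> pvanishes p Y"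
    and XY: "pvanishes p (\<lambda>n. X n - Y n)"
  shows "pvanishes p (\<lambda>n. inverse (X n) - inverse (Y n))"
proof -
  obtain b k where b: "b > 0" "\<And>n. n \<ge> k \<Longrightarrow> b < rat_pabs p (X n)" using pcauchy_not_vanishes[OF X] by blast
  obtain c l where c: "c > 0" "\<And>n. n \<ge> l \<Longrightarrow> c < rat_pabs p (Y n)" using pcauchy_not_vanishes[OF Y] by blast
  have lim: "(\<lambda>n. rat_pabs p (X n - Y n) * (inverse b * inverse c)) \<longlonglongrightarrow> 0"
    using XY unfolding pvanishes_def by (rule tendsto_mult_left_zero)
  show ?thesis unfolding pvanishes_def
  proof (rule tendsto_sandwich[OF _ _ tendsto_const lim])
    show "\<forall>\<^sub>F n in sequentially. rat_pabs p (inverse (X n) - inverse (Y n)) \<le> rat_pabs p (X n - Y n) * (inverse b * inverse c)"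
      unfolding eventually_sequentially using b c by (intro exI[of _ "max k l"]) (auto intro!: rat_pabs_inverse_diff_le)
  qed auto
qed

end

text \<open>
  $\mathbb{Q}_p$ as the completion of the rationals: Cauchy sequences for the $p$-adic absolute
  value modulo null sequences.
\<close>

typedef (overloaded) 'p padic_cauchy = "{X. pcauchy CARD('p::prime_card) X}"
  by (rule exI[of _ "\<lambda>n. 0"]) (simp add: pcauchy_const[OF prime_card])

setup_lifting type_definition_padic_cauchy

lift_definition padicrel :: "'p::prime_card padic_cauchy \<Rightarrow> 'p padic_cauchy \<Rightarrow> bool"
  is "\<lambda>X Y. pvanishes CARD('p) (\<lambda>n. X n - Y n)" .

quotient_type (overloaded) 'p padic = "'p::prime_card padic_cauchy" / padicrel
proof (rule equivpI)
  note p = prime_card[where 'a='p]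
  show "reflp (padicrel :: 'p padic_cauchy \<Rightarrow> _)"
    by (rule reflpI, transfer) (simp add: pvanishes_const[OF p])
  show "symp (padicrel :: 'p padic_cauchy \<Rightarrow> _)"
    by (rule sympI, transfer) (subst pvanishes_diff_commute[OF p])
  show "transp (padicrel :: 'p padic_cauchy \<Rightarrow> _)"
  proof (rule transpI, transfer)
    fix X Y Z assume "pvanishes CARD('p) (\<lambda>n. X n - Y n)" "pvanishes CARD('p) (\<lambda>n. Y n - Z n)"
    thus "pvanishes CARD('p) (\<lambda>n. X n - Z n)"
      using pvanishes_add[OF p, of "\<lambda>n. X n - Y n" "\<lambda>n. Y n - Z n"] by simp
  qed
qed

lift_definition pc_const :: "rat \<Rightarrow> 'p::prime_card padic_cauchy" is "\<lambda>q n. q"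
  by (simp add: pcauchy_const[OF prime_card])

lift_definition pc_add :: "'p::prime_card padic_cauchy \<Rightarrow> 'p padic_cauchy \<Rightarrow> 'p padic_cauchy"
  is "\<lambda>X Y n. X n + Y n" by (rule pcauchy_add[OF prime_card])

lift_definition pc_minus :: "'p::prime_card padic_cauchy \<Rightarrow> 'p padic_cauchy"
  is "\<lambda>X n. - X n" by (rule pcauchy_minus[OF prime_card])

lift_definition pc_mult :: "'p::prime_card padic_cauchy \<Rightarrow> 'p padic_cauchy \<Rightarrow> 'p padic_cauchy"
  is "\<lambda>X Y n. X n * Y n" by (rule pcauchy_mult[OF prime_card])

lift_definition pc_inverse :: "'p::prime_card padic_cauchy \<Rightarrow> 'p padic_cauchy"
  is "\<lambda>X. if pvanishes CARD('p) X then (\<lambda>n. 0) else (\<lambda>n. inverse (X n))"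
  by (simp add: pcauchy_inverse prime_card)

lift_definition pc_norm :: "'p::prime_card padic_cauchy \<Rightarrow> real"
  is "\<lambda>X. lim (\<lambda>n. rat_pabs CARD('p) (X n))" .

instantiation padic :: (prime_card) field
begin

lift_definition zero_padic :: "'a padic" is "pc_const 0" .

lift_definition one_padic :: "'a padic" is "pc_const 1" .

lift_definition plus_padic :: "'a padic \<Rightarrow> 'a padic \<Rightarrow> 'a padic" is pc_add
proof transfer
  note p = prime_card[where 'a='a]
  fix f1 f2 f3 f4 assume "pvanishes CARD('a) (\<lambda>n. f1 n - f2 n)" "pvanishes CARD('a) (\<lambda>n. f3 n - f4 n)"
  from pvanishes_add[OF p this]
  show "pvanishes CARD('a) (\<lambda>n. (f1 n + f3 n) - (f2 n + f4 n))" by (simp add: algebra_simps)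
qed

lift_definition uminus_padic :: "'a padic \<Rightarrow> 'a padic" is pc_minus
proof transfer
  note p = prime_card[where 'a='a]
  fix f1 f2 assume "pvanishes CARD('a) (\<lambda>n. f1 n - f2 n)"
  thus "pvanishes CARD('a) (\<lambda>n. - f1 n - - f2 n)"
    by (subst (asm) pvanishes_minus[OF p, symmetric]) simp
qed

lift_definition times_padic :: "'a padic \<Rightarrow> 'a padic \<Rightarrow> 'a padic" is pc_mult
proof transfer
  note p = prime_card[where 'a='a]
  fix f1 f2 f3 f4 assume "pcauchy CARD('a) f1" "pcauchy CARD('a) f4" 
    and "pvanishes CARD('a) (\<lambda>n. f1 n - f2 n)" "pvanishes CARD('a) (\<lambda>n. f3 n - f4 n)"
  hence "pvanishes CARD('a) (\<lambda>n. f1 n * (f3 n - f4 n) + f4 n * (f1 n - f2 n))"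
    by (intro pvanishes_add[OF p] pvanishes_mult_bounded[OF p])
  thus "pvanishes CARD('a) (\<lambda>n. f1 n * f3 n - f2 n * f4 n)" by (simp add: algebra_simps)
qed

lift_definition inverse_padic :: "'a padic \<Rightarrow> 'a padic" is pc_inverse
proof transfer
  note p = prime_card[where 'a='a]
  fix X Y assume *: "pcauchy CARD('a) X" "pcauchy CARD('a) Y" "pvanishes CARD('a) (\<lambda>n. X n - Y n)"
  hence YX: "pvanishes CARD('a) (\<lambda>n. Y n - X n)" using pvanishes_diff_commute[OF p] by metis
  have "pvanishes CARD('a) X \<longleftrightarrow> pvanishes CARD('a) Y"
    using pvanishes_add[OF p _ *(3), of Y] pvanishes_add[OF p _ YX, of X] by auto
  thus "pvanishes CARD('a) (\<lambda>n. (if pvanishes CARD('a) X then (\<lambda>n. 0) else (\<lambda>n. inverse (X n))) n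
     - (if pvanishes CARD('a) Y then (\<lambda>n. 0) else (\<lambda>n. inverse (Y n))) n)"
    using * by (auto simp: p intro!: pvanishes_diff_inverse)
qed

definition "x - y = x + - y" for x y :: "'a padic"

definition "x div y = x * inverse y" for x y :: "'a padic"

instance
proof
  note p [simp] = prime_card[where 'a='a]
  fix a b c :: "'a padic"
  show "a + b = b + a" "(a + b) + c = a + (b + c)" "(a * b) * c = a * (b * c)" "a * b = b * a"
    "(a + b) * c = a * c + b * c"
    by (transfer; transfer; simp add: ac_simps distrib_left)+
  show "0 + a = a" "1 * a = a" "- a + a = 0" "(0::'a padic) \<noteq> 1" "inverse (0::'a padic) = 0"
    by (transfer; transfer; simp)+
  have "pvanishes CARD('a) (\<lambda>n. inverse (X n) * X n - 1)"
    if X: "pcauchy CARD('a) X" "\<not> pvanishes CARD('a) X" for X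
  proof -
    obtain b k where "b > 0" "\<And>n. n \<ge> k \<Longrightarrow> b < rat_pabs CARD('a) (X n)"
      using pcauchy_not_vanishes[OF p X] by blast
    hence "X n \<noteq> 0" if "n \<ge> k" for n using that by (metis less_asym rat_pabs_0)
    hence "\<forall>\<^sub>F n in sequentially. rat_pabs CARD('a) (inverse (X n) * X n - 1) = 0"
      unfolding eventually_sequentially by (intro exI[of _ k]) simp
    thus ?thesis unfolding pvanishes_def by (rule tendsto_eventually)
  qed
  thus "a \<noteq> 0 \<Longrightarrow> inverse a * a = 1"
    by (transfer, transfer) auto
  show "a - b = a + - b" by (rule minus_padic_def)
  show "a div b = a * inverse b" by (rule divide_padic_def)
qed

end

text \<open>
  The constant \<^term>\<open>norm\<close> is constrained to real normed spaces by the library, hence a separate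
  constant for the absolute value on $\mathbb{Q}_p$.
\<close>

lift_definition padic_abs :: "'a::prime_card padic \<Rightarrow> real" is pc_norm
proof transfer
  note p = prime_card[where 'a='a]
  fix X Y assume *: "pcauchy CARD('a) X" "pvanishes CARD('a) (\<lambda>n. X n - Y n)"
  then obtain L where L: "(\<lambda>n. rat_pabs CARD('a) (X n)) \<longlonglongrightarrow> L"
    using pcauchy_convergent_abs[OF p] by (auto simp: convergent_def)
  have "(\<lambda>n. rat_pabs CARD('a) (Y n) - rat_pabs CARD('a) (X n)) \<longlonglongrightarrow> 0"
  proof (rule Lim_null_comparison)
    show "(\<lambda>n. rat_pabs CARD('a) (X n - Y n)) \<longlonglongrightarrow> 0" using * by (simp add: pvanishes_def)
    show "\<forall>\<^sub>F n in sequentially. norm (rat_pabs CARD('a) (Y n) - rat_pabs CARD('a) (X n)) \<le> rat_pabs CARD('a) (X n - Y n)"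
      using rat_pabs_triangle3[OF p] by (auto simp: abs_minus_commute intro!: always_eventually)
  qed
  from tendsto_add[OF this L] have "(\<lambda>n. rat_pabs CARD('a) (Y n)) \<longlonglongrightarrow> L" by simp
  with L show "lim (\<lambda>n. rat_pabs CARD('a) (X n)) = lim (\<lambda>n. rat_pabs CARD('a) (Y n))"
    by (simp add: limI)
qed

lemma pc_norm_tendsto:
  "(\<lambda>n. rat_pabs CARD('p::prime_card) (Rep_padic_cauchy (X :: 'p padic_cauchy) n)) \<longlonglongrightarrow> pc_norm X"
  using Rep_padic_cauchy[of X] pcauchy_convergent_abs[OF prime_card[where 'a='p]]
  by (simp add: pc_norm.rep_eq convergent_LIMSEQ_iff)

lemma padic_abs_nonneg: "0 \<le> padic_abs (x :: 'p::prime_card padic)"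
  by transfer (rule LIMSEQ_le_const[OF pc_norm_tendsto], simp)

lemma padic_abs_eq_0_iff: "padic_abs (x :: 'p::prime_card padic) = 0 \<longleftrightarrow> x = 0"
proof transfer
  fix X :: "'p padic_cauchy"
  show "pc_norm X = 0 \<longleftrightarrow> padicrel X (pc_const 0)"
    using pc_norm_tendsto[of X]
    by (auto simp: padicrel.rep_eq pc_const.rep_eq pvanishes_def dest: LIMSEQ_unique)
qed

lemma padic_abs_mult: "padic_abs (x * y :: 'p::prime_card padic) = padic_abs x * padic_abs y"
proof transfer
  fix X Y :: "'p padic_cauchy"
  show "pc_norm (pc_mult X Y) = pc_norm X * pc_norm Y"
    using pc_norm_tendsto[of "pc_mult X Y"] tendsto_mult[OF pc_norm_tendsto[of X] pc_norm_tendsto[of Y]]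
    by (auto simp: pc_mult.rep_eq rat_pabs_mult[OF prime_card] intro: LIMSEQ_unique)
qed

lemma padic_abs_ultrametric: "padic_abs (x + y :: 'p::prime_card padic) \<le> max (padic_abs x) (padic_abs y)"
proof transfer
  fix X Y :: "'p padic_cauchy"
  show "pc_norm (pc_add X Y) \<le> max (pc_norm X) (pc_norm Y)"
    using pc_norm_tendsto[of "pc_add X Y"] tendsto_max[OF pc_norm_tendsto[of X] pc_norm_tendsto[of Y]]
    by (rule LIMSEQ_le) (auto simp: pc_add.rep_eq intro!: rat_pabs_ultrametric prime_card)
qed

lemma padic_abs_minus: "padic_abs (- x :: 'a::prime_card padic) = padic_abs x"
proof -
  have "padic_abs (-1 :: 'a padic) * padic_abs (-1 :: 'a padic) = padic_abs (1 :: 'a padic)" "padic_abs (1::'a padic) * padic_abs (1::'a padic) = padic_abs (1::'a padic)"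
    by (simp_all flip: padic_abs_mult)
  hence "padic_abs (-1 :: 'a padic) = 1"
    by (metis abs_of_nonneg padic_abs_nonneg padic_abs_eq_0_iff mult_cancel_right1 one_neq_zero power2_eq_1_iff power2_eq_square abs_minus_cancel abs_one)
  thus ?thesis using padic_abs_mult[of "-1" x] by simp
qed

instantiation padic :: (prime_card) "metric_space"
begin
definition dist_padic :: "'a padic \<Rightarrow> 'a padic \<Rightarrow> real" where "dist_padic x y = padic_abs (x - y)"
definition uniformity_padic :: "('a padic \<times> 'a padic) filter" where
  "uniformity_padic = (INF e\<in>{0 <..}. principal {(x, y). dist x y < e})"
definition open_padic :: "'a padic set \<Rightarrow> bool" where
  "open_padic U \<longleftrightarrow> (\<forall>x\<in>U. eventually (\<lambda>(x', y). x' = x \<longrightarrow> y \<in> U) uniformity)"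
instance
proof
  fix x y z :: "'a padic"
  show "dist x y = 0 \<longleftrightarrow> x = y" by (simp add: dist_padic_def padic_abs_eq_0_iff)
  have "padic_abs ((x - z) + - (y - z)) \<le> max (padic_abs (x - z)) (padic_abs (- (y - z)))" by (rule padic_abs_ultrametric)
  thus "dist x y \<le> dist x z + dist y z"
    using padic_abs_nonneg[of "x - z"] padic_abs_nonneg[of "y - z"] unfolding padic_abs_minus dist_padic_def by auto
qed (simp_all add: uniformity_padic_def open_padic_def)
end


section \<open>Fractional part, additive character, shifts\<close>

text \<open>
  The part $\sum_{j<\gamma} a_j p^{j-\gamma}$ of a digit expansion
  $x = \sum_{j\ge 0} a_j p^{j-\gamma}$ that consists of the negative powers of $p$.
  Leading zero digits are allowed, so every $x$ has such an expansion with \<open>\<gamma> :: nat\<close>, and the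
  value does not depend on \<open>\<gamma>\<close>.
\<close>

definition padic_frac :: "'p::prime_card padic \<Rightarrow> real" where
  "padic_frac x = (THE r. \<exists>(\<gamma>::nat) (a::nat \<Rightarrow> nat).
     (\<forall>j. a j < CARD('p)) \<and>
     (\<lambda>j. of_nat (a j) * of_nat CARD('p) powi (int j - int \<gamma>)) sums x \<and>
     r = (\<Sum>j<\<gamma>. real (a j) * real CARD('p) powi (int j - int \<gamma>)))"

definition padic_char :: "'p::prime_card padic \<Rightarrow> complex" where
  "padic_char x = exp (2 * of_real pi * \<i> * of_real (padic_frac x))"

definition padic_shifts :: "'p::prime_card padic set" where
  "padic_shifts =
     {of_nat CARD('p) powi (- int \<gamma>) * (\<Sum>j<\<gamma>. of_nat (a j) * of_nat CARD('p) ^ j) |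
        (\<gamma>::nat) (a::nat \<Rightarrow> nat). \<forall>j<\<gamma>. a j < CARD('p)}"


section \<open>Haar measure and $L^2$\<close>

text \<open>
  Regularity and local finiteness need not be required: they follow from translation invariance
  and the normalization, since $\mathbb{Q}_p$ is second countable and a countable union of
  translates of the unit disc.
\<close>

definition is_haar :: "'p::prime_card padic measure \<Rightarrow> bool" where
  "is_haar \<mu> \<longleftrightarrow> sets \<mu> = sets borel \<and>
     (\<forall>a. \<forall>A\<in>sets borel. emeasure \<mu> ((\<lambda>x. a + x) ` A) = emeasure \<mu> A) \<and>
     emeasure \<mu> {x. padic_abs x \<le> 1} = 1"

text \<open>
  Elements of $L^2$ are represented by functions, not by classes modulo null sets. Closures, and
  hence closed subspaces, contain with a function all square integrable functions equal to it
  almost everywhere.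
\<close>

definition L2 :: "'a measure \<Rightarrow> ('a \<Rightarrow> complex) set" where
  "L2 \<mu> = {f \<in> borel_measurable \<mu>. integrable \<mu> (\<lambda>x. (cmod (f x))\<^sup>2)}"

definition L2_norm :: "'a measure \<Rightarrow> ('a \<Rightarrow> complex) \<Rightarrow> real" where
  "L2_norm \<mu> f = sqrt (LINT x|\<mu>. (cmod (f x))\<^sup>2)"

definition L2_inner :: "'a measure \<Rightarrow> ('a \<Rightarrow> complex) \<Rightarrow> ('a \<Rightarrow> complex) \<Rightarrow> complex" where
  "L2_inner \<mu> f g = (LINT x|\<mu>. f x * cnj (g x))"

definition L2_closure :: "'a measure \<Rightarrow> ('a \<Rightarrow> complex) set \<Rightarrow> ('a \<Rightarrow> complex) set" where
  "L2_closure \<mu> S = {f \<in> L2 \<mu>. \<forall>e>0. \<exists>g \<in> S \<inter> L2 \<mu>. L2_norm \<mu> (f - g) < e}"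

global_interpretation cfun: vector_space "\<lambda>(c::complex) (f::'a \<Rightarrow> complex) x. c * f x"
  by standard (auto simp: fun_eq_iff algebra_simps)

definition L2_closed_subspace :: "'a measure \<Rightarrow> ('a \<Rightarrow> complex) set \<Rightarrow> bool" where
  "L2_closed_subspace \<mu> V \<longleftrightarrow> V \<subseteq> L2 \<mu> \<and> cfun.subspace V \<and> L2_closure \<mu> V = V"

definition L2_orthonormal_basis ::
    "'a measure \<Rightarrow> 'i set \<Rightarrow> ('i \<Rightarrow> 'a \<Rightarrow> complex) \<Rightarrow> ('a \<Rightarrow> complex) set \<Rightarrow> bool" where
  "L2_orthonormal_basis \<mu> I e V \<longleftrightarrow>
     (\<forall>i\<in>I. e i \<in> V) \<and>
     (\<forall>i\<in>I. \<forall>k\<in>I. L2_inner \<mu> (e i) (e k) = (if i = k then 1 else 0)) \<and>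
     L2_closure \<mu> (cfun.span (e ` I)) = V"


section \<open>Fourier transform\<close>

definition padic_test_function :: "('p::prime_card padic \<Rightarrow> complex) \<Rightarrow> bool" where
  "padic_test_function f \<longleftrightarrow>
     (\<forall>x. \<exists>e>0. \<forall>y\<in>ball x e. f y = f x) \<and> compact (closure {x. f x \<noteq> 0})"

definition padic_fourier ::
    "'p::prime_card padic measure \<Rightarrow> ('p padic \<Rightarrow> complex) \<Rightarrow> 'p padic \<Rightarrow> complex" where
  "padic_fourier \<mu> f \<xi> = (LINT x|\<mu>. padic_char (\<xi> * x) * f x)"

text \<open>
  \<open>is_fourier_L2 \<mu> f g\<close> says that \<open>g\<close> is a version of the Fourier transform of \<open>f\<close>, the continuous
  extension of \<^const>\<open>padic_fourier\<close> from the dense subspace of test functions to $L^2$.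
\<close>

definition is_fourier_L2 ::
    "'p::prime_card padic measure \<Rightarrow> ('p padic \<Rightarrow> complex) \<Rightarrow> ('p padic \<Rightarrow> complex) \<Rightarrow> bool" where
  "is_fourier_L2 \<mu> f g \<longleftrightarrow> f \<in> L2 \<mu> \<and> g \<in> L2 \<mu> \<and>
     (\<exists>h. (\<forall>n::nat. padic_test_function (h n)) \<and>
          (\<lambda>n. L2_norm \<mu> (h n - f)) \<longlonglongrightarrow> 0 \<and>
          (\<lambda>n. L2_norm \<mu> (padic_fourier \<mu> (h n) - g)) \<longlonglongrightarrow> 0)"


section \<open>Multiresolution analysis\<close>

definition is_MRA ::
    "'p::prime_card padic measure \<Rightarrow> (int \<Rightarrow> ('p padic \<Rightarrow> complex) set) \<Rightarrow> bool" where
  "is_MRA \<mu> V \<longleftrightarrow>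
     (\<forall>j. L2_closed_subspace \<mu> (V j)) \<and>
     (\<forall>j. V j \<subseteq> V (j + 1)) \<and>
     L2_closure \<mu> (\<Union>j. V j) = L2 \<mu> \<and>
     (\<Inter>j. V j) = {f \<in> L2 \<mu>. AE x in \<mu>. f x = 0} \<and>
     (\<forall>j f. f \<in> V j \<longleftrightarrow> (\<lambda>x. f (inverse (of_nat CARD('p)) * x)) \<in> V (j + 1)) \<and>
     (\<exists>g \<in> V 0. L2_orthonormal_basis \<mu> padic_shifts (\<lambda>a x. g (x - a)) (V 0))"

definition MRA_spaces ::
    "'p::prime_card padic measure \<Rightarrow> ('p padic \<Rightarrow> complex) \<Rightarrow> int \<Rightarrow> ('p padic \<Rightarrow> complex) set" where
  "MRA_spaces \<mu> \<phi> j = L2_closure \<mu> (cfun.span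
     ((\<lambda>a x. \<phi> (of_nat CARD('p) powi (- j) * x - a)) ` padic_shifts))"

definition padic_mask :: "nat \<Rightarrow> (nat \<Rightarrow> complex) \<Rightarrow> 'p::prime_card padic \<Rightarrow> complex" where
  "padic_mask s \<beta> \<xi> =
     1 / of_nat CARD('p) * (\<Sum>k = 0..CARD('p) ^ s - 1. \<beta> k * padic_char (of_nat k * \<xi>))"

end

theory Submission
  imports Defs
begin

text \<open>
  Let $N = s - 1$. The mask is $\mathbb{Z}_p$-periodic
  and equals $1$ on $\mathbb{Z}_p$, so the infinite product is a finite one at each point; the
  conditions on $m_0(k/p^s)$ say that $|\widehat\phi| = |\widehat\phi(0)| \cdot 1_{\mathbb{Z}_p}$,
  and $\widehat\phi$ is $p^N\mathbb{Z}_p$-periodic. Hence $\phi$ is a.e. equal to a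
  $\mathbb{Z}_p$-periodic function $\phi_0$ supported in $p^{-N}\mathbb{Z}_p$. On the finite group
  $p^{-N}\mathbb{Z}_p/\mathbb{Z}_p$ its discrete Fourier transform has constant modulus, so its
  autocorrelation is a multiple of the delta function. This identity yields both the orthogonality
  of the shifts of $\phi$ and, read as an expansion, $1_{\mathbb{Z}_p}$ as a finite
  linear combination of these shifts. Consequently $V_j$ is the space of all square integrable functions
  that are a.e. constant on the cosets of $p^j\mathbb{Z}_p$, for which the axioms can be read off.
\<close>

section \<open>Arithmetic of the $p$-adic numbers\<close>

text \<open>The points k/p^s represent p^(-s)Z_p modulo Z_p, and p divides k exactly when k/p^s lies
  in p^(1-s)Z_p. For xi in Z_p every argument in the product lies in that subgroup, so every factor
  has modulus 1. If |xi| = p^n with n >= 1, the n-th argument has absolute value p^s, and its factor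
  vanishes. The exponent s - 1 comes from the first factor, which divides xi by p^(s-1). The L2
  Fourier transform enters through its injectivity, for which the Plancherel identity on step
  functions is enough. That identity is Parseval on a finite cyclic group, since step functions and
  their transforms are both finite combinations of cosets. The shifts I_p represent Q_p/Z_p, so V_0
  contains every translate of phi_0, and the expansion of the indicator of Z_p can be moved to any
  coset. Elements of L2 are functions here, and phi agrees with phi_0 only almost everywhere.
  Closures absorb this, which is why V_j is described by constancy almost everywhere. The norm of
  phi is the modulus of its transform at 0, so the orthonormal basis is generated by a rescaling of
  phi that spans the same spaces.\<close>

abbreviation unif :: "'p::prime_card padic" where "unif \<equiv> of_nat CARD('p)"

lemma CARD_ge_2: "CARD('p::prime_card) \<ge> 2"
  using prime_card[where 'a='p] by (rule prime_ge_2_nat)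

lemma CARD_pos [simp]: "CARD('p::prime_card) > 0"
  using CARD_ge_2[where 'p='p] by linarith

lemma CARD_nz [simp]: "CARD('p::prime_card) \<noteq> 0"
  using CARD_pos[where 'p='p] by simp

lemma CARD_real_gt_1: "real CARD('p::prime_card) > 1"
  using CARD_ge_2[where 'p='p] by linarith

section \<open>The rationals inside Q_p and their density\<close>

lift_definition padic_of_rat :: "rat \<Rightarrow> 'p::prime_card padic" is pc_const .

lemma padic_of_rat_add: "(padic_of_rat (x + y) :: 'p::prime_card padic) = padic_of_rat x + padic_of_rat y"
  by (transfer, transfer) (simp add: pvanishes_const[OF prime_card])

lemma padic_of_rat_mult: "(padic_of_rat (x * y) :: 'p::prime_card padic) = padic_of_rat x * padic_of_rat y"
  by (transfer, transfer) (simp add: pvanishes_const[OF prime_card])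

lemma padic_of_rat_0: "(padic_of_rat 0 :: 'p::prime_card padic) = 0"
  by (simp add: zero_padic_def padic_of_rat_def)

lemma padic_of_rat_1: "(padic_of_rat 1 :: 'p::prime_card padic) = 1"
  by (simp add: one_padic_def padic_of_rat_def)

lemma padic_of_rat_of_nat: "(padic_of_rat (of_nat n) :: 'p::prime_card padic) = of_nat n"
  by (induction n) (simp_all add: padic_of_rat_add padic_of_rat_0 padic_of_rat_1)

lemma padic_of_rat_minus: "(padic_of_rat (- x) :: 'p::prime_card padic) = - padic_of_rat x"
  using padic_of_rat_add[of x "-x", where 'p='p]
  by (simp add: padic_of_rat_0 eq_neg_iff_add_eq_0 add.commute)

lemma padic_of_rat_of_int: "(padic_of_rat (of_int n) :: 'p::prime_card padic) = of_int n"
proof (cases "n \<ge> 0")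
  case True
  thus ?thesis using padic_of_rat_of_nat[of "nat n", where 'p='p] by simp
next
  case False
  hence "n = - int (nat (- n))" by simp
  thus ?thesis using padic_of_rat_of_nat[of "nat (- n)", where 'p='p]
    by (metis of_int_minus of_int_of_nat_eq padic_of_rat_minus)
qed

lemma padic_abs_of_rat: "padic_abs (padic_of_rat r :: 'p::prime_card padic) = rat_pabs CARD('p) r"
proof transfer
  fix r
  show "pc_norm (pc_const r :: 'p padic_cauchy) = rat_pabs CARD('p) r"
    using pc_norm_tendsto[of "pc_const r :: 'p padic_cauchy"]
    by (simp add: pc_const.rep_eq LIMSEQ_const_iff)
qed

lemma padic_abs_of_int: "padic_abs (of_int k :: 'p::prime_card padic) = rat_pabs CARD('p) (of_int k)"
  by (metis padic_abs_of_rat padic_of_rat_of_int)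

text \<open>A late term of a representing Cauchy sequence is the approximation. The limit that
  defines the absolute value preserves only weak inequalities, hence the margin
  \<open>e / 2\<close>.\<close>

lemma padic_of_rat_dense:
  fixes x :: "'p::prime_card padic"
  assumes "e > 0"
  shows "\<exists>r. padic_abs (x - padic_of_rat r) < e"
  \<comment> \<open>Subtraction is not itself lifted; unfolding it exposes the lifted addition and
    negation to transfer.\<close>
  using assms unfolding minus_padic_def
proof (transfer fixing: e)
  fix X :: "'p padic_cauchy"
  assume e: "e > 0"
  have X: "pcauchy CARD('p) (Rep_padic_cauchy X)" using Rep_padic_cauchy[of X] by simp
  obtain N where N: "\<And>m n. m \<ge> N \<Longrightarrow> n \<ge> N \<Longrightarrow> rat_pabs CARD('p) (Rep_padic_cauchy X m - Rep_padic_cauchy X n) < e / 2"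
    using X e unfolding pcauchy_def by (metis half_gt_zero)
  let ?Y = "pc_add X (pc_minus (pc_const (Rep_padic_cauchy X N)))"
  have "pc_norm ?Y \<le> e / 2"
  proof (rule LIMSEQ_le_const2[OF pc_norm_tendsto])
    show "\<exists>M. \<forall>n\<ge>M. rat_pabs CARD('p) (Rep_padic_cauchy ?Y n) \<le> e / 2"
      using N by (intro exI[of _ N]) (auto simp: pc_add.rep_eq pc_minus.rep_eq pc_const.rep_eq less_imp_le)
  qed
  thus "\<exists>r. pc_norm (pc_add X (pc_minus (pc_const r))) < e"
    using e by (intro exI[of _ "Rep_padic_cauchy X N"]) linarith
qed

lemma of_nat_padic_eq_0_iff: "of_nat n = (0 :: 'p::prime_card padic) \<longleftrightarrow> n = 0"
proof -
  have "of_nat n = (0 :: 'p padic) \<longleftrightarrow> padic_abs (of_int (int n) :: 'p padic) = 0"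
    by (simp only: padic_abs_eq_0_iff of_int_of_nat_eq)
  also have "\<dots> \<longleftrightarrow> n = 0" by (simp only: padic_abs_of_int rat_pabs_eq_0_iff[OF prime_card]) simp
  finally show ?thesis .
qed

lemma unif_nz [simp]: "(unif :: 'p::prime_card padic) \<noteq> 0"
  by (simp add: of_nat_padic_eq_0_iff)

lemma padic_abs_1 [simp]: "padic_abs (1 :: 'p::prime_card padic) = 1"
  using padic_abs_of_int[of 1, where 'p='p] by simp

lemma padic_abs_0 [simp]: "padic_abs (0 :: 'p::prime_card padic) = 0"
  by (simp add: padic_abs_eq_0_iff)

lemma padic_abs_inverse: "padic_abs (inverse x :: 'p::prime_card padic) = inverse (padic_abs x)"
proof (cases "x = 0")
  case False
  hence "padic_abs x * padic_abs (inverse x) = 1" by (simp flip: padic_abs_mult)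
  thus ?thesis by (metis inverse_unique)
qed auto

lemma padic_abs_power: "padic_abs (x ^ n :: 'p::prime_card padic) = padic_abs x ^ n"
  by (induction n) (simp_all add: padic_abs_mult)

lemma padic_abs_powi: "padic_abs (x powi n :: 'p::prime_card padic) = padic_abs x powi n"
  by (simp add: power_int_def padic_abs_power padic_abs_inverse)

lemma padic_abs_unif: "padic_abs (unif :: 'p::prime_card padic) = inverse (real CARD('p))"
proof -
  have "padic_abs (unif :: 'p padic) = rat_pabs CARD('p) (of_int (int CARD('p)) / of_int 1)"
    using padic_abs_of_int[of "int CARD('p)", where 'p='p] by simp
  also have "\<dots> = real CARD('p) powi (int (multiplicity (int CARD('p)) 1) - int (multiplicity (int CARD('p)) (int CARD('p))))"
    by (rule rat_pabs_frac[OF prime_card]) auto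
  also have "multiplicity (int CARD('p)) (int CARD('p)) = 1"
    using prime_card[where 'a='p] by (intro multiplicity_self) (auto simp: prime_gt_1_nat dest: prime_gt_1_nat)
  finally show ?thesis by (simp add: power_int_minus)
qed

text \<open>The subgroup $p^n\mathbb{Z}_p$; it shrinks as \<open>n\<close> grows.\<close>

definition pball :: "int \<Rightarrow> 'p::prime_card padic set" where
  "pball n = {x. padic_abs x \<le> real CARD('p) powi (- n)}"

lemma pball_0 [simp]: "0 \<in> pball n" by (simp add: pball_def)

lemma pball_minus_iff [simp]: "- x \<in> pball n \<longleftrightarrow> x \<in> pball n"
  by (simp add: pball_def padic_abs_minus)

lemma pball_add: "x \<in> pball n \<Longrightarrow> y \<in> pball n \<Longrightarrow> x + y \<in> pball n"
  using padic_abs_ultrametric[of x y] by (auto simp: pball_def)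

lemma pball_diff: "x \<in> pball n \<Longrightarrow> y \<in> pball n \<Longrightarrow> x - y \<in> pball n"
  using pball_add[of x n "- y"] by simp

lemma pball_add_iff: "x \<in> pball n \<Longrightarrow> x + y \<in> pball n \<longleftrightarrow> y \<in> pball n"
  using pball_add[of x n y] pball_diff[of "x + y" n x] by auto

lemma pball_add_iff': "y \<in> pball n \<Longrightarrow> x + y \<in> pball n \<longleftrightarrow> x \<in> pball n"
  using pball_add_iff[of y n x] by (simp add: add.commute)

lemma pball_diff_commute: "x - y \<in> pball n \<longleftrightarrow> y - x \<in> pball n"
  using pball_minus_iff[of "x - y" n] by simp

lemma CARD_powi_le_iff: "real CARD('p::prime_card) powi m \<le> real CARD('p) powi n \<longleftrightarrow> m \<le> n"
  using CARD_real_gt_1[where 'p='p] power_int_increasing[of m n "real CARD('p)"]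
    power_int_strict_increasing[of n m "real CARD('p)"] by force

lemma pball_mono: "m \<le> n \<Longrightarrow> pball n \<subseteq> (pball m :: 'p::prime_card padic set)"
  by (auto simp: pball_def CARD_powi_le_iff elim!: order_trans)

lemma pball_monoD: "x \<in> pball n \<Longrightarrow> m \<le> n \<Longrightarrow> x \<in> pball m"
  using pball_mono by blast

lemma pball_mult: "x \<in> pball m \<Longrightarrow> y \<in> pball n \<Longrightarrow> x * y \<in> (pball (m + n) :: 'p::prime_card padic set)"
  using CARD_real_gt_1[where 'p='p]
  by (auto simp: pball_def padic_abs_mult power_int_add power_int_diff divide_inverse power_int_minus
      intro!: mult_mono padic_abs_nonneg)

lemma padic_abs_unif_powi: "padic_abs (unif powi k :: 'p::prime_card padic) = real CARD('p) powi (- k)"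
  by (simp add: padic_abs_powi padic_abs_unif power_int_minus power_int_inverse)

text \<open>The factor has absolute value exactly p^(-k), so membership shifts by k in both
  directions. Later arguments about dilation and division by powers of p go through this
  equivalence.\<close>

lemma pball_powi_mult_iff:
  "unif powi k * x \<in> pball n \<longleftrightarrow> x \<in> (pball (n - k) :: 'p::prime_card padic set)"
proof -
  have "padic_abs x \<le> real CARD('p) powi (k - n) \<longleftrightarrow>
    real CARD('p) powi (- k) * padic_abs x \<le> real CARD('p) powi (- k) * real CARD('p) powi (k - n)"
    by (simp add: mult_le_cancel_left_pos zero_less_power_int)
  also have "real CARD('p) powi (- k) * real CARD('p) powi (k - n) = real CARD('p) powi (- n)"
    by (subst power_int_add[symmetric]) auto
  finally show ?thesis by (simp add: pball_def padic_abs_mult padic_abs_unif_powi)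
qed

lemma unif_powi_pball_iff: "(unif powi k :: 'p::prime_card padic) \<in> pball n \<longleftrightarrow> n \<le> k"
  by (simp add: pball_def padic_abs_unif_powi CARD_powi_le_iff)

lemma pball_exhaust: "\<exists>n::nat. x \<in> (pball (- int n) :: 'p::prime_card padic set)"
proof -
  obtain n where "padic_abs x < real CARD('p) ^ n"
    using real_arch_pow[OF CARD_real_gt_1] by blast
  thus ?thesis by (intro exI[of _ n]) (simp add: pball_def)
qed

section \<open>Representatives of the cosets of p^m Z_p\<close>

text \<open>The absolute value of a nonzero integer is p to the minus its multiplicity. This carries
  p-adic closeness over to divisibility in the integers.\<close>

lemma of_int_pball_iff: "(of_int k :: 'p::prime_card padic) \<in> pball (int m) \<longleftrightarrow> int CARD('p) ^ m dvd k"
proof (cases "k = 0")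
  case False
  have "padic_abs (of_int k :: 'p padic) = rat_pabs CARD('p) (of_int k / of_int 1)"
    by (simp add: padic_abs_of_int)
  also have "\<dots> = real CARD('p) powi (int (multiplicity (int CARD('p)) 1) - int (multiplicity (int CARD('p)) k))"
    using False by (intro rat_pabs_frac[OF prime_card]) auto
  finally have e: "padic_abs (of_int k :: 'p padic) = real CARD('p) powi (- int (multiplicity (int CARD('p)) k))" by simp
  have "(of_int k :: 'p padic) \<in> pball (int m) \<longleftrightarrow> m \<le> multiplicity (int CARD('p)) k"
    unfolding pball_def mem_Collect_eq e by (simp add: CARD_powi_le_iff)
  also have "\<dots> \<longleftrightarrow> int CARD('p) ^ m dvd k"
    using False CARD_ge_2[where 'p='p] by (subst power_dvd_iff_le_multiplicity) auto
  finally show ?thesis .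
qed auto

lemma of_int_pball_0 [simp]: "(of_int k :: 'p::prime_card padic) \<in> pball 0"
  using of_int_pball_iff[of k 0] by simp

lemma of_nat_pball_0 [simp]: "(of_nat k :: 'p::prime_card padic) \<in> pball 0"
  using of_int_pball_0[of "int k"] by simp

lemma of_nat_diff_pball_iff:
  assumes "k < CARD('p) ^ m" "l < CARD('p) ^ m"
  shows "(of_nat k - of_nat l :: 'p::prime_card padic) \<in> pball (int m) \<longleftrightarrow> k = l"
proof -
  have "(of_nat k - of_nat l :: 'p padic) \<in> pball (int m) \<longleftrightarrow> int CARD('p) ^ m dvd int k - int l"
    using of_int_pball_iff[of "int k - int l" m, where 'p='p] by simp
  also have "\<dots> \<longleftrightarrow> int k mod (int CARD('p) ^ m) = int l mod (int CARD('p) ^ m)"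
    by (simp add: mod_eq_dvd_iff)
  also have "\<dots> \<longleftrightarrow> k = l" using assms by (simp flip: of_nat_power of_nat_mod)
  finally show ?thesis .
qed

text \<open>A rational a/b in lowest terms close to x is itself a p-adic integer. Then p cannot
  divide b, since it would divide a = b * y as well. So b has an inverse c modulo p^m, and the
  residue of a * c is the required k.\<close>

lemma padic_int_approx:
  fixes x :: "'p::prime_card padic"
  assumes x: "x \<in> pball 0"
  shows "\<exists>k<CARD('p) ^ m. x - of_nat k \<in> pball (int m)"
proof -
  obtain r where r: "padic_abs (x - padic_of_rat r) < real CARD('p) powi (- int m)"
    using padic_of_rat_dense[of "real CARD('p) powi (- int m)" x] by (auto simp: zero_less_power_int)
  hence xr: "x - padic_of_rat r \<in> pball (int m)" by (simp add: pball_def)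
  obtain a b where ab: "quotient_of r = (a, b)" by force
  have b: "b > 0" using quotient_of_denom_pos[OF ab] .
  have cop: "coprime a b" using quotient_of_coprime[OF ab] .
  have rab: "r = of_int a / of_int b" using quotient_of_div[OF ab] .
  define y :: "'p padic" where "y = padic_of_rat r"
  have y: "of_int b * y = of_int a"
    unfolding y_def using rab b by (simp flip: padic_of_rat_of_int padic_of_rat_mult)
  have "x - y \<in> pball 0" using xr pball_monoD[of _ "int m" 0] by (simp add: y_def)
  hence y0: "y \<in> pball 0" using pball_diff[OF x, of "x - y"] by simp
  have pb: "\<not> int CARD('p) dvd b"
  proof
    assume "int CARD('p) dvd b"
    moreover from this have "(of_int b :: 'p padic) \<in> pball 1" using of_int_pball_iff[of b 1, where 'p='p] by simp
    hence "(of_int a :: 'p padic) \<in> pball 1" using pball_mult[OF _ y0, of "of_int b" 1] y by simp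
    hence "int CARD('p) dvd a" using of_int_pball_iff[of a 1, where 'p='p] by simp
    ultimately have "is_unit (int CARD('p))" using cop by (metis coprime_common_divisor)
    thus False using CARD_ge_2[where 'p='p] by auto
  qed
  have "coprime (int CARD('p)) b"
    using pb prime_card[where 'a='p] by (intro prime_imp_coprime) auto
  hence "coprime b (int CARD('p) ^ m)" by (simp add: coprime_commute)
  \<comment> \<open>Bezout: c inverts b modulo p^m.\<close>
  then obtain c v where c: "c * b + v * int CARD('p) ^ m = 1" using bezout_int[of b] by (metis coprime_iff_gcd_eq_1)
  define M where "M = int CARD('p) ^ m"
  have M: "M > 0" by (simp add: M_def)
  define k where "k = nat (a * c mod M)"
  have k: "int k = a * c mod M" using M by (simp add: k_def)
  have "k < CARD('p) ^ m"
    using M pos_mod_bound[of M "a * c"] k unfolding M_def by (metis of_nat_less_iff of_nat_power)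
  moreover have "x - of_nat k \<in> pball (int m)"
  proof -
    have "1 - b * c = v * M" using c by (simp add: M_def algebra_simps)
    hence bc: "(of_int (1 - b * c) :: 'p padic) \<in> pball (int m)" unfolding of_int_pball_iff M_def by simp
    have "y * of_int (1 - b * c) \<in> pball (0 + int m)" by (rule pball_mult[OF y0 bc])
    also have "y * of_int (1 - b * c) = y - of_int (a * c)"
      using y by (simp add: algebra_simps flip: mult.assoc)
    finally have 1: "y - of_int (a * c) \<in> pball (int m)" by simp
    have "M dvd a * c - int k" by (simp add: k minus_mod_eq_mult_div)
    hence "(of_int (a * c - int k) :: 'p padic) \<in> pball (int m)" unfolding of_int_pball_iff M_def .
    from pball_add[OF pball_add[OF xr[folded y_def] 1] this] show ?thesis by simp
  qed
  ultimately show ?thesis by blast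
qed

text \<open>Multiplication by p^n reduces this to \<open>padic_int_approx\<close>. Together with
  \<open>padic_approx_unique\<close> it says that the fractions k/p^n with k < p^(n+m) meet every
  coset of p^m Z_p in p^(-n)Z_p exactly once; the finite sums below run over these
  representatives.\<close>

lemma padic_approx:
  fixes x :: "'p::prime_card padic"
  assumes x: "x \<in> pball (- int n)"
  shows "\<exists>k<CARD('p) ^ (n + m). x - of_nat k / unif ^ n \<in> pball (int m)"
proof -
  have "unif powi int n * x \<in> pball 0" using x by (subst pball_powi_mult_iff) simp
  from padic_int_approx[OF this, of "n + m"]
  obtain k where k: "k < CARD('p) ^ (n + m)" "unif powi int n * x - of_nat k \<in> pball (int (n + m))" by blast
  have "unif powi int n * (x - of_nat k / unif ^ n) = unif powi int n * x - of_nat k" by (simp add: algebra_simps)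
  hence "x - of_nat k / unif ^ n \<in> pball (int (n + m) - int n)"
    using k(2) pball_powi_mult_iff by metis
  thus ?thesis using k(1) by auto
qed

lemma padic_approx_unique:
  fixes x :: "'p::prime_card padic"
  assumes kl: "k < CARD('p) ^ (n + m)" "l < CARD('p) ^ (n + m)"
    and x: "x - of_nat k / unif ^ n \<in> pball (int m)" "x - of_nat l / unif ^ n \<in> pball (int m)"
  shows "k = l"
proof -
  have "unif powi int n * (of_nat k / unif ^ n - of_nat l / unif ^ n) = (of_nat k - of_nat l :: 'p padic)"
    by (simp add: algebra_simps)
  moreover have "of_nat k / unif ^ n - of_nat l / unif ^ n \<in> (pball (int m) :: 'p padic set)"
    using pball_diff[OF x(2) x(1)] by simp
  ultimately have "(of_nat k - of_nat l :: 'p padic) \<in> pball (int (n + m))"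
    using pball_powi_mult_iff[of "int n" "of_nat k / unif ^ n - of_nat l / unif ^ n :: 'p padic" "int (n + m)"]
    by simp
  thus ?thesis using of_nat_diff_pball_iff[OF kl] by simp
qed

lemma frac_pball: "of_nat k / unif ^ n \<in> (pball (- int n) :: 'p::prime_card padic set)"
  using pball_powi_mult_iff[of "int n" "of_nat k / unif ^ n :: 'p padic" 0] by simp

section \<open>Fractional part and additive character\<close>

text \<open>Here \<open>d z\<close> is the leading digit of z, meaningful for z in Z_p only, and
  \<open>Y n\<close> is what remains of y after n digits have been removed and the rest divided by
  p^n. It never leaves Z_p.\<close>

lemma padic_digit_expansion:
  fixes y :: "'p::prime_card padic"
  assumes y: "y \<in> pball 0"
  shows "\<exists>a::nat \<Rightarrow> nat. (\<forall>j. a j < CARD('p)) \<and> (\<forall>n. y - (\<Sum>j<n. of_nat (a j) * unif ^ j) \<in> pball (int n))"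
proof -
  define d :: "'p padic \<Rightarrow> nat" where "d z = (SOME k. k < CARD('p) \<and> z - of_nat k \<in> pball 1)" for z
  have d: "d z < CARD('p) \<and> z - of_nat (d z) \<in> pball 1" if "z \<in> pball 0" for z
    unfolding d_def by (rule someI_ex) (use padic_int_approx[OF that, of 1] in simp)
  define Y where "Y n = ((\<lambda>z. (z - of_nat (d z)) / unif) ^^ n) y" for n
  have YS: "Y (Suc n) = (Y n - of_nat (d (Y n))) / unif" for n by (simp add: Y_def)
  have Y0: "Y n \<in> pball 0" for n
  proof (induction n)
    case (Suc n)
    have "unif powi 1 * Y (Suc n) \<in> pball 1" using d[OF Suc] by (simp add: YS)
    thus ?case by (subst (asm) pball_powi_mult_iff) simp
  qed (simp add: Y_def y)
  have "y - (\<Sum>j<n. of_nat (d (Y j)) * unif ^ j) = unif ^ n * Y n" for n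
  proof (induction n)
    case (Suc n)
    have "unif ^ Suc n * Y (Suc n) = unif ^ n * Y n - of_nat (d (Y n)) * unif ^ n"
      by (simp add: YS field_simps)
    thus ?case using Suc by (simp add: algebra_simps)
  qed (simp add: Y_def)
  moreover have "unif ^ n * Y n \<in> pball (int n)" for n
    using pball_powi_mult_iff[of "int n" "Y n" "int n"] Y0 by simp
  ultimately show ?thesis using d Y0 by (intro exI[of _ "\<lambda>j. d (Y j)"]) auto
qed

lemma digit_sum_less:
  assumes "\<And>j. j < n \<Longrightarrow> a j < (q::nat)"
  shows "(\<Sum>j<n. a j * q ^ j) < q ^ n"
  using assms
proof (induction n)
  case (Suc n)
  have "(\<Sum>j<Suc n. a j * q ^ j) < q ^ n + a n * q ^ n" using Suc by simp
  also have "\<dots> = (a n + 1) * q ^ n" by (simp add: algebra_simps)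
  also have "\<dots> \<le> q * q ^ n" using Suc.prems[of n] by (intro mult_right_mono) auto
  finally show ?case by simp
qed auto

lemma digit_sum_exists:
  assumes "k < (q::nat) ^ n"
  shows "\<exists>a. (\<forall>j<n. a j < q) \<and> (\<Sum>j<n. a j * q ^ j) = k"
  using assms
proof (induction n arbitrary: k)
  case (Suc n)
  have q: "q > 0" using Suc.prems by (cases "q = 0") auto
  have "k mod q ^ n < q ^ n" using q by simp
  then obtain a where a: "\<forall>j<n. a j < q" "(\<Sum>j<n. a j * q ^ j) = k mod q ^ n" using Suc.IH by blast
  have kd: "k div q ^ n < q" using Suc.prems by (simp add: less_mult_imp_div_less)
  have "(\<Sum>j<n. (a(n := k div q ^ n)) j * q ^ j) = (\<Sum>j<n. a j * q ^ j)" by (intro sum.cong) auto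
  hence "(\<Sum>j<Suc n. (a(n := k div q ^ n)) j * q ^ j) = k" using a(2) by (simp add: mod_div_mult_eq)
  thus ?case using a(1) kd by (intro exI[of _ "a(n := k div q ^ n)"]) auto
qed auto

lemma sum_powi_shift:
  fixes P :: "'a::field"
  assumes "P \<noteq> 0"
  shows "(\<Sum>j<n. of_nat (a j) * P powi (int j - int \<gamma>)) = (\<Sum>j<n. of_nat (a j) * P ^ j) / P ^ \<gamma>"
  using assms by (simp add: sum_divide_distrib power_int_diff)

text \<open>Digit strings of length n are the base-p expansions of the numbers below p^n, so a
  single numerator replaces the string.\<close>

lemma padic_shifts_eq: "padic_shifts = {of_nat k / unif ^ n :: 'p::prime_card padic |k n. k < CARD('p) ^ n}"
proof (intro equalityI subsetI)
  fix x :: "'p padic" assume "x \<in> padic_shifts"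
  then obtain n a where a: "\<forall>j<n. a j < CARD('p)"
    and x: "x = unif powi (- int n) * (\<Sum>j<n. of_nat (a j) * unif ^ j)"
    unfolding padic_shifts_def by blast
  have "x = of_nat (\<Sum>j<n. a j * CARD('p) ^ j) / unif ^ n"
    by (simp add: x power_int_minus divide_inverse)
  thus "x \<in> {of_nat k / unif ^ n |k n. k < CARD('p) ^ n}" using digit_sum_less a by blast
next
  fix x :: "'p padic" assume "x \<in> {of_nat k / unif ^ n |k n. k < CARD('p) ^ n}"
  then obtain k n where k: "k < CARD('p) ^ n" "x = of_nat k / unif ^ n" by blast
  obtain a where a: "\<forall>j<n. a j < CARD('p)" "(\<Sum>j<n. a j * CARD('p) ^ j) = k"
    using digit_sum_exists[OF k(1)] by blast
  have "x = unif powi (- int n) * (\<Sum>j<n. of_nat (a j) * unif ^ j)"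
    by (simp add: k(2) power_int_minus divide_inverse flip: a(2))
  thus "x \<in> padic_shifts" using a(1) unfolding padic_shifts_def by blast
qed

text \<open>Shifts meet every coset of Z_p, so for a Z_p-periodic function every translate equals a
  translate by some shift.\<close>

lemma padic_shift_exists:
  fixes x :: "'p::prime_card padic"
  shows "\<exists>a\<in>padic_shifts. x - a \<in> pball 0"
proof -
  obtain n where "x \<in> pball (- int n)" using pball_exhaust by blast
  from padic_approx[OF this, of 0] show ?thesis unfolding padic_shifts_eq by fastforce
qed

section \<open>Fractional parts as real numbers modulo 1\<close>

lemma frac_extend:
  assumes "m \<le> n"
  shows "of_int k / unif ^ m = (of_int (k * int CARD('p) ^ (n - m)) / unif ^ n :: 'p::prime_card padic)"
proof -
  have "(unif :: 'p padic) ^ n = unif ^ m * unif ^ (n - m)" using assms by (simp flip: power_add)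
  thus ?thesis by simp
qed

lemma real_frac_extend:
  assumes "m \<le> n"
  shows "of_int k / real CARD('p::prime_card) ^ m = of_int (k * int CARD('p) ^ (n - m)) / real CARD('p) ^ n"
proof -
  have "real CARD('p) ^ n = real CARD('p) ^ m * real CARD('p) ^ (n - m)" using assms by (simp flip: power_add)
  thus ?thesis by simp
qed

text \<open>Both sides say that p^n divides k. This is the bridge between the p-adic fraction and
  the real fraction with the same numerator and denominator.\<close>

lemma frac_pball_0_iff:
  "(of_int k / unif ^ n :: 'p::prime_card padic) \<in> pball 0 \<longleftrightarrow> of_int k / real CARD('p) ^ n \<in> \<int>"
proof -
  have "unif powi (- int n) * of_int k \<in> (pball 0 :: 'p padic set) \<longleftrightarrow> of_int k \<in> (pball (int n) :: 'p padic set)"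
    by (subst pball_powi_mult_iff) simp
  hence "(of_int k / unif ^ n :: 'p padic) \<in> pball 0 \<longleftrightarrow> int CARD('p) ^ n dvd k"
    by (simp only: of_int_pball_iff power_int_minus divide_inverse mult.commute power_int_of_nat)
  also have "\<dots> \<longleftrightarrow> of_int k / of_int (int CARD('p) ^ n) \<in> (\<int> :: real set)"
    using CARD_pos[where 'p='p] by (subst of_int_div_of_int_in_Ints_iff) (simp del: CARD_pos)
  finally show ?thesis by simp
qed

text \<open>Over a common denominator the difference of the two fractions is a p-adic integer, hence
  an ordinary one. So the real fraction attached to x is well defined modulo 1.\<close>

lemma frac_diff_pball_0:
  assumes "x - of_int k / unif ^ m \<in> pball 0" "(x :: 'p::prime_card padic) - of_int l / unif ^ n \<in> pball 0"
  shows "of_int k / real CARD('p) ^ m - of_int l / real CARD('p) ^ n \<in> \<int>"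
proof -
  define N where "N = max m n"
  define k' l' where "k' = k * int CARD('p) ^ (N - m)" and "l' = l * int CARD('p) ^ (N - n)"
  have "of_int l / unif ^ n - of_int k / unif ^ m \<in> (pball 0 :: 'p padic set)"
    using pball_diff[OF assms] by simp
  hence "of_int (k' - l') / unif ^ N \<in> (pball 0 :: 'p padic set)"
    using frac_extend[of m N k, where 'p='p] frac_extend[of n N l, where 'p='p]
    by (simp add: N_def k'_def l'_def diff_divide_distrib pball_diff_commute)
  hence "of_int (k' - l') / real CARD('p) ^ N \<in> \<int>" unfolding frac_pball_0_iff .
  thus ?thesis
    using real_frac_extend[of m N k, where 'p='p] real_frac_extend[of n N l, where 'p='p]
    by (simp add: N_def k'_def l'_def diff_divide_distrib)
qed

text \<open>Resolves the definite description in \<open>padic_frac\<close>. Existence comes from a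
  digit expansion; for uniqueness, any admissible value is a fraction in [0, 1) congruent to x, and
  two such fractions differ by an integer.\<close>

lemma padic_frac_eqI:
  fixes x :: "'p::prime_card padic"
  assumes k: "k < CARD('p) ^ n" and xk: "x - of_nat k / unif ^ n \<in> pball 0"
  shows "padic_frac x = real k / real CARD('p) ^ n"
proof -
  have cancel: "real k' / real CARD('p) ^ n' = real l' / real CARD('p) ^ m'"
    if "k' < CARD('p) ^ n'" "x - of_nat k' / unif ^ n' \<in> pball 0"
      "l' < CARD('p) ^ m'" "x - of_nat l' / unif ^ m' \<in> pball 0" for k' n' l' m'
  proof -
    have "real k' / real CARD('p) ^ n' - real l' / real CARD('p) ^ m' \<in> \<int>"
      using frac_diff_pball_0[of x "int k'" n' "int l'" m'] that by simp
    moreover have "real k' / real CARD('p) ^ n' < 1" "real l' / real CARD('p) ^ m' < 1"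
      using that by (simp_all add: divide_less_eq flip: of_nat_power)
    moreover have "real k' / real CARD('p) ^ n' \<ge> 0" "real l' / real CARD('p) ^ m' \<ge> 0" by simp_all
    ultimately show ?thesis
      using Ints_nonzero_abs_less1[of "real k' / real CARD('p) ^ n' - real l' / real CARD('p) ^ m'"] by linarith
  qed
  \<comment> \<open>Terms from index \<gamma> on are p-adic integers, so later partial sums agree
    with the truncation \<open>S \<gamma>\<close> modulo Z_p. One partial sum at distance below 1
    from x carries the congruence over to x.\<close>
  have exp: "\<exists>l<CARD('p) ^ \<gamma>. x - of_nat l / unif ^ \<gamma> \<in> pball 0 \<and> r = real l / real CARD('p) ^ \<gamma>"
    if a: "\<forall>j. a j < CARD('p)" and sums: "(\<lambda>j. of_nat (a j) * unif powi (int j - int \<gamma>)) sums x"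
      and r: "r = (\<Sum>j<\<gamma>. real (a j) * real CARD('p) powi (int j - int \<gamma>))" for \<gamma> a r
  proof -
    define S where "S n = (\<Sum>j<n. of_nat (a j) * unif powi (int j - int \<gamma>) :: 'p padic)" for n
    define l where "l = (\<Sum>j<\<gamma>. a j * CARD('p) ^ j)"
    have S\<gamma>: "S \<gamma> = of_nat l / unif ^ \<gamma>" by (simp add: S_def l_def sum_powi_shift)
    have step: "S n - S \<gamma> \<in> pball 0" if "n \<ge> \<gamma>" for n
      using that
    proof (induction n rule: dec_induct)
      case (step n)
      have "of_nat (a n) * unif powi (int n - int \<gamma>) \<in> (pball (0 + 0) :: 'p padic set)"
        using step by (intro pball_mult) (auto simp: unif_powi_pball_iff)
      from pball_add[OF step.IH[unfolded S_def] this[simplified]] show ?case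
        by (simp add: S_def algebra_simps)
    qed simp
    have "\<forall>\<^sub>F n in sequentially. dist (S n) x < 1"
      using sums unfolding sums_def S_def[symmetric] by (intro tendstoD) auto
    then obtain M where "\<And>n. n \<ge> M \<Longrightarrow> dist (S n) x < 1" by (auto simp: eventually_sequentially)
    hence "dist (S (max M \<gamma>)) x < 1" by simp
    hence "S (max M \<gamma>) - x \<in> pball 0" by (simp add: dist_padic_def pball_def)
    hence "x - S \<gamma> \<in> pball 0"
      using pball_diff[OF step[of "max M \<gamma>"], of "S (max M \<gamma>) - x"] by simp
    moreover have "r = real l / real CARD('p) ^ \<gamma>" by (simp add: r l_def sum_powi_shift)
    moreover have "l < CARD('p) ^ \<gamma>" unfolding l_def using a by (intro digit_sum_less) auto
    ultimately show ?thesis unfolding S\<gamma> by blast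
  qed
  have ex: "\<exists>r (\<gamma>::nat) (a::nat \<Rightarrow> nat).
     (\<forall>j. a j < CARD('p)) \<and>
     (\<lambda>j. of_nat (a j) * of_nat CARD('p) powi (int j - int \<gamma>)) sums x \<and>
     r = (\<Sum>j<\<gamma>. real (a j) * real CARD('p) powi (int j - int \<gamma>))"
  proof -
    obtain \<gamma> where "x \<in> pball (- int \<gamma>)" using pball_exhaust by blast
    hence "unif powi int \<gamma> * x \<in> pball 0" by (subst pball_powi_mult_iff) simp
    then obtain a where a: "\<forall>j. a j < CARD('p)"
      "\<And>n. unif powi int \<gamma> * x - (\<Sum>j<n. of_nat (a j) * unif ^ j) \<in> pball (int n)"
      using padic_digit_expansion by blast
    have "(\<lambda>j. of_nat (a j) * unif powi (int j - int \<gamma>)) sums x"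
      unfolding sums_def
    proof (rule metric_LIMSEQ_I)
      fix e :: real assume e: "e > 0"
      \<comment> \<open>The n-th partial sum is within p^(\<gamma> - n) of x, and M makes
        p^(\<gamma> - M) smaller than e.\<close>
      obtain M where M: "real CARD('p) powi int \<gamma> / e < real CARD('p) ^ M"
        using real_arch_pow[OF CARD_real_gt_1] by blast
      have "dist (\<Sum>j<n. of_nat (a j) * unif powi (int j - int \<gamma>)) x < e" if n: "n \<ge> M" for n
      proof -
        have "unif powi int \<gamma> * (x - (\<Sum>j<n. of_nat (a j) * unif powi (int j - int \<gamma>)))
          = unif powi int \<gamma> * x - (\<Sum>j<n. of_nat (a j) * unif ^ j)"
          by (simp add: sum_powi_shift algebra_simps)
        hence "x - (\<Sum>j<n. of_nat (a j) * unif powi (int j - int \<gamma>)) \<in> pball (int n - int \<gamma>)"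
          using a(2)[of n] pball_powi_mult_iff[of "int \<gamma>" "x - (\<Sum>j<n. of_nat (a j) * unif powi (int j - int \<gamma>))" "int n"]
          by simp
        hence "dist (\<Sum>j<n. of_nat (a j) * unif powi (int j - int \<gamma>)) x \<le> real CARD('p) powi (int \<gamma> - int n)"
          by (subst dist_commute) (simp add: dist_padic_def pball_def)
        also have "\<dots> \<le> real CARD('p) powi (int \<gamma> - int M)" using n by (simp add: CARD_powi_le_iff)
        also have "\<dots> < e" using M e by (simp add: power_int_diff field_simps)
        finally show ?thesis .
      qed
      thus "\<exists>no. \<forall>n\<ge>no. dist (\<Sum>j<n. of_nat (a j) * unif powi (int j - int \<gamma>)) x < e" by blast
    qed
    thus ?thesis using a(1) by blast
  qed
  define D where "D r \<longleftrightarrow> (\<exists>(\<gamma>::nat) (a::nat \<Rightarrow> nat). (\<forall>j. a j < CARD('p)) \<and>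
     (\<lambda>j. of_nat (a j) * of_nat CARD('p) powi (int j - int \<gamma>)) sums x \<and>
     r = (\<Sum>j<\<gamma>. real (a j) * real CARD('p) powi (int j - int \<gamma>)))" for r
  have D: "r = real k / real CARD('p) ^ n" if "D r" for r
  proof -
    obtain \<gamma> l where l: "l < CARD('p) ^ \<gamma>" "x - of_nat l / unif ^ \<gamma> \<in> pball 0" "r = real l / real CARD('p) ^ \<gamma>"
      using \<open>D r\<close> exp unfolding D_def by (elim exE conjE) blast
    show ?thesis unfolding l(3) by (rule cancel[OF l(1,2) k xk])
  qed
  have "\<exists>r. D r" using ex unfolding D_def .
  hence "(THE r. D r) = real k / real CARD('p) ^ n"
    using D by (intro the_equality) auto
  thus ?thesis unfolding padic_frac_def D_def .
qed

lemma padic_frac_approx: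
  fixes x :: "'p::prime_card padic"
  obtains k n where "k < CARD('p) ^ n" "x - of_nat k / unif ^ n \<in> pball 0"
    "padic_frac x = real k / real CARD('p) ^ n"
proof -
  obtain n where "x \<in> pball (- int n)" using pball_exhaust by blast
  from padic_approx[OF this, of 0] show ?thesis using that padic_frac_eqI by fastforce
qed

section \<open>The additive character\<close>

lemma exp_2pi_cong:
  assumes "r - t \<in> \<int>"
  shows "exp (2 * of_real pi * \<i> * of_real r) = exp (2 * of_real pi * \<i> * of_real t)"
proof -
  obtain n where n: "r - t = of_int n" using assms by (elim Ints_cases)
  hence "r = t + of_int n" by simp
  thus ?thesis unfolding exp_eq by (intro exI[of _ n]) (simp add: algebra_simps)
qed

lemma exp_2pi_eq_1_iff: "exp (2 * of_real pi * \<i> * of_real r) = 1 \<longleftrightarrow> r \<in> \<int>"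
proof
  assume "exp (2 * of_real pi * \<i> * of_real r) = 1"
  then obtain n where "2 * of_real pi * r = of_int (2 * n) * pi"
    unfolding exp_eq_1 by auto
  thus "r \<in> \<int>" by simp
next
  assume "r \<in> \<int>"
  thus "exp (2 * of_real pi * \<i> * of_real r) = 1" using exp_2pi_cong[of r 0] by simp
qed

text \<open>The exponential ignores integers, so any integer numerator serves, without reduction to
  [0, 1). This makes additivity immediate, with no carries to track.\<close>

lemma padic_char_eq:
  fixes x :: "'p::prime_card padic"
  assumes "x - of_int k / unif ^ n \<in> pball 0"
  shows "padic_char x = exp (2 * of_real pi * \<i> * of_real (of_int k / real CARD('p) ^ n))"
proof -
  obtain l m where l: "l < CARD('p) ^ m" "x - of_nat l / unif ^ m \<in> pball 0"
    "padic_frac x = real l / real CARD('p) ^ m" by (rule padic_frac_approx)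
  have "padic_frac x - of_int k / real CARD('p) ^ n \<in> \<int>"
    using frac_diff_pball_0[of x "int l" m k n] l assms by simp
  thus ?thesis unfolding padic_char_def by (rule exp_2pi_cong)
qed

lemma padic_frac_approx2:
  fixes x y :: "'p::prime_card padic"
  obtains k l n where "x - of_int k / unif ^ n \<in> pball 0" "y - of_int l / unif ^ n \<in> pball 0"
proof -
  obtain k m where k: "x - of_nat k / unif ^ m \<in> pball 0" by (rule padic_frac_approx)
  obtain l n where l: "y - of_nat l / unif ^ n \<in> pball 0" by (rule padic_frac_approx)
  show ?thesis
    using that[of "int k * int CARD('p) ^ (max m n - m)" "max m n" "int l * int CARD('p) ^ (max m n - n)"]
      k l frac_extend[of m "max m n" "int k", where 'p='p] frac_extend[of n "max m n" "int l", where 'p='p]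
    by simp
qed

lemma padic_char_add: "padic_char (x + y :: 'p::prime_card padic) = padic_char x * padic_char y"
proof -
  obtain k l n where kl: "x - of_int k / unif ^ n \<in> pball 0" "y - of_int l / unif ^ n \<in> pball 0"
    by (rule padic_frac_approx2)
  have "x + y - of_int (k + l) / unif ^ n \<in> pball 0"
    using pball_add[OF kl] by (simp add: algebra_simps add_divide_distrib)
  from padic_char_eq[OF this] kl[THEN padic_char_eq] show ?thesis
    by (simp add: add_divide_distrib algebra_simps flip: exp_add)
qed

lemma padic_char_eq_1_iff: "padic_char (x :: 'p::prime_card padic) = 1 \<longleftrightarrow> x \<in> pball 0"
proof -
  obtain k l n where k: "x - of_int k / unif ^ n \<in> pball 0" by (rule padic_frac_approx2[of x])
  have "padic_char x = 1 \<longleftrightarrow> of_int k / real CARD('p) ^ n \<in> \<int>"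
    unfolding padic_char_eq[OF k] by (rule exp_2pi_eq_1_iff)
  also have "\<dots> \<longleftrightarrow> of_int k / unif ^ n \<in> (pball 0 :: 'p padic set)" by (rule frac_pball_0_iff[symmetric])
  also have "\<dots> \<longleftrightarrow> x \<in> pball 0" using pball_add_iff[OF k, of "of_int k / unif ^ n"] by simp
  finally show ?thesis .
qed

lemma padic_char_0 [simp]: "padic_char 0 = 1"
  by (simp add: padic_char_eq_1_iff)

lemma cmod_padic_char [simp]: "cmod (padic_char x) = 1"
  by (simp add: padic_char_def norm_exp_eq_Re)

lemma padic_char_nz [simp]: "padic_char x \<noteq> 0"
  by (simp add: padic_char_def)

lemma padic_char_minus: "padic_char (- x :: 'p::prime_card padic) = cnj (padic_char x)"
proof -
  have "padic_char (- x) * padic_char x = 1" by (simp flip: padic_char_add)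
  moreover have "cnj (padic_char x) * padic_char x = 1"
    using complex_norm_square[of "padic_char x"] by (subst mult.commute) simp
  ultimately show ?thesis by (metis mult_right_cancel padic_char_nz)
qed

lemma padic_char_of_nat_mult: "padic_char (of_nat k * x :: 'p::prime_card padic) = padic_char x ^ k"
  by (induction k) (simp_all add: padic_char_add distrib_right)

lemma padic_char_cong: "x - y \<in> pball 0 \<Longrightarrow> padic_char (x :: 'p::prime_card padic) = padic_char y"
  using padic_char_add[of "x - y" y] padic_char_eq_1_iff[of "x - y"] by simp

text \<open>A geometric sum: the character value at x is a root of unity of order dividing p^n, and
  it equals 1 exactly when x lies in Z_p. All orthogonality below comes from here.\<close>

lemma sum_padic_char:
  fixes x :: "'p::prime_card padic"
  assumes x: "x \<in> pball (- int n)"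
  shows "(\<Sum>k<CARD('p) ^ n. padic_char (of_nat k * x)) = (if x \<in> pball 0 then of_nat (CARD('p) ^ n) else 0)"
proof (cases "x \<in> pball 0")
  case True
  thus ?thesis using padic_char_eq_1_iff[of x] by (simp add: padic_char_of_nat_mult)
next
  case False
  hence ne: "padic_char x \<noteq> 1" by (simp add: padic_char_eq_1_iff)
  have "of_nat (CARD('p) ^ n) * x \<in> pball 0"
    using x pball_powi_mult_iff[of "int n" x 0] by simp
  hence "padic_char x ^ (CARD('p) ^ n) = 1" by (simp only: padic_char_of_nat_mult[symmetric] padic_char_eq_1_iff)
  thus ?thesis using False ne by (simp add: padic_char_of_nat_mult sum_gp_strict)
qed

section \<open>Haar measure\<close>

definition pdisc :: "'p::prime_card padic \<Rightarrow> int \<Rightarrow> 'p padic set" where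
  "pdisc a n = {x. x - a \<in> pball n}"

lemma mem_pdisc_iff: "x \<in> pdisc a n \<longleftrightarrow> x - a \<in> pball n"
  by (simp add: pdisc_def)

lemma pdisc_0: "pdisc 0 n = pball n"
  by (simp add: pdisc_def)

text \<open>Every point of a coset is a center, so two discs with a common point can be recentered
  there and are then nested.\<close>

lemma pdisc_eq: "b \<in> pdisc a n \<Longrightarrow> pdisc a n = pdisc b n"
  unfolding pdisc_def
proof (intro Collect_cong)
  fix x assume "b \<in> {x. x - a \<in> pball n}"
  thus "x - a \<in> pball n \<longleftrightarrow> x - b \<in> pball n" using pball_add_iff'[of "b - a" n "x - b"] by simp
qed

lemma pdisc_mono: "m \<le> n \<Longrightarrow> pdisc a n \<subseteq> pdisc a m"
  using pball_mono by (auto simp: pdisc_def)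

lemma pball_if_abs_less: "padic_abs x < real CARD('p) powi (- n) \<Longrightarrow> (x :: 'p::prime_card padic) \<in> pball n"
  by (simp add: pball_def)

lemma open_pdisc: "open (pdisc a n :: 'p::prime_card padic set)"
  unfolding open_dist
proof
  fix x assume x: "x \<in> pdisc a n"
  show "\<exists>e>0. \<forall>y. dist y x < e \<longrightarrow> y \<in> pdisc a n"
  proof (intro exI[of _ "real CARD('p) powi (- n)"] conjI allI impI)
    fix y assume "dist y x < real CARD('p) powi (- n)"
    hence "y \<in> pdisc x n" by (simp add: dist_padic_def pball_if_abs_less mem_pdisc_iff)
    thus "y \<in> pdisc a n" using pdisc_eq[OF x] by simp
  qed (simp add: zero_less_power_int)
qed

lemma pdisc_subset_ball:
  fixes x :: "'p::prime_card padic"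
  assumes "e > 0"
  shows "\<exists>n::nat. pdisc x (int n) \<subseteq> ball x e"
proof -
  obtain n where n: "1 / e < real CARD('p) ^ n" using real_arch_pow[OF CARD_real_gt_1] by blast
  have "real CARD('p) powi (- int n) < e"
    using n assms by (simp add: power_int_minus field_simps)
  hence "dist y x < e" if "y \<in> pdisc x (int n)" for y
    using that by (simp add: mem_pdisc_iff pball_def dist_padic_def)
  hence "pdisc x (int n) \<subseteq> ball x e" by (auto simp: dist_commute)
  thus ?thesis ..
qed

lemma open_contains_pdisc:
  fixes U :: "'p::prime_card padic set"
  assumes "open U" "x \<in> U"
  shows "\<exists>n::nat. pdisc x (int n) \<subseteq> U"
proof -
  obtain e where "e > 0" "ball x e \<subseteq> U" using assms by (meson open_contains_ball)
  thus ?thesis using pdisc_subset_ball[of e x] by blast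
qed

text \<open>A generator of the Borel sets for uniqueness of measures and for induction; the empty
  set is added to close the family under intersection.\<close>

definition pdiscs :: "'p::prime_card padic set set" where
  "pdiscs = insert {} (range (\<lambda>(a, n). pdisc a n))"

lemma pdisc_in_pdiscs: "pdisc a n \<in> pdiscs"
  unfolding pdiscs_def by (intro insertI2 range_eqI[of _ _ "(a, n)"]) simp

lemma Int_stable_pdiscs: "Int_stable (pdiscs :: 'p::prime_card padic set set)"
proof (rule Int_stableI)
  fix A B :: "'p padic set" assume AB: "A \<in> pdiscs" "B \<in> pdiscs"
  show "A \<inter> B \<in> pdiscs"
  proof (cases "A \<inter> B = {}")
    case False
    then obtain x where x: "x \<in> A" "x \<in> B" by blast
    obtain m n where "A = pdisc x m" "B = pdisc x n"
      using AB x unfolding pdiscs_def by (auto dest: pdisc_eq)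
    thus ?thesis using AB pdisc_mono[of m n x] pdisc_mono[of n m x] by (cases m n rule: le_cases) (auto simp: Int_absorb1 Int_absorb2)
  qed (simp add: pdiscs_def)
qed

text \<open>Discs with centers k/p^n and radii p^(-m), for natural k, n and m, form a countable
  family, and an open set is the union of those that it contains.\<close>

lemma sets_borel_padic: "sets (borel :: 'p::prime_card padic measure) = sigma_sets UNIV pdiscs"
proof
  have "pdiscs \<subseteq> sets (borel :: 'p padic measure)"
    by (auto simp: pdiscs_def intro: borel_open open_pdisc)
  thus "sigma_sets UNIV pdiscs \<subseteq> sets (borel :: 'p padic measure)"
    using sets.sigma_sets_subset[of pdiscs "borel :: 'p padic measure"] by simp
  have "S \<in> sigma_sets UNIV pdiscs" if S: "open S" for S :: "'p padic set"
  proof -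
    define D where "D = (\<lambda>(k::nat, n::nat, m::nat). pdisc (of_nat k / unif ^ n :: 'p padic) (int m))"
    have "S = \<Union>(D ` {t. D t \<subseteq> S})"
    proof
      show "S \<subseteq> \<Union>(D ` {t. D t \<subseteq> S})"
      proof
        fix x assume x: "x \<in> S"
        obtain m where m: "pdisc x (int m) \<subseteq> S" using open_contains_pdisc[OF S x] by blast
        obtain n where "x \<in> pball (- int n)" using pball_exhaust by blast
        then obtain k where "x - of_nat k / unif ^ n \<in> pball (int m)" using padic_approx by blast
        hence xk: "x \<in> pdisc (of_nat k / unif ^ n) (int m)" by (simp add: mem_pdisc_iff)
        hence "pdisc (of_nat k / unif ^ n) (int m) = pdisc x (int m)" by (rule pdisc_eq)
        hence "D (k, n, m) \<subseteq> S" "x \<in> D (k, n, m)" using m xk by (simp_all add: D_def)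
        thus "x \<in> \<Union>(D ` {t. D t \<subseteq> S})" by blast
      qed
    qed auto
    also have "\<dots> \<in> sigma_sets UNIV pdiscs"
      by (rule sigma_sets_UNION) (auto simp: D_def pdisc_in_pdiscs)
    finally show ?thesis .
  qed
  hence "sigma_sets UNIV {S. open S} \<subseteq> (sigma_sets UNIV pdiscs :: 'p padic set set)"
    by (intro sigma_sets_mono) auto
  thus "sets (borel :: 'p padic measure) \<subseteq> sigma_sets UNIV pdiscs"
    by (simp add: borel_def)
qed

lemma continuous_on_padic_affine:
  "continuous_on UNIV (\<lambda>x :: 'p::prime_card padic. c * x + a)"
proof -
  have "\<forall>x\<in>UNIV. \<forall>e>0. \<exists>d>0. \<forall>x'\<in>UNIV. dist x' x < d \<longrightarrow> dist (c * x' + a) (c * x + a) < e"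
  proof (intro ballI allI impI)
    fix x :: "'p padic" and e :: real assume e: "e > 0"
    \<comment> \<open>The added 1 keeps the denominator positive when c = 0.\<close>
    have c: "padic_abs c + 1 > 0" using padic_abs_nonneg[of c] by linarith
    have "dist (c * y + a) (c * x + a) < e" if "dist y x < e / (padic_abs c + 1)" for y
    proof -
      have "dist (c * y + a) (c * x + a) = padic_abs c * dist y x"
        by (simp add: dist_padic_def flip: padic_abs_mult) (simp add: algebra_simps)
      also have "\<dots> \<le> (padic_abs c + 1) * dist y x" by (intro mult_right_mono) auto
      also have "\<dots> < e" using that c by (simp add: field_simps)
      finally show ?thesis .
    qed
    thus "\<exists>d>0. \<forall>x'\<in>UNIV. dist x' x < d \<longrightarrow> dist (c * x' + a) (c * x + a) < e"
      using e c by (intro exI[of _ "e / (padic_abs c + 1)"]) auto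
  qed
  thus ?thesis unfolding continuous_on_iff .
qed

lemma measurable_padic_affine [measurable]: "(\<lambda>x :: 'p::prime_card padic. c * x + a) \<in> borel_measurable borel"
  by (rule borel_measurable_continuous_onI[OF continuous_on_padic_affine])

lemma pdisc_borel [measurable, simp]: "pdisc a n \<in> sets borel"
  using open_pdisc by (rule borel_open)

lemma pball_borel [measurable, simp]: "pball n \<in> sets borel"
  using pdisc_borel[of 0 n] by (simp add: pdisc_0)

lemma powi_mult_mem_pdisc_iff:
  "unif powi j * x \<in> pdisc a n \<longleftrightarrow> (x :: 'p::prime_card padic) \<in> pdisc (unif powi (- j) * a) (n - j)"
proof -
  have "unif powi j * x - a = unif powi j * (x - unif powi (- j) * a)"
    by (simp add: algebra_simps flip: mult.assoc power_int_add)
  thus ?thesis by (simp add: mem_pdisc_iff pball_powi_mult_iff)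
qed

lemma pball_decomp:
  "pball (- int n) = (\<Union>k<CARD('p) ^ (n + m). pdisc (of_nat k / unif ^ n :: 'p::prime_card padic) (int m))"
proof (intro equalityI subsetI)
  fix x :: "'p padic" assume "x \<in> pball (- int n)"
  from padic_approx[OF this, of m]
  show "x \<in> (\<Union>k<CARD('p) ^ (n + m). pdisc (of_nat k / unif ^ n) (int m))" by (auto simp: mem_pdisc_iff)
next
  fix x :: "'p padic" assume "x \<in> (\<Union>k<CARD('p) ^ (n + m). pdisc (of_nat k / unif ^ n) (int m))"
  then obtain k where "x - of_nat k / unif ^ n \<in> pball (int m)" by (auto simp: mem_pdisc_iff)
  hence "x - of_nat k / unif ^ n \<in> pball (- int n)" by (rule pball_monoD) simp
  from pball_add[OF this frac_pball, of k] show "x \<in> pball (- int n)" by simp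
qed

lemma disjoint_pdisc_family:
  "disjoint_family_on (\<lambda>k. pdisc (of_nat k / unif ^ n :: 'p::prime_card padic) (int m)) {..<CARD('p) ^ (n + m)}"
  by (auto simp: disjoint_family_on_def mem_pdisc_iff dest: padic_approx_unique)

section \<open>Step functions, and measures of discs\<close>

text \<open>Supported in p^(-n)Z_p and p^m Z_p-periodic. Both exponents are recorded because the
  Fourier transform interchanges them. Every test function is of this form by
  \<open>padic_test_function_step\<close>.\<close>

definition padic_step :: "nat \<Rightarrow> nat \<Rightarrow> ('p::prime_card padic \<Rightarrow> 'b::zero) \<Rightarrow> bool" where
  "padic_step n m f \<longleftrightarrow> (\<forall>x. x \<notin> pball (- int n) \<longrightarrow> f x = 0) \<and> (\<forall>x. \<forall>z\<in>pball (int m). f (x + z) = f x)"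

lemma padic_step_eq_sum:
  fixes f :: "'p::prime_card padic \<Rightarrow> 'b::real_normed_vector"
  assumes f: "padic_step n m f"
  shows "f x = (\<Sum>k<CARD('p) ^ (n + m). indicator (pdisc (of_nat k / unif ^ n) (int m)) x *\<^sub>R f (of_nat k / unif ^ n))"
proof (cases "x \<in> pball (- int n)")
  case True
  obtain k where k: "k < CARD('p) ^ (n + m)" "x - of_nat k / unif ^ n \<in> pball (int m)" using padic_approx[OF True] by blast
  have ind: "indicator (pdisc (of_nat l / unif ^ n) (int m)) x = (if l = k then 1 else 0 :: real)" if "l < CARD('p) ^ (n + m)" for l
    using k padic_approx_unique[OF that k(1), of x] by (cases "l = k") (auto simp: mem_pdisc_iff indicator_def)
  have "(\<Sum>l<CARD('p) ^ (n + m). indicator (pdisc (of_nat l / unif ^ n) (int m)) x *\<^sub>R f (of_nat l / unif ^ n))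
    = (\<Sum>l<CARD('p) ^ (n + m). if l = k then f (of_nat k / unif ^ n) else 0)"
    by (intro sum.cong refl) (simp add: ind)
  also have "\<dots> = f (of_nat k / unif ^ n)" using k(1) by simp
  also have "\<dots> = f (of_nat k / unif ^ n + (x - of_nat k / unif ^ n))"
    using k(2) f unfolding padic_step_def by metis
  finally show ?thesis by simp
next
  case False
  hence "x \<notin> pdisc (of_nat k / unif ^ n) (int m)" if "k < CARD('p) ^ (n + m)" for k
    using that pball_decomp[of n m, where 'p='p] by blast
  thus ?thesis using False f by (simp add: padic_step_def)
qed

context
  fixes \<mu> :: "'p::prime_card padic measure"
  assumes haar: "is_haar \<mu>"
begin

lemma sets_haar [simp, measurable_cong]: "sets \<mu> = sets borel"
  using haar by (simp add: is_haar_def)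

lemma space_haar [simp]: "space \<mu> = UNIV"
  using sets_eq_imp_space_eq[OF sets_haar] by simp

lemma emeasure_haar_translate: "A \<in> sets borel \<Longrightarrow> emeasure \<mu> ((\<lambda>x. a + x) ` A) = emeasure \<mu> A"
  using haar by (simp add: is_haar_def)

lemma pdisc_translate: "pdisc (a :: 'p padic) n = (\<lambda>x. a + x) ` pball n"
  by (force simp: pdisc_def image_iff intro!: bexI[of _ "_ - a"])

lemma emeasure_pdisc_translate: "emeasure \<mu> (pdisc a n) = emeasure \<mu> (pball n)"
  by (simp add: pdisc_translate emeasure_haar_translate)

lemma emeasure_pball_decomp: "emeasure \<mu> (pball (- int n)) = of_nat (CARD('p) ^ (n + m)) * emeasure \<mu> (pball (int m))"
proof -
  have "emeasure \<mu> (pball (- int n)) = (\<Sum>k<CARD('p) ^ (n + m). emeasure \<mu> (pdisc (of_nat k / unif ^ n) (int m)))"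
    unfolding pball_decomp[of n m] by (rule sum_emeasure[symmetric]) (auto simp: disjoint_pdisc_family)
  thus ?thesis by (simp add: emeasure_pdisc_translate)
qed

text \<open>Counting translates from the normalized Z_p: it consists of p^m cosets of p^m Z_p, and
  p^(-m)Z_p consists of p^m cosets of Z_p.\<close>

lemma emeasure_pball: "emeasure \<mu> (pball n) = ennreal (real CARD('p) powi (- n))"
proof -
  have 1: "emeasure \<mu> (pball 0) = 1" using haar by (simp add: is_haar_def pball_def)
  show ?thesis
  proof (cases n rule: int_cases2)
    case (nonneg m)
    have m: "1 = of_nat (CARD('p) ^ m) * emeasure \<mu> (pball (int m))"
      using emeasure_pball_decomp[of 0 m] by (simp add: 1)
    \<comment> \<open>An infinite value would make the product infinite instead of 1. Finiteness has
      to be settled before passing to the real-valued \<open>measure\<close>.\<close>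
    hence fin: "emeasure \<mu> (pball (int m)) < \<infinity>"
      using CARD_pos[where 'p='p] by (cases "emeasure \<mu> (pball (int m))") (auto simp: ennreal_mult_eq_top_iff ennreal_of_nat_eq_real_of_nat simp del: CARD_pos)
    have "1 = real (CARD('p) ^ m) * measure \<mu> (pball (int m))"
    proof -
      have "ennreal 1 = ennreal (real (CARD('p) ^ m)) * ennreal (measure \<mu> (pball (int m)))"
        using m fin by (simp add: emeasure_eq_ennreal_measure ennreal_of_nat_eq_real_of_nat)
      thus ?thesis by (subst (asm) ennreal_mult[symmetric]) (auto simp flip: ennreal_1)
    qed
    hence "measure \<mu> (pball (int m)) = real CARD('p) powi (- int m)"
      by (simp add: power_int_minus field_simps)
    thus ?thesis using fin nonneg by (simp add: emeasure_eq_ennreal_measure)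
  next
    case (nonpos m)
    thus ?thesis using emeasure_pball_decomp[of m 0]
      by (simp add: 1 ennreal_of_nat_eq_real_of_nat)
  qed
qed

lemma emeasure_pdisc: "emeasure \<mu> (pdisc a n) = ennreal (real CARD('p) powi (- n))"
  by (simp add: emeasure_pdisc_translate emeasure_pball)

lemma measure_pdisc: "measure \<mu> (pdisc a n) = real CARD('p) powi (- n)"
  by (simp add: measure_def emeasure_pdisc)

lemma distr_haar_translate: "distr \<mu> borel (\<lambda>x. x + a) = \<mu>"
proof (rule measure_eqI)
  fix A assume "A \<in> sets (distr \<mu> borel (\<lambda>x. x + a))"
  hence A: "A \<in> sets borel" by simp
  have m: "(\<lambda>x. x + a) \<in> measurable \<mu> borel" using measurable_padic_affine[of 1 a] by simp
  \<comment> \<open>\<open>is_haar\<close> speaks of images; the preimage under translation by a is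
    the image under translation by -a.\<close>
  have "(\<lambda>x. x + a) -` A = (\<lambda>x. - a + x) ` A"
    by (force simp: image_iff intro!: bexI[of _ "_ + a"])
  thus "emeasure (distr \<mu> borel (\<lambda>x. x + a)) A = emeasure \<mu> A"
    using A m emeasure_haar_translate[OF A, of "- a"] by (simp add: emeasure_distr)
qed simp

lemma integral_haar_translate:
  fixes f :: "'p padic \<Rightarrow> 'b::{banach, second_countable_topology}"
  assumes "f \<in> borel_measurable borel"
  shows "(LINT x|\<mu>. f (x + a)) = (LINT x|\<mu>. f x)"
proof -
  have m: "(\<lambda>x. x + a) \<in> measurable \<mu> borel" using measurable_padic_affine[of 1 a] by simp
  show ?thesis using integral_distr[OF m assms] by (simp add: distr_haar_translate)
qed

lemma measurable_haar_dilate: "(\<lambda>x. unif powi j * x) \<in> measurable \<mu> borel"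
  unfolding measurable_cong_sets[OF sets_haar refl] using measurable_padic_affine[of "unif powi j" 0] by simp

lemma measurable_haar_translate: "(\<lambda>x. x + a) \<in> measurable \<mu> borel"
  unfolding measurable_cong_sets[OF sets_haar refl] using measurable_padic_affine[of 1 a] by simp

text \<open>The preimage of a disc of measure p^(-n) is a disc of measure p^(j-n). Agreement on the
  intersection-stable family of discs, with the balls p^(-n)Z_p as exhaustion of finite measure,
  determines the measure.\<close>

lemma distr_haar_dilate: "distr \<mu> borel (\<lambda>x. unif powi j * x) = scale_measure (ennreal (real CARD('p) powi j)) \<mu>"
proof (rule measure_eqI_generator_eq[OF Int_stable_pdiscs, of UNIV _ _ "\<lambda>n::nat. pball (- int n)"])
  note m = measurable_haar_dilate[of j]
  fix X :: "'p padic set" assume "X \<in> pdiscs"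
  then consider "X = {}" | a n where "X = pdisc a n" by (auto simp: pdiscs_def)
  thus "emeasure (distr \<mu> borel (\<lambda>x. unif powi j * x)) X = emeasure (scale_measure (ennreal (real CARD('p) powi j)) \<mu>) X"
  proof cases
    case (2 a n)
    have "(\<lambda>x. unif powi j * x) -` pdisc a n = pdisc (unif powi (- j) * a) (n - j)"
      using powi_mult_mem_pdisc_iff by blast
    thus ?thesis using m 2
      by (simp add: emeasure_distr emeasure_pdisc power_int_diff power_int_minus divide_inverse flip: ennreal_mult)
  qed simp
next
  show "range (\<lambda>n::nat. pball (- int n) :: 'p padic set) \<subseteq> pdiscs"
    using pdisc_in_pdiscs[of 0] by (auto simp: pdisc_0)
  show "(\<Union>n::nat. pball (- int n) :: 'p padic set) = UNIV" using pball_exhaust by blast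
  fix n
  have "(\<lambda>x. unif powi j * x) -` pdisc 0 (- int n) = (pdisc (unif powi (- j) * 0) (- int n - j) :: 'p padic set)"
    using powi_mult_mem_pdisc_iff by blast
  thus "emeasure (distr \<mu> borel (\<lambda>x. unif powi j * x)) (pball (- int n)) \<noteq> \<infinity>"
    unfolding pdisc_0[symmetric] using measurable_haar_dilate[of j] by (simp add: emeasure_distr emeasure_pdisc)
qed (auto simp: sets_borel_padic)

text \<open>Each coset has measure p^(-m), so a Riemann sum over representatives is exact.\<close>

lemma has_bochner_integral_padic_step:
  fixes f :: "'p padic \<Rightarrow> 'b::{banach, second_countable_topology}"
  assumes f: "padic_step n m f"
  shows "has_bochner_integral \<mu> f ((1 / real CARD('p) ^ m) *\<^sub>R (\<Sum>k<CARD('p) ^ (n + m). f (of_nat k / unif ^ n)))"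
proof -
  have "has_bochner_integral \<mu> (\<lambda>x. \<Sum>k<CARD('p) ^ (n + m). indicator (pdisc (of_nat k / unif ^ n) (int m)) x *\<^sub>R f (of_nat k / unif ^ n))
    (\<Sum>k<CARD('p) ^ (n + m). measure \<mu> (pdisc (of_nat k / unif ^ n) (int m)) *\<^sub>R f (of_nat k / unif ^ n))"
    by (intro has_bochner_integral_sum has_bochner_integral_indicator) (auto simp: emeasure_pdisc)
  thus ?thesis unfolding padic_step_eq_sum[OF f, symmetric]
    by (simp add: measure_pdisc scaleR_sum_right power_int_minus divide_inverse)
qed

end

section \<open>Fourier transform of step functions\<close>

lemma padic_step_mono:
  fixes f :: "'p::prime_card padic \<Rightarrow> 'b::zero"
  assumes "padic_step n m f" "n \<le> n'" "m \<le> m'"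
  shows "padic_step n' m' f"
  using assms pball_mono[of "- int n'" "- int n", where 'p='p] pball_mono[of "int m" "int m'", where 'p='p]
  unfolding padic_step_def by (simp add: subset_iff) blast

lemma padic_step_vanish: "padic_step n m f \<Longrightarrow> x \<notin> pball (- int n) \<Longrightarrow> f x = 0"
  by (simp add: padic_step_def)

lemma padic_step_periodic: "padic_step n m f \<Longrightarrow> z \<in> pball (int m) \<Longrightarrow> f (x + z) = f x"
  by (simp add: padic_step_def)

lemma padic_step_cong: "padic_step n m f \<Longrightarrow> x - y \<in> pball (int m) \<Longrightarrow> f x = f y"
  using padic_step_periodic[of n m f "x - y" y] by simp

lemma padic_step_map: "padic_step n m f \<Longrightarrow> g 0 = 0 \<Longrightarrow> padic_step n m (\<lambda>x. g (f x))"
  by (simp add: padic_step_def)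

lemma padic_step_diff:
  fixes f :: "'p::prime_card padic \<Rightarrow> 'b::group_add"
  shows "padic_step n m f \<Longrightarrow> padic_step n m g \<Longrightarrow> padic_step n m (\<lambda>x. f x - g x)"
  by (simp add: padic_step_def)

lemma padic_step_mult_periodic:
  fixes f :: "'p::prime_card padic \<Rightarrow> 'b::mult_zero"
  assumes "padic_step n m f" "\<And>x z. z \<in> pball (int m) \<Longrightarrow> g (x + z) = g x"
  shows "padic_step n m (\<lambda>x. f x * g x)"
  using assms by (simp add: padic_step_def)

lemma padic_step_borel [measurable_dest]:
  fixes f :: "'p::prime_card padic \<Rightarrow> 'b::{real_normed_vector, second_countable_topology}"
  assumes f: "padic_step n m f"
  shows "f \<in> borel_measurable borel"
proof -
  have "(\<lambda>x :: 'p padic. \<Sum>k<CARD('p) ^ (n + m). indicator (pdisc (of_nat k / unif ^ n) (int m)) x *\<^sub>R f (of_nat k / unif ^ n)) \<in> borel_measurable borel"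
    by measurable
  thus ?thesis unfolding padic_step_eq_sum[OF f, symmetric] .
qed

text \<open>For such frequencies the product of \<xi> with an element of p^m Z_p is a p-adic
  integer, so the character shares the period of f.\<close>

lemma padic_step_char_mult:
  fixes f :: "'p::prime_card padic \<Rightarrow> complex"
  assumes f: "padic_step n m f" and \<xi>: "\<xi> \<in> pball (- int m)"
  shows "padic_step n m (\<lambda>x. padic_char (\<xi> * x) * f x)"
proof -
  have "padic_char (\<xi> * (x + z)) = padic_char (\<xi> * x)" if "z \<in> pball (int m)" for x z
    using pball_mult[OF \<xi> that] by (intro padic_char_cong) (simp add: algebra_simps)
  thus ?thesis using padic_step_mult_periodic[OF f, of "\<lambda>x. padic_char (\<xi> * x)"] by (simp add: mult.commute)
qed

lemma padic_char_mult_step_borel: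
  fixes f :: "'p::prime_card padic \<Rightarrow> complex"
  assumes f: "padic_step n m f"
  shows "(\<lambda>x. padic_char (\<xi> * x) * f x) \<in> borel_measurable borel"
proof -
  obtain M where M: "\<xi> \<in> pball (- int M)" using pball_exhaust by blast
  have "padic_step n (max m M) (\<lambda>x. padic_char (\<xi> * x) * f x)"
    by (rule padic_step_char_mult[OF padic_step_mono[OF f] pball_monoD[OF M]]) auto
  thus ?thesis by (rule padic_step_borel)
qed

context
  fixes \<mu> :: "'p::prime_card padic measure"
  assumes haar: "is_haar \<mu>"
begin

text \<open>
  Translating the integration variable by $p^m$, a period of \<open>f\<close>, multiplies the integral by
  $\chi_p(p^m\xi) \ne 1$.
\<close>

lemma padic_fourier_step_vanish:
  assumes f: "padic_step n m f" and \<xi>: "\<xi> \<notin> pball (- int m)"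
  shows "padic_fourier \<mu> f \<xi> = 0"
proof -
  define z :: "'p padic" where "z = unif ^ m"
  have "unif powi int m * \<xi> \<notin> pball 0" using \<xi> by (subst pball_powi_mult_iff) simp
  hence nz: "padic_char (\<xi> * z) \<noteq> 1" by (simp add: padic_char_eq_1_iff z_def mult.commute)
  have z: "z \<in> pball (int m)" using unif_powi_pball_iff[of "int m" "int m", where 'p='p] by (simp add: z_def)
  have "padic_fourier \<mu> f \<xi> = (LINT x|\<mu>. padic_char (\<xi> * (x + z)) * f (x + z))"
    unfolding padic_fourier_def by (rule integral_haar_translate[OF haar padic_char_mult_step_borel[OF f], symmetric])
  also have "\<dots> = (LINT x|\<mu>. padic_char (\<xi> * z) * (padic_char (\<xi> * x) * f x))"
    by (intro Bochner_Integration.integral_cong refl)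
      (simp add: padic_step_periodic[OF f z] padic_char_add distrib_left)
  also have "\<dots> = padic_char (\<xi> * z) * padic_fourier \<mu> f \<xi>" by (simp add: padic_fourier_def)
  finally show ?thesis using nz by simp
qed

text \<open>For frequencies in p^(-m)Z_p the integrand is again a step function with the same
  exponents; all other frequencies are covered by \<open>padic_fourier_step_vanish\<close>.\<close>

lemma padic_fourier_step:
  assumes f: "padic_step n m f" and \<xi>: "\<xi> \<in> pball (- int m)"
  shows "padic_fourier \<mu> f \<xi> =
    (\<Sum>k<CARD('p) ^ (n + m). padic_char (\<xi> * (of_nat k / unif ^ n)) * f (of_nat k / unif ^ n)) / of_nat CARD('p) ^ m"
  unfolding padic_fourier_def
  using has_bochner_integral_integral_eq[OF has_bochner_integral_padic_step[OF haar padic_step_char_mult[OF f \<xi>]]]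
  by (simp add: scaleR_conv_of_real divide_inverse mult.commute)

text \<open>Period and support trade places: the period of f bounds the support of the transform,
  and the support of f gives the transform its period.\<close>

lemma padic_step_fourier:
  assumes f: "padic_step n m f"
  shows "padic_step m n (padic_fourier \<mu> f)"
  unfolding padic_step_def
proof (intro conjI allI impI ballI)
  fix \<xi> \<eta> :: "'p padic" assume \<eta>: "\<eta> \<in> pball (int n)"
  have "padic_char ((\<xi> + \<eta>) * x) * f x = padic_char (\<xi> * x) * f x" for x
  proof (cases "x \<in> pball (- int n)")
    case True
    have "padic_char ((\<xi> + \<eta>) * x) = padic_char (\<xi> * x)"
      using pball_mult[OF \<eta> True] by (intro padic_char_cong) (simp add: algebra_simps)
    thus ?thesis by simp
  qed (simp add: padic_step_vanish[OF f])
  hence "(\<lambda>x. padic_char ((\<xi> + \<eta>) * x) * f x) = (\<lambda>x. padic_char (\<xi> * x) * f x)" by (rule ext)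
  thus "padic_fourier \<mu> f (\<xi> + \<eta>) = padic_fourier \<mu> f \<xi>" by (simp only: padic_fourier_def)
qed (rule padic_fourier_step_vanish[OF f])

end

section \<open>Parseval on finite quotients and Plancherel for step functions\<close>

lemma padic_char_diff: "padic_char (x - y :: 'p::prime_card padic) = padic_char x * cnj (padic_char y)"
  using padic_char_add[of x "- y"] by (simp add: padic_char_minus)

text \<open>After interchanging sums, the sum over l is a full character sum that vanishes off the
  diagonal. Two vectors are allowed because the autocorrelation pairs a vector with a modulated copy
  of itself.\<close>

lemma dft_parseval:
  fixes a b :: "nat \<Rightarrow> complex" and N :: nat
  defines "F \<equiv> \<lambda>(c :: nat \<Rightarrow> complex) l. \<Sum>k<CARD('p::prime_card) ^ N. padic_char (of_nat l * (of_nat k / unif ^ N :: 'p padic)) * c k"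
  shows "(\<Sum>l<CARD('p) ^ N. F a l * cnj (F b l)) = of_nat (CARD('p) ^ N) * (\<Sum>k<CARD('p) ^ N. a k * cnj (b k))"
proof -
  let ?Q = "CARD('p) ^ N"
  have orth: "(\<Sum>l<?Q. padic_char (of_nat l * (of_nat k / unif ^ N - of_nat k' / unif ^ N :: 'p padic)))
     = (if k = k' then of_nat ?Q else 0)" if "k < ?Q" "k' < ?Q" for k k'
  proof -
    have "of_nat k / unif ^ N - of_nat k' / unif ^ N \<in> (pball (- int N) :: 'p padic set)"
      by (intro pball_diff frac_pball)
    moreover have "of_nat k / unif ^ N - of_nat k' / unif ^ N \<in> (pball 0 :: 'p padic set) \<longleftrightarrow> k = k'"
      using padic_approx_unique[of k' N 0 k "of_nat k / unif ^ N :: 'p padic"] that by auto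
    ultimately show ?thesis by (simp add: sum_padic_char)
  qed
  have "(\<Sum>l<?Q. F a l * cnj (F b l)) = (\<Sum>l<?Q. \<Sum>k<?Q. \<Sum>k'<?Q.
     a k * cnj (b k') * padic_char (of_nat l * (of_nat k / unif ^ N - of_nat k' / unif ^ N :: 'p padic)))"
  proof (intro sum.cong refl)
    fix l
    have "padic_char (of_nat l * (of_nat k / unif ^ N - of_nat k' / unif ^ N :: 'p padic))
      = padic_char (of_nat l * (of_nat k / unif ^ N :: 'p padic)) * cnj (padic_char (of_nat l * (of_nat k' / unif ^ N :: 'p padic)))" for k k'
      by (simp only: right_diff_distrib padic_char_diff)
    thus "F a l * cnj (F b l) = (\<Sum>k<?Q. \<Sum>k'<?Q.
     a k * cnj (b k') * padic_char (of_nat l * (of_nat k / unif ^ N - of_nat k' / unif ^ N :: 'p padic)))"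
      by (simp add: F_def sum_product mult_ac)
  qed
  also have "\<dots> = (\<Sum>k<?Q. \<Sum>l<?Q. \<Sum>k'<?Q.
     a k * cnj (b k') * padic_char (of_nat l * (of_nat k / unif ^ N - of_nat k' / unif ^ N :: 'p padic)))"
    by (rule sum.swap)
  also have "\<dots> = (\<Sum>k<?Q. \<Sum>k'<?Q. \<Sum>l<?Q.
     a k * cnj (b k') * padic_char (of_nat l * (of_nat k / unif ^ N - of_nat k' / unif ^ N :: 'p padic)))"
    by (intro sum.cong refl sum.swap)
  also have "\<dots> = (\<Sum>k<?Q. \<Sum>k'<?Q. if k' = k then a k * cnj (b k) * of_nat ?Q else 0)"
    by (intro sum.cong refl) (simp only: sum_distrib_left[symmetric] orth lessThan_iff, simp)
  also have "\<dots> = (\<Sum>k<?Q. a k * cnj (b k) * of_nat ?Q)"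
    by (intro sum.cong refl) (simp only: sum.delta finite_lessThan lessThan_iff if_True)
  finally show ?thesis by (simp add: sum_distrib_left mult_ac)
qed

text \<open>Sampled at l/p^m, the transform is a discrete transform of length p^(n+m) divided by
  p^m. The Parseval factor p^(n+m), the squared normalization p^(-2m) and the measure p^(-n) of the
  dual cosets combine to p^(-m), the measure of the cosets for f.\<close>

lemma padic_plancherel_step:
  fixes \<mu> :: "'p::prime_card padic measure"
  assumes haar: "is_haar \<mu>" and f: "padic_step n m f"
  shows "(LINT x|\<mu>. (cmod (padic_fourier \<mu> f x))\<^sup>2) = (LINT x|\<mu>. (cmod (f x))\<^sup>2)"
proof -
  let ?Q = "CARD('p) ^ (n + m)"
  let ?F = "padic_fourier \<mu> f"
  let ?G = "\<lambda>l. \<Sum>k<?Q. padic_char (of_nat l * (of_nat k / unif ^ (n + m) :: 'p padic)) * f (of_nat k / unif ^ n)"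
  have F: "?F (of_nat l / unif ^ m) = ?G l / of_nat CARD('p) ^ m" for l
    by (subst padic_fourier_step[OF haar f frac_pball]) (simp add: power_add mult_ac)
  have "complex_of_real (\<Sum>l<?Q. (cmod (?F (of_nat l / unif ^ m)))\<^sup>2)
    = (\<Sum>l<?Q. ?G l * cnj (?G l)) / of_nat CARD('p) ^ (2 * m)"
  proof -
    have "complex_of_real ((cmod (?F (of_nat l / unif ^ m)))\<^sup>2) = ?G l * cnj (?G l) / of_nat CARD('p) ^ (2 * m)" for l
      unfolding complex_norm_square F
      by (simp only: complex_cnj_divide complex_cnj_power complex_cnj_of_nat times_divide_times_eq mult_2 power_add)
    thus ?thesis unfolding of_real_sum by (simp only: sum_divide_distrib[symmetric])
  qed
  also have "(\<Sum>l<?Q. ?G l * cnj (?G l)) = of_nat ?Q * (\<Sum>k<?Q. f (of_nat k / unif ^ n) * cnj (f (of_nat k / unif ^ n)))"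
    by (rule dft_parseval)
  also have "(\<Sum>k<?Q. f (of_nat k / unif ^ n) * cnj (f (of_nat k / unif ^ n)))
     = complex_of_real (\<Sum>k<?Q. (cmod (f (of_nat k / unif ^ n)))\<^sup>2)"
    by (simp only: of_real_sum complex_norm_square)
  also have "of_nat ?Q * complex_of_real (\<Sum>k<?Q. (cmod (f (of_nat k / unif ^ n)))\<^sup>2) / of_nat CARD('p) ^ (2 * m)
     = complex_of_real (real ?Q * (\<Sum>k<?Q. (cmod (f (of_nat k / unif ^ n)))\<^sup>2) / real CARD('p) ^ (2 * m))"
    by simp
  finally have eq: "(\<Sum>l<?Q. (cmod (?F (of_nat l / unif ^ m)))\<^sup>2)
     = real ?Q * (\<Sum>k<?Q. (cmod (f (of_nat k / unif ^ n)))\<^sup>2) / real CARD('p) ^ (2 * m)"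
    unfolding of_real_eq_iff .
  have "(LINT x|\<mu>. (cmod (?F x))\<^sup>2) = (\<Sum>l<?Q. (cmod (?F (of_nat l / unif ^ m)))\<^sup>2) / real CARD('p) ^ n"
    using has_bochner_integral_integral_eq[OF has_bochner_integral_padic_step[OF haar
      padic_step_map[OF padic_step_fourier[OF haar f], of "\<lambda>z. (cmod z)\<^sup>2"]]]
    by (simp add: add.commute)
  also have "\<dots> = (\<Sum>k<?Q. (cmod (f (of_nat k / unif ^ n)))\<^sup>2) / real CARD('p) ^ m"
  proof -
    have "real CARD('p) ^ (2 * m) = real CARD('p) ^ m * real CARD('p) ^ m" by (simp add: mult_2 power_add)
    thus ?thesis unfolding eq by (simp add: power_add)
  qed
  also have "\<dots> = (LINT x|\<mu>. (cmod (f x))\<^sup>2)"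
    using has_bochner_integral_integral_eq[OF has_bochner_integral_padic_step[OF haar
      padic_step_map[OF f, of "\<lambda>z. (cmod z)\<^sup>2"]]] by simp
  finally show ?thesis .
qed

text \<open>Compactness of the support makes the local radii of constancy uniform and bounds the
  location of the support.\<close>

lemma padic_test_function_step:
  fixes h :: "'p::prime_card padic \<Rightarrow> complex"
  assumes h: "padic_test_function h"
  shows "\<exists>n. padic_step n n h"
proof -
  define S where "S = closure {x. h x \<noteq> 0}"
  have S: "compact S" using h by (simp add: S_def padic_test_function_def)
  have hS: "h x = 0" if "x \<notin> S" for x using that closure_subset[of "{x. h x \<noteq> 0}"] by (auto simp: S_def)
  have "\<forall>x. \<exists>m::nat. \<forall>y\<in>pdisc x (int m). h y = h x"
  proof
    fix x
    obtain e where "e > 0" "\<forall>y\<in>ball x e. h y = h x" using h unfolding padic_test_function_def by blast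
    thus "\<exists>m::nat. \<forall>y\<in>pdisc x (int m). h y = h x" using pdisc_subset_ball[of e x] by blast
  qed
  then obtain M where M: "\<And>x y. y \<in> pdisc x (int (M x)) \<Longrightarrow> h y = h x" by metis
  have "S \<subseteq> (\<Union>x\<in>S. pdisc x (int (M x)))" by (auto simp: mem_pdisc_iff)
  then obtain T where T: "T \<subseteq> S" "finite T" "S \<subseteq> (\<Union>x\<in>T. pdisc x (int (M x)))"
    using S open_pdisc by (elim compactE_image) auto
  obtain K where K: "\<And>x. x \<in> T \<Longrightarrow> x \<in> pball (- int (K x))" using pball_exhaust by metis
  \<comment> \<open>One exponent dominates finitely many radii (M) and center sizes (K); the 0 keeps
    the maximum defined for an empty cover.\<close>
  define n where "n = Max (insert 0 (M ` T \<union> K ` T))"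
  have n: "M x \<le> n" "K x \<le> n" if "x \<in> T" for x using that T(2) by (simp_all add: n_def)
  have loc: "h (x + z) = h x" if x: "x \<in> S" and z: "z \<in> pball (int n)" for x z
  proof -
    obtain t where t: "t \<in> T" "x \<in> pdisc t (int (M t))" using T(3) x by blast
    have "z \<in> pball (int (M t))" using z n(1)[OF t(1)] by (auto intro: pball_monoD)
    hence "x + z \<in> pdisc t (int (M t))" using t(2) pball_add[of "x - t" _ z] by (simp add: mem_pdisc_iff algebra_simps)
    thus ?thesis using M t(2) by metis
  qed
  have "padic_step n n h" unfolding padic_step_def
  proof (intro conjI allI impI ballI)
    fix x :: "'p padic" assume x: "x \<notin> pball (- int n)"
    show "h x = 0"
    proof (rule ccontr)
      assume "h x \<noteq> 0"
      hence "x \<in> S" using hS by blast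
      then obtain t where t: "t \<in> T" "x \<in> pdisc t (int (M t))" using T(3) by blast
      have "x - t \<in> pball (- int n)" using t(2) unfolding mem_pdisc_iff by (rule pball_monoD) simp
      moreover have "t \<in> pball (- int n)" using K[OF t(1)] by (rule pball_monoD) (simp add: n(2)[OF t(1)])
      ultimately show False using pball_add[of "x - t" "- int n" t] x by simp
    qed
  next
    fix x z :: "'p padic" assume z: "z \<in> pball (int n)"
    show "h (x + z) = h x"
    proof (cases "x \<in> S")
      \<comment> \<open>If x + z lies in S, local constancy is applied backwards from there;
        otherwise both values vanish.\<close>
      case False
      thus ?thesis using loc[of "x + z" "- z"] z hS[of "x + z"] hS[of x] by (cases "x + z \<in> S") auto
    qed (rule loc[OF _ z])
  qed
  thus ?thesis ..
qed

section \<open>The refinable function\<close>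

text \<open>The inverse Fourier transform of a step function supported in the unit disc.\<close>

definition padic_synth :: "nat \<Rightarrow> ('p::prime_card padic \<Rightarrow> complex) \<Rightarrow> 'p padic \<Rightarrow> complex" where
  "padic_synth N w x = (if x \<in> pball (- int N)
     then (\<Sum>l<CARD('p) ^ N. w (of_nat l) * padic_char (- (of_nat l * x))) / of_nat CARD('p) ^ N else 0)"

lemma padic_step_synth: "padic_step N 0 (padic_synth N w)"
  unfolding padic_step_def
proof (intro conjI allI impI ballI)
  fix x z :: "'a padic" assume z: "z \<in> pball (int 0)"
  have "padic_char (- (of_nat l * (x + z))) = padic_char (- (of_nat l * x))" for l
    using pball_mult[OF of_nat_pball_0[of l] z] by (intro padic_char_cong) (simp add: algebra_simps)
  moreover have "x + z \<in> pball (- int N) \<longleftrightarrow> x \<in> pball (- int N)"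
    by (rule pball_add_iff', rule pball_monoD[OF z]) simp
  ultimately show "padic_synth N w (x + z) = padic_synth N w x" by (simp add: padic_synth_def)
qed (simp add: padic_synth_def)

text \<open>Inversion on a finite group: after interchanging sums, the sum over k is p^N if \<xi>
  and l are congruent modulo p^N and 0 otherwise. What remains is the disc expansion of w. Cosets of
  Z_p have measure 1, so the factor p^(-N) in \<open>padic_synth\<close> is the whole
  normalization.\<close>

lemma padic_fourier_synth:
  fixes \<mu> :: "'p::prime_card padic measure"
  assumes haar: "is_haar \<mu>" and w: "padic_step 0 N w"
  shows "padic_fourier \<mu> (padic_synth N w) = w"
proof
  fix \<xi> :: "'p padic"
  let ?Q = "CARD('p) ^ N"
  show "padic_fourier \<mu> (padic_synth N w) \<xi> = w \<xi>"
  proof (cases "\<xi> \<in> pball 0")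
    case True
    have "padic_char (\<xi> * (of_nat k / unif ^ N)) * padic_synth N w (of_nat k / unif ^ N)
      = (\<Sum>l<?Q. w (of_nat l) / of_nat ?Q * padic_char (of_nat k * ((\<xi> - of_nat l) / unif ^ N)))" for k
      by (simp add: padic_synth_def frac_pball sum_distrib_left sum_divide_distrib mult_ac diff_divide_distrib right_diff_distrib
         flip: padic_char_add)
    hence "padic_fourier \<mu> (padic_synth N w) \<xi>
      = (\<Sum>k<?Q. \<Sum>l<?Q. w (of_nat l) / of_nat ?Q * padic_char (of_nat k * ((\<xi> - of_nat l) / unif ^ N)))"
      using padic_fourier_step[OF haar padic_step_synth[of N w], of \<xi>] True by simp
    also have "\<dots> = (\<Sum>l<?Q. w (of_nat l) / of_nat ?Q * (\<Sum>k<?Q. padic_char (of_nat k * ((\<xi> - of_nat l) / unif ^ N))))"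
      by (subst sum.swap) (simp only: sum_distrib_left)
    also have "\<dots> = (\<Sum>l<?Q. indicator (pdisc (of_nat l) (int N)) \<xi> *\<^sub>R w (of_nat l))"
    proof (intro sum.cong refl)
      fix l
      have "unif powi (int N) * ((\<xi> - of_nat l) / unif ^ N) \<in> pball 0"
        using pball_diff[OF True of_nat_pball_0[of l]] by simp
      hence "(\<xi> - of_nat l) / unif ^ N \<in> pball (- int N)" by (subst (asm) pball_powi_mult_iff) simp
      moreover have "(\<xi> - of_nat l) / unif ^ N \<in> pball 0 \<longleftrightarrow> \<xi> \<in> pdisc (of_nat l) (int N)"
        using pball_powi_mult_iff[of "int N" "(\<xi> - of_nat l) / unif ^ N" "int N"] by (simp add: mem_pdisc_iff)
      ultimately show "w (of_nat l) / of_nat ?Q * (\<Sum>k<?Q. padic_char (of_nat k * ((\<xi> - of_nat l) / unif ^ N)))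
         = indicator (pdisc (of_nat l) (int N)) \<xi> *\<^sub>R w (of_nat l)"
        by (simp only: sum_padic_char) (simp add: indicator_def)
    qed
    also have "\<dots> = w \<xi>" using padic_step_eq_sum[OF w, of \<xi>] by simp
    finally show ?thesis .
  next
    case False
    thus ?thesis using padic_fourier_step_vanish[OF haar padic_step_synth] padic_step_vanish[OF w] by simp
  qed
qed

text \<open>Translation by d modulates the spectrum. Parseval turns the correlation into the sum of
  |w(l)|^2 times the character of l * d, and constant modulus leaves C^2 times a character sum. The
  normalizing powers of p^N cancel.\<close>

lemma padic_synth_correlation:
  fixes w :: "'p::prime_card padic \<Rightarrow> complex"
  assumes w: "\<And>\<xi>. \<xi> \<in> pball 0 \<Longrightarrow> cmod (w \<xi>) = C"
  shows "(\<Sum>k<CARD('p) ^ N. padic_synth N w (of_nat k / unif ^ N) * cnj (padic_synth N w (of_nat k / unif ^ N + d)))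
    = (if d \<in> pball 0 then of_real (C\<^sup>2) else 0)"
proof (cases "d \<in> pball (- int N)")
  case True
  let ?Q = "CARD('p) ^ N"
  let ?F = "\<lambda>(c :: nat \<Rightarrow> complex) l. \<Sum>k<?Q. padic_char (of_nat l * (of_nat k / unif ^ N :: 'p padic)) * c k"
  have kd: "of_nat k / unif ^ N + d \<in> pball (- int N)" for k
    using pball_add[OF frac_pball True] .
  \<comment> \<open>The synthesis uses conjugated characters, so each factor is rewritten as a
    discrete transform of the conjugated spectrum, the form that \<open>dft_parseval\<close>
    accepts.\<close>
  have 1: "padic_synth N w (of_nat k / unif ^ N) = cnj (?F (\<lambda>l. cnj (w (of_nat l))) k) / of_nat ?Q" for k
    by (simp add: padic_synth_def frac_pball padic_char_minus mult_ac)
  have 2: "cnj (padic_synth N w (of_nat k / unif ^ N + d)) = ?F (\<lambda>l. cnj (w (of_nat l)) * padic_char (of_nat l * d)) k / of_nat ?Q" for k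
  proof -
    have "cnj (padic_char (- (of_nat l * (of_nat k / unif ^ N + d)))) = padic_char (of_nat l * d) * padic_char (of_nat k * (of_nat l / unif ^ N) :: 'p padic)" for l
    proof -
      have "of_nat l * (of_nat k / unif ^ N + d) = of_nat l * d + of_nat k * (of_nat l / unif ^ N)"
        by (simp add: algebra_simps)
      thus ?thesis by (simp only: padic_char_minus complex_cnj_cnj padic_char_add)
    qed
    thus ?thesis unfolding padic_synth_def if_P[OF kd]
      by (simp only: complex_cnj_divide cnj_sum complex_cnj_mult complex_cnj_power complex_cnj_of_nat of_nat_power mult_ac)
  qed
  have "(\<Sum>k<?Q. padic_synth N w (of_nat k / unif ^ N) * cnj (padic_synth N w (of_nat k / unif ^ N + d)))
    = (\<Sum>k<?Q. ?F (\<lambda>l. cnj (w (of_nat l)) * padic_char (of_nat l * d)) k * cnj (?F (\<lambda>l. cnj (w (of_nat l))) k)) / (of_nat ?Q * of_nat ?Q)"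
    unfolding 1 2 by (subst sum_divide_distrib) (intro sum.cong refl, simp only: times_divide_times_eq mult.commute)
  also have "\<dots> = of_nat ?Q * (\<Sum>l<?Q. (cnj (w (of_nat l)) * padic_char (of_nat l * d)) * cnj (cnj (w (of_nat l)))) / (of_nat ?Q * of_nat ?Q)"
    by (subst dft_parseval) (rule refl)
  also have "(\<Sum>l<?Q. (cnj (w (of_nat l)) * padic_char (of_nat l * d)) * cnj (cnj (w (of_nat l))))
     = (\<Sum>l<?Q. of_real (C\<^sup>2) * padic_char (of_nat l * d))"
  proof (intro sum.cong refl)
    fix l
    have "w (of_nat l) * cnj (w (of_nat l)) = of_real (C\<^sup>2)"
      using complex_norm_square[of "w (of_nat l)"] w[OF of_nat_pball_0[of l]] by simp
    thus "(cnj (w (of_nat l)) * padic_char (of_nat l * d)) * cnj (cnj (w (of_nat l))) = of_real (C\<^sup>2) * padic_char (of_nat l * d)"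
      by (metis complex_cnj_cnj mult.assoc mult.commute)
  qed
  also have "\<dots> = of_real (C\<^sup>2) * (if d \<in> pball 0 then of_nat ?Q else 0)"
    unfolding sum_distrib_left[symmetric] sum_padic_char[OF True] ..
  finally show ?thesis by simp
next
  case False
  \<comment> \<open>Translation by such a d moves the whole support p^(-N)Z_p off itself, so every
    product vanishes.\<close>
  have "of_nat k / unif ^ N + d \<notin> pball (- int N)" for k
    using False pball_add_iff[OF frac_pball, of k N d] by simp
  moreover have "d \<notin> pball 0" using False pball_monoD[of d 0 "- int N"] by auto
  ultimately show ?thesis by (simp add: padic_synth_def)
qed

section \<open>The mask and its infinite product\<close>

lemma padic_mask_cong: "x - y \<in> pball 0 \<Longrightarrow> padic_mask s \<beta> x = padic_mask s \<beta> y"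
  unfolding padic_mask_def
proof (intro arg_cong2[where f="(*)"] sum.cong refl)
  fix k assume "x - y \<in> pball 0"
  from pball_mult[OF of_nat_pball_0 this, of k]
  show "padic_char (of_nat k * x) = padic_char (of_nat k * y)"
    by (intro padic_char_cong) (simp add: algebra_simps)
qed

context
  fixes s :: nat and \<beta> :: "nat \<Rightarrow> complex" and m\<^sub>0 :: "'p::prime_card padic \<Rightarrow> complex"
  assumes s: "s \<ge> 1" and m0: "m\<^sub>0 = padic_mask s \<beta>" and m0_0: "m\<^sub>0 0 = 1"
    and m0_zero: "\<forall>k \<in> {1..CARD('p) ^ s - 1}. \<not> CARD('p) dvd k \<longrightarrow>
           m\<^sub>0 (of_nat k / of_nat CARD('p) ^ s) = 0"
    and m0_unimod: "\<forall>k \<in> {1..CARD('p) ^ s - 1}. CARD('p) dvd k \<longrightarrow>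
           cmod (m\<^sub>0 (of_nat k / of_nat CARD('p) ^ s)) = 1"
begin

lemma mask_1: "x \<in> pball 0 \<Longrightarrow> m\<^sub>0 x = 1"
  using padic_mask_cong[of x 0 s \<beta>] m0 m0_0 by simp

text \<open>Periodicity moves x to a sample point k/p^s, and x lies in p^(1-s)Z_p exactly when p
  divides k. The index k = 0, outside the range of the two sampling hypotheses, is covered by the
  value 1 at 0.\<close>

lemma mask_values:
  assumes x: "x \<in> pball (- int s)"
  shows "x \<in> pball (1 - int s) \<Longrightarrow> cmod (m\<^sub>0 x) = 1" and "x \<notin> pball (1 - int s) \<Longrightarrow> m\<^sub>0 x = 0"
proof -
  obtain k where k: "k < CARD('p) ^ s" "x - of_nat k / unif ^ s \<in> pball 0"
    using padic_approx[OF x, of 0] by auto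
  have mk: "m\<^sub>0 x = m\<^sub>0 (of_nat k / unif ^ s)" unfolding m0 by (rule padic_mask_cong[OF k(2)])
  have "x - of_nat k / unif ^ s \<in> pball (1 - int s)" using k(2) s by (auto intro: pball_monoD)
  hence "x \<in> pball (1 - int s) \<longleftrightarrow> of_nat k / unif ^ s \<in> (pball (1 - int s) :: 'p padic set)"
    using pball_add_iff[of "x - of_nat k / unif ^ s" "1 - int s" "of_nat k / unif ^ s"] by simp
  also have "\<dots> \<longleftrightarrow> of_nat k \<in> (pball 1 :: 'p padic set)"
    using pball_powi_mult_iff[of "int s" "of_nat k / unif ^ s :: 'p padic" 1] by simp
  also have "\<dots> \<longleftrightarrow> CARD('p) dvd k"
    using of_int_pball_iff[of "int k" 1, where 'p='p] by simp
  finally have dvd: "x \<in> pball (1 - int s) \<longleftrightarrow> CARD('p) dvd k" .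
  show "cmod (m\<^sub>0 x) = 1" if "x \<in> pball (1 - int s)"
    using that dvd m0_unimod k(1) m0_0 by (cases "k = 0") (auto simp: mk)
  show "m\<^sub>0 x = 0" if "x \<notin> pball (1 - int s)"
    using that dvd m0_zero k(1) by (cases "k = 0") (auto simp: mk)
qed

lemma mask_product_properties:
  fixes w :: "'p padic \<Rightarrow> complex"
  assumes w: "\<forall>\<xi>. w \<xi> = w 0 * prodinf (\<lambda>i. m\<^sub>0 (\<xi> / of_nat CARD('p) powi (int s - int (Suc i))))"
  shows "padic_step 0 (s - 1) w" and "\<And>\<xi>. \<xi> \<in> pball 0 \<Longrightarrow> cmod (w \<xi>) = cmod (w 0)"
proof -
  \<comment> \<open>Indices start at 0: factor i has argument \<xi> * p^(i+1-s).\<close>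
  define f where "f \<xi> i = m\<^sub>0 (\<xi> / of_nat CARD('p) powi (int s - int (Suc i)))" for \<xi> i
  have w': "w \<xi> = w 0 * prodinf (f \<xi>)" for \<xi> using w unfolding f_def by blast
  have mem: "\<xi> / of_nat CARD('p) powi (int s - (1 + int i)) \<in> pball n \<longleftrightarrow> \<xi> \<in> pball (n + (int s - (1 + int i)))"
    for \<xi> :: "'p padic" and i n
    using pball_powi_mult_iff[of "int s - (1 + int i)" "\<xi> / unif powi (int s - (1 + int i))" "n + (int s - (1 + int i))"]
    by (simp add: algebra_simps)
  have f1: "f \<xi> i = 1" if "\<xi> \<in> pball (int s - int (Suc i))" for \<xi> i
    unfolding f_def using that by (intro mask_1) (simp add: mem)
  \<comment> \<open>From index s + N on, the arguments are p-adic integers, where the mask is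
    1.\<close>
  have fin: "prodinf (f \<xi>) = (\<Prod>i<s+N. f \<xi> i)" if "\<xi> \<in> pball (- int N)" for \<xi> N
    using that by (intro prodinf_finite f1) (auto intro: pball_monoD)
  have zero: "w \<xi> = 0" if \<xi>: "\<xi> \<notin> pball 0" for \<xi>
  proof -
    \<comment> \<open>So |\<xi>| = p^N with N >= 1. The factor of index N - 1 has argument \<xi> *
      p^(N-s), which lies in p^(-s)Z_p but not in p^(1-s)Z_p, and vanishes.\<close>
    define N where "N = (LEAST n. \<xi> \<in> pball (- int n))"
    have N: "\<xi> \<in> pball (- int N)" unfolding N_def using pball_exhaust by (rule LeastI_ex)
    hence "N \<noteq> 0" using \<xi> by (cases "N = 0") auto
    then obtain M where M: "N = Suc M" by (cases N) auto
    have NM: "\<xi> \<notin> pball (- int M)" using not_less_Least[of M "\<lambda>n. \<xi> \<in> pball (- int n)"] M unfolding N_def by auto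
    have "f \<xi> M = 0" unfolding f_def using N NM M by (intro mask_values) (simp_all add: mem)
    hence "(\<Prod>i<s+N. f \<xi> i) = 0" using M by (intro prod_zero) auto
    thus ?thesis using fin[OF N] w'[of \<xi>] by simp
  qed
  show "cmod (w \<xi>) = cmod (w 0)" if \<xi>: "\<xi> \<in> pball 0" for \<xi>
  proof -
    have "cmod (f \<xi> i) = 1" for i
      unfolding f_def using \<xi> by (intro mask_values) (auto simp: mem intro: pball_monoD)
    hence "cmod (prodinf (f \<xi>)) = 1" using fin[of \<xi> 0] \<xi> by (simp add: prod_norm[symmetric])
    thus ?thesis using w'[of \<xi>] by (simp add: norm_mult)
  qed
  show "padic_step 0 (s - 1) w"
    unfolding padic_step_def
  proof (intro conjI allI impI ballI)
    fix \<xi> z :: "'p padic" assume z: "z \<in> pball (int (s - 1))"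
    have "f (\<xi> + z) i = f \<xi> i" for i
      unfolding f_def m0
    proof (rule padic_mask_cong)
      \<comment> \<open>The case i = 0 is the restrictive one and dictates the period exponent s -
        1.\<close>
      have "z / of_nat CARD('p) powi (int s - (1 + int i)) \<in> pball 0"
        unfolding mem by (rule pball_monoD[OF z]) (use s in simp)
      thus "(\<xi> + z) / of_nat CARD('p) powi (int s - int (Suc i)) - \<xi> / of_nat CARD('p) powi (int s - int (Suc i)) \<in> pball 0"
        by (simp add: add_divide_distrib)
    qed
    hence "f (\<xi> + z) = f \<xi>" by blast
    thus "w (\<xi> + z) = w \<xi>" using w'[of \<xi>] w'[of "\<xi> + z"] by simp
  qed (simp add: zero)
qed

end

section \<open>Square integrable functions and closures\<close>

definition L2_sq :: "'a measure \<Rightarrow> ('a \<Rightarrow> complex) \<Rightarrow> real" where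
  "L2_sq M f = (LINT x|M. (cmod (f x))\<^sup>2)"

lemma L2_sq_nonneg [simp]: "L2_sq M f \<ge> 0"
  by (simp add: L2_sq_def)

lemma L2_norm_eq: "L2_norm M f = sqrt (L2_sq M f)"
  by (simp add: L2_norm_def L2_sq_def)

lemma L2_sq_eq: "L2_sq M f = (L2_norm M f)\<^sup>2"
  by (simp add: L2_norm_eq)

lemma L2D: "f \<in> L2 M \<Longrightarrow> f \<in> borel_measurable M" "f \<in> L2 M \<Longrightarrow> integrable M (\<lambda>x. (cmod (f x))\<^sup>2)"
  by (auto simp: L2_def)

text \<open>
  In all limit arguments below this crude inequality, which costs a factor 2, replaces Minkowski's
  inequality.
\<close>

lemma cmod_add_sq_le: "(cmod (a + b))\<^sup>2 \<le> 2 * (cmod a)\<^sup>2 + 2 * (cmod b)\<^sup>2"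
proof -
  have "(cmod (a + b))\<^sup>2 \<le> (cmod a + cmod b)\<^sup>2" by (intro power_mono norm_triangle_ineq) auto
  also have "\<dots> \<le> 2 * (cmod a)\<^sup>2 + 2 * (cmod b)\<^sup>2"
    using sum_squares_bound[of "cmod a" "cmod b"] by (simp add: power2_sum)
  finally show ?thesis .
qed

lemma L2_bound:
  assumes "f \<in> borel_measurable M" "g \<in> L2 M" "\<And>x. cmod (f x) \<le> C * cmod (g x)"
  shows "f \<in> L2 M"
proof -
  have "integrable M (\<lambda>x. (cmod (f x))\<^sup>2)"
  proof (rule Bochner_Integration.integrable_bound)
    show "integrable M (\<lambda>x. C\<^sup>2 * (cmod (g x))\<^sup>2)" using L2D(2)[OF assms(2)] by simp
    have "(cmod (f x))\<^sup>2 \<le> C\<^sup>2 * (cmod (g x))\<^sup>2" for x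
      using power_mono[OF assms(3)[of x], of 2] by (simp add: power_mult_distrib)
    thus "AE x in M. norm ((cmod (f x))\<^sup>2) \<le> norm (C\<^sup>2 * (cmod (g x))\<^sup>2)" by simp
  qed (use assms(1) in measurable)
  thus ?thesis using assms(1) by (simp add: L2_def)
qed

lemma L2_scale: "f \<in> L2 M \<Longrightarrow> (\<lambda>x. c * f x) \<in> L2 M"
  by (rule L2_bound[of _ M f "cmod c"]) (auto simp: norm_mult dest: L2D)

lemma L2_add: "f \<in> L2 M \<Longrightarrow> g \<in> L2 M \<Longrightarrow> (\<lambda>x. f x + g x) \<in> L2 M"
proof -
  assume f: "f \<in> L2 M" and g: "g \<in> L2 M"
  note [measurable] = L2D(1)[OF f] L2D(1)[OF g]
  have "integrable M (\<lambda>x. (cmod (f x + g x))\<^sup>2)"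
  proof (rule Bochner_Integration.integrable_bound)
    show "integrable M (\<lambda>x. 2 * (cmod (f x))\<^sup>2 + 2 * (cmod (g x))\<^sup>2)"
      using L2D(2)[OF f] L2D(2)[OF g] by simp
    show "AE x in M. norm ((cmod (f x + g x))\<^sup>2) \<le> norm (2 * (cmod (f x))\<^sup>2 + 2 * (cmod (g x))\<^sup>2)"
      using cmod_add_sq_le by (intro AE_I2) simp
  qed measurable
  thus ?thesis by (simp add: L2_def)
qed

lemma L2_zero: "(\<lambda>x. 0) \<in> L2 M"
  by (simp add: L2_def)

lemma L2_diff: "f \<in> L2 M \<Longrightarrow> g \<in> L2 M \<Longrightarrow> (\<lambda>x. f x - g x) \<in> L2 M"
  using L2_add[of f M "\<lambda>x. (-1) * g x"] L2_scale[of g M "-1"] by simp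

lemma subspace_funI:
  assumes "(\<lambda>x. 0) \<in> S" "\<And>f g. f \<in> S \<Longrightarrow> g \<in> S \<Longrightarrow> (\<lambda>x. f x + g x) \<in> S"
    "\<And>c f. f \<in> S \<Longrightarrow> (\<lambda>x. c * f x) \<in> S"
  shows "cfun.subspace S"
  using assms by (auto simp: cfun.subspace_def zero_fun_def plus_fun_def)

lemma subspace_funD:
  assumes "cfun.subspace S"
  shows "(\<lambda>x. 0) \<in> S" "\<And>f g. f \<in> S \<Longrightarrow> g \<in> S \<Longrightarrow> (\<lambda>x. f x + g x) \<in> S"
    "\<And>c f. f \<in> S \<Longrightarrow> (\<lambda>x. c * f x) \<in> S" "\<And>f g. f \<in> S \<Longrightarrow> g \<in> S \<Longrightarrow> (\<lambda>x. f x - g x) \<in> S"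
proof -
  show "(\<lambda>x. 0) \<in> S" and add: "\<And>f g. f \<in> S \<Longrightarrow> g \<in> S \<Longrightarrow> (\<lambda>x. f x + g x) \<in> S"
    and scale: "\<And>c f. f \<in> S \<Longrightarrow> (\<lambda>x. c * f x) \<in> S"
    using assms by (auto simp: cfun.subspace_def zero_fun_def plus_fun_def)
  show "(\<lambda>x. f x - g x) \<in> S" if "f \<in> S" "g \<in> S" for f g
    using add[OF that(1) scale[OF that(2), of "-1"]] by simp
qed

lemma subspace_fun_sum:
  assumes S: "cfun.subspace S" and f: "\<And>i. i \<in> A \<Longrightarrow> f i \<in> S"
  shows "(\<lambda>x. \<Sum>i\<in>A. c i * f i x) \<in> S"
  using f
proof (induction A rule: infinite_finite_induct)
  case (insert i A)
  thus ?case using subspace_funD(2)[OF S subspace_funD(3)[OF S, of "f i" "c i"]] by simp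
qed (use subspace_funD(1)[OF S] in simp_all)

lemma L2_sq_add_le:
  assumes f: "f \<in> L2 M" and g: "g \<in> L2 M"
  shows "L2_sq M (\<lambda>x. f x + g x) \<le> 2 * L2_sq M f + 2 * L2_sq M g"
proof -
  have "L2_sq M (\<lambda>x. f x + g x) \<le> (LINT x|M. 2 * (cmod (f x))\<^sup>2 + 2 * (cmod (g x))\<^sup>2)"
    unfolding L2_sq_def using L2D(2)[OF f] L2D(2)[OF g] L2D(2)[OF L2_add[OF f g]] cmod_add_sq_le
    by (intro integral_mono) auto
  also have "\<dots> = 2 * L2_sq M f + 2 * L2_sq M g"
    unfolding L2_sq_def using L2D(2)[OF f] L2D(2)[OF g] by simp
  finally show ?thesis .
qed

lemma L2_sq_triangle:
  assumes "f \<in> L2 M" "g \<in> L2 M" "h \<in> L2 M"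
  shows "L2_sq M (\<lambda>x. f x - h x) \<le> 2 * L2_sq M (\<lambda>x. f x - g x) + 2 * L2_sq M (\<lambda>x. g x - h x)"
  using L2_sq_add_le[OF L2_diff[OF assms(1,2)] L2_diff[OF assms(2,3)]] by simp

lemma L2_sq_commute: "L2_sq M (\<lambda>x. f x - g x) = L2_sq M (\<lambda>x. g x - f x)"
  by (simp add: L2_sq_def norm_minus_commute)

lemma L2_sq_scale: "L2_sq M (\<lambda>x. c * f x) = (cmod c)\<^sup>2 * L2_sq M f"
  by (simp add: L2_sq_def norm_mult power_mult_distrib)

lemma L2_sq_cong_AE:
  assumes "f \<in> borel_measurable M" "g \<in> borel_measurable M" "AE x in M. f x = g x"
  shows "L2_sq M f = L2_sq M g"
  unfolding L2_sq_def using assms(3) by (intro integral_cong_AE) (use assms in auto)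

lemma L2_cong_AE:
  assumes f: "f \<in> L2 M" and g: "g \<in> borel_measurable M" and eq: "AE x in M. f x = g x"
  shows "g \<in> L2 M"
proof -
  have "integrable M (\<lambda>x. (cmod (f x))\<^sup>2) \<longleftrightarrow> integrable M (\<lambda>x. (cmod (g x))\<^sup>2)"
    using eq by (intro integrable_cong_AE) (use L2D(1)[OF f] g in auto)
  thus ?thesis using f g by (simp add: L2_def)
qed

section \<open>Closures in squared norm\<close>

lemma L2_closure_iff:
  "f \<in> L2_closure M S \<longleftrightarrow> f \<in> L2 M \<and> (\<forall>e>0. \<exists>g\<in>S \<inter> L2 M. L2_sq M (\<lambda>x. f x - g x) < e)"
proof (intro iffI conjI allI impI)
  assume f: "f \<in> L2_closure M S"
  thus "f \<in> L2 M" by (simp add: L2_closure_def)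
  fix e :: real assume e: "e > 0"
  hence "sqrt e > 0" by simp
  then obtain g where "g \<in> S \<inter> L2 M" "L2_norm M (f - g) < sqrt e" using f unfolding L2_closure_def by blast
  thus "\<exists>g\<in>S \<inter> L2 M. L2_sq M (\<lambda>x. f x - g x) < e" by (auto simp: L2_norm_eq fun_diff_def)
next
  assume *: "f \<in> L2 M \<and> (\<forall>e>0. \<exists>g\<in>S \<inter> L2 M. L2_sq M (\<lambda>x. f x - g x) < e)"
  have "\<exists>g\<in>S \<inter> L2 M. L2_norm M (f - g) < e" if e: "e > 0" for e
  proof -
    have "e\<^sup>2 > 0" using e by simp
    then obtain g where g: "g \<in> S \<inter> L2 M" "L2_sq M (\<lambda>x. f x - g x) < e\<^sup>2" using * by blast
    have "L2_norm M (f - g) < sqrt (e\<^sup>2)" using g(2) unfolding L2_norm_eq real_sqrt_less_iff by (simp add: fun_diff_def)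
    thus ?thesis using g(1) e by auto
  qed
  thus "f \<in> L2_closure M S" using * by (simp add: L2_closure_def)
qed

lemma L2_closure_subset_L2: "L2_closure M S \<subseteq> L2 M"
  by (auto simp: L2_closure_def)

lemma L2_closure_superset: "S \<inter> L2 M \<subseteq> L2_closure M S"
proof
  fix f assume f: "f \<in> S \<inter> L2 M"
  have "L2_sq M (\<lambda>x. f x - f x) = 0" by (simp add: L2_sq_def)
  thus "f \<in> L2_closure M S" using f unfolding L2_closure_iff by (metis IntD2)
qed

lemma L2_closure_base: "f \<in> S \<Longrightarrow> f \<in> L2 M \<Longrightarrow> f \<in> L2_closure M S"
  using L2_closure_superset by blast

lemma L2_closure_mono: "S \<subseteq> T \<Longrightarrow> L2_closure M S \<subseteq> L2_closure M T"
  unfolding L2_closure_iff subset_iff by blast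

lemma L2_closure_idem: "L2_closure M (L2_closure M S) = L2_closure M S"
proof
  show "L2_closure M (L2_closure M S) \<subseteq> L2_closure M S"
  proof
    fix f assume f: "f \<in> L2_closure M (L2_closure M S)"
    hence f2: "f \<in> L2 M" using L2_closure_subset_L2 by blast
    have "\<exists>g\<in>S \<inter> L2 M. L2_sq M (\<lambda>x. f x - g x) < e" if e: "e > 0" for e
    proof -
      \<comment> \<open>Two errors below e/4, each doubled by \<open>L2_sq_triangle\<close>, add up
        to less than e.\<close>
      have e4: "e / 4 > 0" using e by simp
      obtain g where g: "g \<in> L2_closure M S" "g \<in> L2 M" "L2_sq M (\<lambda>x. f x - g x) < e / 4"
        using f e4 unfolding L2_closure_iff[of f] by blast
      obtain h where h: "h \<in> S \<inter> L2 M" "L2_sq M (\<lambda>x. g x - h x) < e / 4"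
        using g(1) e4 unfolding L2_closure_iff[of g] by blast
      have "L2_sq M (\<lambda>x. f x - h x) < e" using L2_sq_triangle[OF f2 g(2), of h] g(3) h by simp
      thus ?thesis using h(1) by blast
    qed
    thus "f \<in> L2_closure M S" using f2 by (simp add: L2_closure_iff)
  qed
  show "L2_closure M S \<subseteq> L2_closure M (L2_closure M S)"
    using L2_closure_superset[of "L2_closure M S" M] L2_closure_subset_L2[of M S] by blast
qed

lemma L2_closure_limit:
  assumes "f \<in> L2 M" "\<And>n. h n \<in> L2_closure M S" "(\<lambda>n::nat. L2_sq M (\<lambda>x. f x - h n x)) \<longlonglongrightarrow> 0"
  shows "f \<in> L2_closure M S"
proof -
  have "\<exists>g\<in>L2_closure M S \<inter> L2 M. L2_sq M (\<lambda>x. f x - g x) < e" if e: "e > 0" for e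
  proof -
    have "\<forall>\<^sub>F n in sequentially. L2_sq M (\<lambda>x. f x - h n x) < e" using assms(3) e by (rule order_tendstoD)
    then obtain n where "L2_sq M (\<lambda>x. f x - h n x) < e" using eventually_happens'[OF sequentially_bot] by blast
    thus ?thesis using assms(2)[of n] L2_closure_subset_L2 by blast
  qed
  hence "f \<in> L2_closure M (L2_closure M S)" using assms(1) by (simp add: L2_closure_iff[of _ _ "L2_closure M S"])
  thus ?thesis by (simp add: L2_closure_idem)
qed

text \<open>The constant sequence f also converges to g. Replacing \<phi> by its periodic version
  inside closures rests on this.\<close>

lemma L2_closure_cong_AE:
  assumes f: "f \<in> L2_closure M S" and g: "g \<in> borel_measurable M" and eq: "AE x in M. f x = g x"
  shows "g \<in> L2_closure M S"
proof -
  have f2: "f \<in> L2 M" using f L2_closure_subset_L2 by blast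
  have g2: "g \<in> L2 M" by (rule L2_cong_AE[OF f2 g eq])
  have "L2_sq M (\<lambda>x. g x - f x) = L2_sq M (\<lambda>x. 0)"
    using eq by (intro L2_sq_cong_AE) (use L2D(1)[OF f2] g in auto)
  thus ?thesis using f by (intro L2_closure_limit[of g M "\<lambda>_. f", OF g2]) (simp_all add: L2_sq_def)
qed

text \<open>Dominated convergence with majorant (1 + C)^2 |f|^2. It handles truncations and partial
  unions with C = 1, and approximation by simple functions with C = 2.\<close>

lemma L2_closure_dominated:
  assumes f: "f \<in> L2 M" and h: "\<And>n. h n \<in> L2_closure M S"
    and lim: "\<And>x. (\<lambda>n::nat. h n x) \<longlonglongrightarrow> f x" and bound: "\<And>n x. cmod (h n x) \<le> C * cmod (f x)"
  shows "f \<in> L2_closure M S"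
proof (rule L2_closure_limit[OF f h])
  have h2: "h n \<in> L2 M" for n using h L2_closure_subset_L2 by blast
  note [measurable] = L2D(1)[OF f] L2D(1)[OF h2]
  have "(\<lambda>n. LINT x|M. (cmod (f x - h n x))\<^sup>2) \<longlonglongrightarrow> (LINT x|M. 0)"
  proof (rule integral_dominated_convergence)
    show "integrable M (\<lambda>x. (1 + C)\<^sup>2 * (cmod (f x))\<^sup>2)" using L2D(2)[OF f] by simp
    have "(\<lambda>n. (cmod (f x - h n x))\<^sup>2) \<longlonglongrightarrow> (cmod (f x - f x))\<^sup>2" for x
      by (intro tendsto_intros lim)
    thus "AE x in M. (\<lambda>n. (cmod (f x - h n x))\<^sup>2) \<longlonglongrightarrow> 0" by simp
    have "cmod (f x - h n x) \<le> (1 + C) * cmod (f x)" for n x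
      using norm_triangle_ineq4[of "f x" "h n x"] bound[of n x] by (simp add: algebra_simps)
    hence "(cmod (f x - h n x))\<^sup>2 \<le> (1 + C)\<^sup>2 * (cmod (f x))\<^sup>2" for n x
      using power_mono[of "cmod (f x - h n x)" "(1 + C) * cmod (f x)" 2] by (simp add: power_mult_distrib)
    thus "\<And>n. AE x in M. norm ((cmod (f x - h n x))\<^sup>2) \<le> (1 + C)\<^sup>2 * (cmod (f x))\<^sup>2" by simp
  qed measurable
  thus "(\<lambda>n. L2_sq M (\<lambda>x. f x - h n x)) \<longlonglongrightarrow> 0" by (simp add: L2_sq_def)
qed

lemma subspace_L2_closure:
  assumes S: "cfun.subspace S"
  shows "cfun.subspace (L2_closure M S)"
proof (rule subspace_funI)
  show "(\<lambda>x. 0) \<in> L2_closure M S" by (intro L2_closure_base L2_zero subspace_funD(1)[OF S])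
next
  fix f g assume f: "f \<in> L2_closure M S" and g: "g \<in> L2_closure M S"
  have fg: "f \<in> L2 M" "g \<in> L2 M" using f g L2_closure_subset_L2 by blast+
  have "\<exists>h\<in>S \<inter> L2 M. L2_sq M (\<lambda>x. f x + g x - h x) < e" if e: "e > 0" for e
  proof -
    have e4: "e / 4 > 0" using e by simp
    obtain f' where f': "f' \<in> S" "f' \<in> L2 M" "L2_sq M (\<lambda>x. f x - f' x) < e / 4"
      using f e4 unfolding L2_closure_iff by blast
    obtain g' where g': "g' \<in> S" "g' \<in> L2 M" "L2_sq M (\<lambda>x. g x - g' x) < e / 4"
      using g e4 unfolding L2_closure_iff by blast
    have "(\<lambda>x. f x + g x - (f' x + g' x)) = (\<lambda>x. (f x - f' x) + (g x - g' x))" by (simp add: fun_eq_iff)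
    hence "L2_sq M (\<lambda>x. f x + g x - (f' x + g' x)) < e"
      using L2_sq_add_le[OF L2_diff[OF fg(1) f'(2)] L2_diff[OF fg(2) g'(2)]] f'(3) g'(3) by simp
    thus ?thesis using subspace_funD(2)[OF S f'(1) g'(1)] L2_add[OF f'(2) g'(2)]
      by (intro bexI[of _ "\<lambda>x. f' x + g' x"]) auto
  qed
  thus "(\<lambda>x. f x + g x) \<in> L2_closure M S" using L2_add[OF fg] by (simp add: L2_closure_iff)
next
  fix c f assume f: "f \<in> L2_closure M S"
  have f2: "f \<in> L2 M" using f L2_closure_subset_L2 by blast
  have "\<exists>h\<in>S \<inter> L2 M. L2_sq M (\<lambda>x. c * f x - h x) < e" if e: "e > 0" for e
  proof -
    \<comment> \<open>The added 1 avoids division by zero for c = 0.\<close>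
    have c: "(cmod c)\<^sup>2 + 1 > 0" using zero_le_power2[of "cmod c"] by linarith
    hence "e / ((cmod c)\<^sup>2 + 1) > 0" using e by simp
    then obtain f' where f': "f' \<in> S" "f' \<in> L2 M" "L2_sq M (\<lambda>x. f x - f' x) < e / ((cmod c)\<^sup>2 + 1)"
      using f unfolding L2_closure_iff by blast
    have "(\<lambda>x. c * f x - c * f' x) = (\<lambda>x. c * (f x - f' x))" by (simp add: algebra_simps)
    hence "L2_sq M (\<lambda>x. c * f x - c * f' x) = (cmod c)\<^sup>2 * L2_sq M (\<lambda>x. f x - f' x)"
      by (simp only: L2_sq_scale)
    also have "\<dots> \<le> ((cmod c)\<^sup>2 + 1) * L2_sq M (\<lambda>x. f x - f' x)" by (intro mult_right_mono) auto
    also have "\<dots> < e" using f'(3) c by (simp add: pos_less_divide_eq mult.commute)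
    finally show ?thesis using subspace_funD(3)[OF S f'(1)] L2_scale[OF f'(2)]
      by (intro bexI[of _ "\<lambda>x. c * f' x"]) auto
  qed
  thus "(\<lambda>x. c * f x) \<in> L2_closure M S" using L2_scale[OF f2] by (simp add: L2_closure_iff)
qed

lemma L2_closed_subspace_closure:
  "cfun.subspace S \<Longrightarrow> L2_closed_subspace M (L2_closure M S)"
  by (simp add: L2_closed_subspace_def L2_closure_subset_L2 subspace_L2_closure L2_closure_idem)

lemma L2_sq_eq_0_AE:
  assumes "f \<in> L2 M" "L2_sq M f = 0"
  shows "AE x in M. f x = 0"
  using assms integral_nonneg_eq_0_iff_AE[OF L2D(2)[OF assms(1)]] by (simp add: L2_sq_def)

section \<open>Locally constant functions in $L^2$\<close>

text \<open>The concrete form of V_j. Exact constancy would not survive changes on null sets,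
  whereas closures do, so constancy on each coset is required almost everywhere only.\<close>

definition L2_locconst :: "'p::prime_card padic measure \<Rightarrow> int \<Rightarrow> ('p padic \<Rightarrow> complex) set" where
  "L2_locconst \<mu> j = {f \<in> L2 \<mu>. \<forall>a. \<exists>c. AE x in \<mu>. x \<in> pdisc a j \<longrightarrow> f x = c}"

lemma L2_locconst_subset_L2: "L2_locconst \<mu> j \<subseteq> L2 \<mu>"
  by (auto simp: L2_locconst_def)

lemma L2_locconst_mono:
  assumes "i \<le> j"
  shows "L2_locconst \<mu> i \<subseteq> L2_locconst \<mu> j"
proof
  fix f assume f: "f \<in> L2_locconst \<mu> i"
  have "\<exists>c. AE x in \<mu>. x \<in> pdisc a j \<longrightarrow> f x = c" for a
  proof -
    obtain c where "AE x in \<mu>. x \<in> pdisc a i \<longrightarrow> f x = c" using f unfolding L2_locconst_def by blast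
    hence "AE x in \<mu>. x \<in> pdisc a j \<longrightarrow> f x = c" using pdisc_mono[OF assms, of a] by (auto elim!: eventually_mono)
    thus ?thesis ..
  qed
  thus "f \<in> L2_locconst \<mu> j" using f by (simp add: L2_locconst_def)
qed

lemma subspace_L2_locconst: "cfun.subspace (L2_locconst \<mu> j)"
proof (rule subspace_funI)
  fix f g assume f: "f \<in> L2_locconst \<mu> j" and g: "g \<in> L2_locconst \<mu> j"
  have "\<exists>c. AE x in \<mu>. x \<in> pdisc a j \<longrightarrow> f x + g x = c" for a
  proof -
    obtain c d where "AE x in \<mu>. x \<in> pdisc a j \<longrightarrow> f x = c" "AE x in \<mu>. x \<in> pdisc a j \<longrightarrow> g x = d"
      using f g unfolding L2_locconst_def by blast
    hence "AE x in \<mu>. x \<in> pdisc a j \<longrightarrow> f x + g x = c + d" by eventually_elim auto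
    thus ?thesis ..
  qed
  thus "(\<lambda>x. f x + g x) \<in> L2_locconst \<mu> j" using f g by (simp add: L2_locconst_def L2_add)
next
  fix c f assume f: "f \<in> L2_locconst \<mu> j"
  have "\<exists>d. AE x in \<mu>. x \<in> pdisc a j \<longrightarrow> c * f x = d" for a
  proof -
    obtain d where "AE x in \<mu>. x \<in> pdisc a j \<longrightarrow> f x = d"
      using f unfolding L2_locconst_def by blast
    hence "AE x in \<mu>. x \<in> pdisc a j \<longrightarrow> c * f x = c * d" by eventually_elim auto
    thus ?thesis ..
  qed
  thus "(\<lambda>x. c * f x) \<in> L2_locconst \<mu> j" using f by (simp add: L2_locconst_def L2_scale)
qed (auto simp: L2_locconst_def L2_zero)

context
  fixes \<mu> :: "'p::prime_card padic measure"
  assumes haar: "is_haar \<mu>"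
begin

lemmas haar_simps = sets_haar[OF haar] space_haar[OF haar]

lemma borel_measurable_haar: "borel_measurable \<mu> = borel_measurable borel"
  by (rule measurable_cong_sets) (simp_all add: haar_simps)

lemma indicator_mult_L2:
  assumes "f \<in> L2 \<mu>" "A \<in> sets borel"
  shows "(\<lambda>x. indicator A x * f x) \<in> L2 \<mu>"
proof (rule L2_bound[OF _ assms(1)])
  have "f \<in> borel_measurable borel" using L2D(1)[OF assms(1)] by (simp add: borel_measurable_haar)
  thus "(\<lambda>x. indicator A x * f x) \<in> borel_measurable \<mu>"
    unfolding borel_measurable_haar using assms(2) by (intro borel_measurable_times borel_measurable_indicator)
  show "cmod (indicator A x * f x) \<le> 1 * cmod (f x)" for x by (simp add: indicator_def)
qed

lemma L2_indicator:
  assumes "A \<in> sets borel" "emeasure \<mu> A < \<infinity>"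
  shows "(\<lambda>x. indicator A x) \<in> L2 \<mu>"
proof -
  have "integrable \<mu> (\<lambda>x. indicator A x :: real)"
    using assms by (intro integrable_real_indicator) (simp_all add: haar_simps)
  moreover have "(\<lambda>x. (cmod (indicator A x))\<^sup>2) = (\<lambda>x. indicator A x)" by (auto simp: indicator_def)
  ultimately show ?thesis using assms(1) by (simp add: L2_def borel_measurable_haar)
qed

lemma emeasure_pdisc_finite: "emeasure \<mu> (pdisc a j) < \<infinity>"
  by (simp add: emeasure_pdisc[OF haar])

lemma L2_sq_indicator_pdisc:
  "L2_sq \<mu> (\<lambda>x. c * indicator (pdisc a j) x) = (cmod c)\<^sup>2 * real CARD('p) powi (- j)"
proof -
  have "L2_sq \<mu> (indicator (pdisc a j)) = (LINT x|\<mu>. indicator (pdisc a j) x)"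
    unfolding L2_sq_def by (intro Bochner_Integration.integral_cong refl) (simp add: indicator_def)
  also have "\<dots> = real CARD('p) powi (- j)"
    by (simp add: haar_simps measure_pdisc[OF haar])
  finally show ?thesis by (simp only: L2_sq_scale)
qed

text \<open>A coset has positive measure, so norm convergence of functions constant on it forces
  their constants to form a Cauchy sequence. The limit constant is then the value of f
  there.\<close>

lemma L2_closure_locconst: "L2_closure \<mu> (L2_locconst \<mu> j) = L2_locconst \<mu> j"
proof
  show "L2_locconst \<mu> j \<subseteq> L2_closure \<mu> (L2_locconst \<mu> j)"
    using L2_closure_superset[of "L2_locconst \<mu> j" \<mu>] L2_locconst_subset_L2[of \<mu> j] by blast
  show "L2_closure \<mu> (L2_locconst \<mu> j) \<subseteq> L2_locconst \<mu> j"
  proof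
    fix f assume f: "f \<in> L2_closure \<mu> (L2_locconst \<mu> j)"
    have f2: "f \<in> L2 \<mu>" using f L2_closure_subset_L2 by blast
    have "\<exists>c. AE x in \<mu>. x \<in> pdisc a j \<longrightarrow> f x = c" for a
    proof -
      define B where "B = pdisc a j"
      define r where "r = real CARD('p) powi (- j)"
      have r: "r > 0" by (simp add: r_def zero_less_power_int)
      have "\<exists>g\<in>L2_locconst \<mu> j. L2_sq \<mu> (\<lambda>x. f x - g x) < 1 / real (Suc n)" for n
        using f unfolding L2_closure_iff by (metis IntD1 of_nat_0_less_iff zero_less_Suc zero_less_divide_1_iff)
      then obtain g where g: "\<And>n. g n \<in> L2_locconst \<mu> j" "\<And>n. L2_sq \<mu> (\<lambda>x. f x - g n x) < 1 / real (Suc n)"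
        by metis
      have g2: "g n \<in> L2 \<mu>" for n using g(1) L2_locconst_subset_L2 by blast
      have "\<exists>c. AE x in \<mu>. x \<in> B \<longrightarrow> g n x = c" for n using g(1)[of n] by (auto simp: L2_locconst_def B_def)
      then obtain c where c: "\<And>n. AE x in \<mu>. x \<in> B \<longrightarrow> g n x = c n" by metis
      have B2: "(\<lambda>x. indicator B x * h x) \<in> L2 \<mu>" if "h \<in> L2 \<mu>" for h
        unfolding B_def by (rule indicator_mult_L2[OF that]) simp
      have le: "L2_sq \<mu> (\<lambda>x. indicator B x * h x) \<le> L2_sq \<mu> h" if "h \<in> L2 \<mu>" for h
        unfolding L2_sq_def by (intro integral_mono L2D(2) B2 that) (auto simp: indicator_def)
      have const2: "(\<lambda>x. d * indicator B x) \<in> L2 \<mu>" for d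
        unfolding B_def by (intro L2_scale L2_indicator emeasure_pdisc_finite) simp
      \<comment> \<open>On B the approximant g n is the constant c n almost everywhere, so
        restriction to B compares f with constants.\<close>
      have gc: "L2_sq \<mu> (\<lambda>x. indicator B x * f x - c n * indicator B x) < 1 / real (Suc n)" for n
      proof -
        have "L2_sq \<mu> (\<lambda>x. indicator B x * f x - c n * indicator B x) = L2_sq \<mu> (\<lambda>x. indicator B x * (f x - g n x))"
        proof (rule L2_sq_cong_AE)
          show "AE x in \<mu>. indicator B x * f x - c n * indicator B x = indicator B x * (f x - g n x)"
            using c[of n] by eventually_elim (auto simp: indicator_def)
        qed (intro L2D(1) L2_diff B2 const2 f2 g2)+
        also have "\<dots> \<le> L2_sq \<mu> (\<lambda>x. f x - g n x)" by (intro le L2_diff f2 g2)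
        finally show ?thesis using g(2)[of n] by linarith
      qed
      have cd: "(cmod (c n - c m))\<^sup>2 * r \<le> 2 / real (Suc n) + 2 / real (Suc m)" for n m
      proof -
        have "(cmod (c n - c m))\<^sup>2 * r = L2_sq \<mu> (\<lambda>x. (c n - c m) * indicator B x)"
          unfolding B_def r_def by (rule L2_sq_indicator_pdisc[symmetric])
        also have "\<dots> = L2_sq \<mu> (\<lambda>x. c n * indicator B x - c m * indicator B x)" by (simp add: left_diff_distrib)
        also have "\<dots> \<le> 2 * L2_sq \<mu> (\<lambda>x. c n * indicator B x - indicator B x * f x)
            + 2 * L2_sq \<mu> (\<lambda>x. indicator B x * f x - c m * indicator B x)"
          by (intro L2_sq_triangle const2 B2 f2)
        finally show ?thesis using gc[of n] gc[of m] L2_sq_commute[of \<mu> "\<lambda>x. c n * indicator B x"] by fastforce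
      qed
      have "Cauchy c"
      proof (rule metric_CauchyI)
        fix e :: real assume e: "e > 0"
        \<comment> \<open>Beyond M both error terms in \<open>cd\<close> sum to at most 4/(M+1),
          which is below e^2 * r.\<close>
        define M where "M = nat \<lceil>4 / (e\<^sup>2 * r)\<rceil>"
        have er: "e\<^sup>2 * r > 0" using e r by simp
        have M: "4 / real (Suc M) < e\<^sup>2 * r"
        proof -
          have "4 / (e\<^sup>2 * r) < real (Suc M)" unfolding M_def by linarith
          thus ?thesis using er by (simp add: field_simps del: of_nat_Suc)
        qed
        show "\<exists>M. \<forall>m\<ge>M. \<forall>n\<ge>M. dist (c m) (c n) < e"
        proof (intro exI[of _ M] allI impI)
          fix m n assume mn: "M \<le> m" "M \<le> n"
          have "2 / real (Suc m) \<le> 2 / real (Suc M)" "2 / real (Suc n) \<le> 2 / real (Suc M)"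
            using mn by (auto intro!: divide_left_mono)
          hence "(cmod (c m - c n))\<^sup>2 * r < e\<^sup>2 * r" using cd[of m n] M by linarith
          hence "(cmod (c m - c n))\<^sup>2 < e\<^sup>2" using r by simp
          thus "dist (c m) (c n) < e" using e by (simp add: dist_norm power2_less_imp_less)
        qed
      qed
      then obtain d where d: "c \<longlonglongrightarrow> d" using Cauchy_convergent by (auto simp: convergent_def)
      have "L2_sq \<mu> (\<lambda>x. indicator B x * f x - d * indicator B x) \<le> 0"
      proof (rule LIMSEQ_le_const)
        have "(\<lambda>n. 2 * (1 / real (Suc n)) + 2 * ((cmod (c n - d))\<^sup>2 * r)) \<longlonglongrightarrow> 2 * 0 + 2 * ((cmod (d - d))\<^sup>2 * r)"
          using LIMSEQ_inverse_real_of_nat unfolding inverse_eq_divide by (intro tendsto_intros d) 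
        thus "(\<lambda>n. 2 * (1 / real (Suc n)) + 2 * ((cmod (c n - d))\<^sup>2 * r)) \<longlonglongrightarrow> 0" by simp
        have "L2_sq \<mu> (\<lambda>x. indicator B x * f x - d * indicator B x) \<le> 2 * (1 / real (Suc n)) + 2 * ((cmod (c n - d))\<^sup>2 * r)" for n
        proof -
          have "L2_sq \<mu> (\<lambda>x. indicator B x * f x - d * indicator B x) \<le>
            2 * L2_sq \<mu> (\<lambda>x. indicator B x * f x - c n * indicator B x) + 2 * L2_sq \<mu> (\<lambda>x. c n * indicator B x - d * indicator B x)"
            by (intro L2_sq_triangle const2 B2 f2)
          also have "L2_sq \<mu> (\<lambda>x. c n * indicator B x - d * indicator B x) = (cmod (c n - d))\<^sup>2 * r"
            using L2_sq_indicator_pdisc[of "c n - d" a j] by (simp add: left_diff_distrib B_def r_def)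
          finally show ?thesis using gc[of n] by linarith
        qed
        thus "\<exists>N. \<forall>n\<ge>N. L2_sq \<mu> (\<lambda>x. indicator B x * f x - d * indicator B x) \<le> 2 * (1 / real (Suc n)) + 2 * ((cmod (c n - d))\<^sup>2 * r)"
          by blast
      qed
      hence "L2_sq \<mu> (\<lambda>x. indicator B x * f x - d * indicator B x) = 0"
        using L2_sq_nonneg by (rule antisym)
      hence "AE x in \<mu>. indicator B x * f x - d * indicator B x = 0"
        by (intro L2_sq_eq_0_AE L2_diff B2 const2 f2)
      hence "AE x in \<mu>. x \<in> B \<longrightarrow> f x = d" by eventually_elim (auto simp: indicator_def)
      thus ?thesis unfolding B_def ..
    qed
    thus "f \<in> L2_locconst \<mu> j" using f2 by (simp add: L2_locconst_def)
  qed
qed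

section \<open>Affine changes of variable\<close>

text \<open>Translation preserves \<mu>, and dilation pushes it to a multiple of itself, for which
  null sets of \<mu> remain null.\<close>

lemma AE_haar_affine:
  assumes "AE x in \<mu>. P x"
  shows "AE x in \<mu>. P (unif powi i * x + b)"
proof -
  have "AE x in distr \<mu> borel (\<lambda>x. x + b). P x" unfolding distr_haar_translate[OF haar] by (rule assms)
  from AE_distrD[OF measurable_haar_translate[OF haar] this]
  obtain Z where Z: "Z \<in> null_sets \<mu>" "{x \<in> space \<mu>. \<not> P (x + b)} \<subseteq> Z" by (auto simp: eventually_ae_filter)
  hence "Z \<in> null_sets (scale_measure (ennreal (real CARD('p) powi i)) \<mu>)" by (auto simp: null_sets_def)
  hence "AE x in distr \<mu> borel (\<lambda>x. unif powi i * x). P (x + b)"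
    using Z(2) unfolding distr_haar_dilate[OF haar] by (intro AE_I'[of Z]) (auto simp: space_scale_measure)
  from AE_distrD[OF measurable_haar_dilate[OF haar] this] show ?thesis .
qed

lemma integrable_haar_affine:
  fixes f :: "'p padic \<Rightarrow> real"
  assumes "integrable \<mu> f"
  shows "integrable \<mu> (\<lambda>x. f (unif powi i * x + b))"
proof -
  have "integrable (distr \<mu> borel (\<lambda>x. x + b)) f" using assms by (simp add: distr_haar_translate[OF haar])
  from integrable_distr[OF measurable_haar_translate[OF haar] this] have fb: "integrable \<mu> (\<lambda>x. f (x + b))" .
  have "integrable (scale_measure (ennreal (real CARD('p) powi i)) \<mu>) (\<lambda>x. f (x + b))"
  proof (rule integrableI_bounded)
    show "(\<lambda>x. f (x + b)) \<in> borel_measurable (scale_measure (ennreal (real CARD('p) powi i)) \<mu>)"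
      unfolding measurable_cong_sets[OF sets_scale_measure refl] by (rule borel_measurable_integrable[OF fb])
    have "(\<integral>\<^sup>+x. ennreal (norm (f (x + b))) \<partial>\<mu>) < \<infinity>" using fb by (simp add: integrable_iff_bounded)
    moreover have "(\<lambda>x. ennreal (norm (f (x + b)))) \<in> borel_measurable \<mu>" using borel_measurable_integrable[OF fb] by simp
    ultimately show "(\<integral>\<^sup>+x. ennreal (norm (f (x + b))) \<partial>scale_measure (ennreal (real CARD('p) powi i)) \<mu>) < \<infinity>"
      by (simp add: nn_integral_scale_measure ennreal_mult_less_top)
  qed
  hence "integrable (distr \<mu> borel (\<lambda>x. unif powi i * x)) (\<lambda>x. f (x + b))" by (simp add: distr_haar_dilate[OF haar])
  from integrable_distr[OF measurable_haar_dilate[OF haar] this] show ?thesis .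
qed

lemma L2_affine:
  assumes "f \<in> L2 \<mu>"
  shows "(\<lambda>x. f (unif powi i * x + b)) \<in> L2 \<mu>"
proof -
  have f: "f \<in> borel_measurable borel" using L2D(1)[OF assms] by (simp add: borel_measurable_haar)
  have "(\<lambda>x. f (unif powi i * x + b)) \<in> borel_measurable borel"
    using measurable_compose[OF measurable_padic_affine f] .
  thus ?thesis using integrable_haar_affine[OF L2D(2)[OF assms]] by (simp add: L2_def borel_measurable_haar)
qed

lemma L2_locconst_dilate:
  assumes f: "f \<in> L2_locconst \<mu> j"
  shows "(\<lambda>x. f (unif powi i * x)) \<in> L2_locconst \<mu> (j - i)"
proof -
  have "\<exists>c. AE x in \<mu>. x \<in> pdisc a (j - i) \<longrightarrow> f (unif powi i * x) = c" for a
  proof -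
    obtain c where c: "AE x in \<mu>. x \<in> pdisc (unif powi i * a) j \<longrightarrow> f x = c" using f unfolding L2_locconst_def by blast
    have "unif powi i * x \<in> pdisc (unif powi i * a) j \<longleftrightarrow> x \<in> pdisc a (j - i)" for x
      by (simp add: powi_mult_mem_pdisc_iff flip: mult.assoc power_int_add)
    thus ?thesis using AE_haar_affine[OF c, of i 0] by auto
  qed
  thus ?thesis using f L2_affine[of f i 0] by (simp add: L2_locconst_def)
qed

lemma L2_locconst_dilate_iff:
  "f \<in> L2_locconst \<mu> j \<longleftrightarrow> (\<lambda>x. f (inverse (of_nat CARD('p)) * x)) \<in> L2_locconst \<mu> (j + 1)"
proof
  assume "f \<in> L2_locconst \<mu> j"
  from L2_locconst_dilate[OF this, of "- 1"] show "(\<lambda>x. f (inverse (of_nat CARD('p)) * x)) \<in> L2_locconst \<mu> (j + 1)"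
    by (simp add: power_int_minus)
next
  assume "(\<lambda>x. f (inverse (of_nat CARD('p)) * x)) \<in> L2_locconst \<mu> (j + 1)"
  from L2_locconst_dilate[OF this, of 1] show "f \<in> L2_locconst \<mu> j"
    by (simp flip: mult.assoc)
qed

section \<open>Trivial intersection and dense union\<close>

text \<open>Such an f is almost everywhere constant on each p^(-n)Z_p. These balls have measure p^n,
  so a nonzero constant is incompatible with a finite norm.\<close>

lemma Inter_L2_locconst: "(\<Inter>j. L2_locconst \<mu> j) = {f \<in> L2 \<mu>. AE x in \<mu>. f x = 0}"
proof (intro equalityI subsetI)
  fix f assume f: "f \<in> {f \<in> L2 \<mu>. AE x in \<mu>. f x = 0}"
  have "AE x in \<mu>. x \<in> pdisc a j \<longrightarrow> f x = 0" for a j using f by auto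
  thus "f \<in> (\<Inter>j. L2_locconst \<mu> j)" using f unfolding L2_locconst_def by blast
next
  fix f assume f: "f \<in> (\<Inter>j. L2_locconst \<mu> j)"
  hence f2: "f \<in> L2 \<mu>" using L2_locconst_subset_L2 by blast
  have "\<exists>c. AE x in \<mu>. x \<in> pball (- int n) \<longrightarrow> f x = c" for n
    using f unfolding L2_locconst_def pdisc_0[symmetric] by blast
  then obtain c where c: "\<And>n. AE x in \<mu>. x \<in> pball (- int n) \<longrightarrow> f x = c n" by metis
  have bound: "(cmod (c n))\<^sup>2 * real CARD('p) ^ n \<le> L2_sq \<mu> f" for n
  proof -
    have pb: "(\<lambda>x. indicator (pball (- int n)) x * f x) \<in> L2 \<mu>" by (rule indicator_mult_L2[OF f2]) simp
    have "(cmod (c n))\<^sup>2 * real CARD('p) ^ n = L2_sq \<mu> (\<lambda>x. c n * indicator (pball (- int n)) x)"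
      using L2_sq_indicator_pdisc[of "c n" 0 "- int n"] by (simp add: pdisc_0)
    also have "\<dots> = L2_sq \<mu> (\<lambda>x. indicator (pball (- int n)) x * f x)"
    proof (rule L2_sq_cong_AE)
      show "AE x in \<mu>. c n * indicator (pball (- int n)) x = indicator (pball (- int n)) x * f x"
        using c[of n] by eventually_elim (auto simp: indicator_def)
    qed (use L2D(1)[OF pb] in \<open>auto simp: borel_measurable_haar\<close>)
    also have "\<dots> \<le> L2_sq \<mu> f"
      unfolding L2_sq_def by (intro integral_mono L2D(2) f2 pb) (auto simp: indicator_def)
    finally show ?thesis .
  qed
  \<comment> \<open>All these constants describe f on Z_p, which has positive measure.\<close>
  have cn: "c n = c 0" for n
  proof (rule ccontr)
    assume ne: "c n \<noteq> c 0"
    have "AE x in \<mu>. x \<notin> pball 0" using c[of n] c[of 0]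
    proof eventually_elim
      case (elim x)
      thus ?case using ne pball_monoD[of x 0 "- int n"] by auto
    qed
    hence "emeasure \<mu> (pball 0) = 0"
      by (subst (asm) AE_iff_measurable[OF _ refl]) (simp_all add: haar_simps)
    thus False by (simp add: emeasure_pball[OF haar])
  qed
  have "c 0 = 0"
  proof (rule ccontr)
    assume "c 0 \<noteq> 0"
    hence pos: "(cmod (c 0))\<^sup>2 > 0" by simp
    obtain n where "L2_sq \<mu> f / (cmod (c 0))\<^sup>2 < real CARD('p) ^ n"
      using real_arch_pow[OF CARD_real_gt_1] by blast
    thus False using bound[of n] pos unfolding cn[of n] by (simp add: field_simps)
  qed
  hence "c n = 0" for n using cn[of n] by simp
  hence "AE x in \<mu>. x \<in> pball (- int n) \<longrightarrow> f x = 0" for n using c[of n] by simp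
  hence "AE x in \<mu>. \<forall>n. x \<in> pball (- int n) \<longrightarrow> f x = 0" unfolding AE_all_countable ..
  hence "AE x in \<mu>. f x = 0"
  proof eventually_elim
    case (elim x)
    thus ?case using pball_exhaust[of x] by blast
  qed
  thus "f \<in> {f \<in> L2 \<mu>. AE x in \<mu>. f x = 0}" using f2 by simp
qed

lemma indicator_pdisc_locconst: "indicator (pdisc a j) \<in> L2_locconst \<mu> j"
proof -
  have "\<exists>c. AE x in \<mu>. x \<in> pdisc b j \<longrightarrow> indicator (pdisc a j) x = (c :: complex)" for b
  proof -
    have "indicator (pdisc a j) x = (indicator (pdisc a j) b :: complex)" if "x \<in> pdisc b j" for x
      using pball_add_iff[of "x - b" j "b - a"] that by (simp add: indicator_def mem_pdisc_iff)
    thus ?thesis by auto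
  qed
  moreover have "indicator (pdisc a j) \<in> L2 \<mu>" by (rule L2_indicator[OF pdisc_borel emeasure_pdisc_finite])
  ultimately show ?thesis by (simp add: L2_locconst_def)
qed

lemma subspace_Union_locconst: "cfun.subspace (\<Union>j. L2_locconst \<mu> j)"
proof (rule subspace_funI)
  show "(\<lambda>x. 0) \<in> (\<Union>j. L2_locconst \<mu> j)" using subspace_funD(1)[OF subspace_L2_locconst] by blast
next
  fix f g assume "f \<in> (\<Union>j. L2_locconst \<mu> j)" "g \<in> (\<Union>j. L2_locconst \<mu> j)"
  then obtain i j where "f \<in> L2_locconst \<mu> i" "g \<in> L2_locconst \<mu> j" by blast
  hence "f \<in> L2_locconst \<mu> (max i j)" "g \<in> L2_locconst \<mu> (max i j)"
    using L2_locconst_mono[of i "max i j" \<mu>] L2_locconst_mono[of j "max i j" \<mu>] by auto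
  from subspace_funD(2)[OF subspace_L2_locconst this] show "(\<lambda>x. f x + g x) \<in> (\<Union>j. L2_locconst \<mu> j)" by blast
next
  fix c f assume "f \<in> (\<Union>j. L2_locconst \<mu> j)"
  thus "(\<lambda>x. c * f x) \<in> (\<Union>j. L2_locconst \<mu> j)" using subspace_funD(3)[OF subspace_L2_locconst] by blast
qed

text \<open>Induction over the sigma-algebra generated by the discs. The fixed ball keeps every
  indicator square integrable, which complements and countable unions would otherwise
  destroy.\<close>

lemma indicator_dense:
  assumes A: "A \<in> sets borel"
  shows "indicator (A \<inter> pball (- int n)) \<in> L2_closure \<mu> (\<Union>j. L2_locconst \<mu> j)"
proof -
  define D where "D = L2_closure \<mu> (\<Union>j. L2_locconst \<mu> j)"
  define B where "B = (pball (- int n) :: 'p padic set)"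
  have D: "cfun.subspace D" unfolding D_def by (rule subspace_L2_closure[OF subspace_Union_locconst])
  have disc: "indicator (pdisc a j) \<in> D" for a j
    unfolding D_def using indicator_pdisc_locconst[of a j] L2_locconst_subset_L2[of \<mu> j] by (intro L2_closure_base) auto
  have zero: "(\<lambda>x. 0) \<in> D" by (rule subspace_funD(1)[OF D])
  have B: "B \<in> pdiscs" using pdisc_in_pdiscs[of 0 "- int n"] by (simp add: B_def pdisc_0)
  have Bb: "B \<in> sets borel" by (simp add: B_def)
  have Bfin: "emeasure \<mu> (X \<inter> B) < \<infinity>" if "X \<in> sets borel" for X
  proof -
    have "emeasure \<mu> (X \<inter> B) \<le> emeasure \<mu> B" using Bb by (intro emeasure_mono) (auto simp: haar_simps)
    also have "\<dots> < \<infinity>" by (simp add: B_def emeasure_pball[OF haar])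
    finally show ?thesis .
  qed
  have sub: "sigma_sets UNIV pdiscs = sets (borel :: 'p padic measure)" by (simp add: sets_borel_padic)
  have "A \<in> sigma_sets UNIV pdiscs" using A by (simp add: sub)
  have "pdiscs \<subseteq> Pow (UNIV :: 'p padic set)" by simp
  from Int_stable_pdiscs this \<open>A \<in> sigma_sets UNIV pdiscs\<close> have "indicator (A \<inter> B) \<in> D"
  proof (induction rule: sigma_sets_induct_disjoint)
    case (basic X)
    hence "X \<inter> B \<in> pdiscs" using B Int_stable_pdiscs unfolding Int_stable_def by blast
    thus ?case using disc zero by (auto simp: pdiscs_def)
  next
    case empty
    thus ?case using zero by simp
  next
    case (compl X)
    have "indicator B \<in> D" using disc[of 0 "- int n"] by (simp add: B_def pdisc_0)
    from subspace_funD(4)[OF D this compl.IH]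
    have "(\<lambda>x. indicator B x - indicator (X \<inter> B) x) \<in> D" .
    also have "(\<lambda>x. indicator B x - indicator (X \<inter> B) x) = (indicator ((UNIV - X) \<inter> B) :: _ \<Rightarrow> complex)"
      by (auto simp: indicator_def fun_eq_iff)
    finally show ?case .
  next
    case (union X)
    have Xb: "X i \<in> sets borel" for i using union.hyps by (auto simp: sub)
    have part: "indicator ((\<Union>i<k. X i) \<inter> B) \<in> D" for k
    proof (induction k)
      case (Suc k)
      have "X k \<inter> X i = {}" if "i < k" for i
        using disjoint_family_onD[OF union.hyps(1), of k i] that by simp
      hence "X k \<inter> (\<Union>i<k. X i) = {}" by blast
      hence "(\<lambda>x. indicator ((\<Union>i<k. X i) \<inter> B) x + indicator (X k \<inter> B) x) = (indicator ((\<Union>i<Suc k. X i) \<inter> B) :: _ \<Rightarrow> complex)"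
        by (auto simp: indicator_def fun_eq_iff lessThan_Suc)
      thus ?case using subspace_funD(2)[OF D Suc union.IH[of k]] by simp
    qed (use zero in simp)
    have "(\<Union>i. X i) \<in> sets borel" using Xb by auto
    show ?case unfolding D_def
    proof (rule L2_closure_dominated[where C = 1])
      show "indicator (\<Union> (range X) \<inter> B) \<in> L2 \<mu>"
        using Xb Bb by (intro L2_indicator Bfin) auto
      show "indicator ((\<Union>i<k. X i) \<inter> B) \<in> L2_closure \<mu> (\<Union>j. L2_locconst \<mu> j)" for k
        using part[of k] by (simp add: D_def)
      fix x
      have "(\<lambda>k. indicator (\<Union>i<k. X i \<inter> B) x :: complex) \<longlonglongrightarrow> indicator (\<Union>i. X i \<inter> B) x"
        by (rule LIMSEQ_indicator_UN)
      thus "(\<lambda>k. indicator ((\<Union>i<k. X i) \<inter> B) x :: complex) \<longlonglongrightarrow> indicator (\<Union> (range X) \<inter> B) x"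
        by simp
      show "cmod (indicator ((\<Union>i<k. X i) \<inter> B) x) \<le> 1 * cmod (indicator (\<Union> (range X) \<inter> B) x)" for k
        by (auto simp: indicator_def)
    qed
  qed
  thus ?thesis by (simp add: D_def B_def)
qed

text \<open>Simple functions bounded by 2|f| converge pointwise to f. Cut off to growing balls, they
  become finite combinations of the indicators from \<open>indicator_dense\<close> and still
  converge.\<close>

lemma Union_L2_locconst_dense: "L2_closure \<mu> (\<Union>j. L2_locconst \<mu> j) = L2 \<mu>"
proof
  show "L2 \<mu> \<subseteq> L2_closure \<mu> (\<Union>j. L2_locconst \<mu> j)"
  proof
    fix f assume f: "f \<in> L2 \<mu>"
    obtain F where F: "\<And>i. simple_function \<mu> (F i)" "\<And>x. x \<in> space \<mu> \<Longrightarrow> (\<lambda>i. F i x) \<longlonglongrightarrow> f x"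
      "\<And>i x. x \<in> space \<mu> \<Longrightarrow> dist (F i x) 0 \<le> 2 * dist (f x) 0"
      using borel_measurable_implies_sequence_metric[OF L2D(1)[OF f], of 0] by blast
    show "f \<in> L2_closure \<mu> (\<Union>j. L2_locconst \<mu> j)"
    proof (rule L2_closure_dominated[OF f, where C = 2 and h = "\<lambda>i x. F i x * indicator (pball (- int i)) x"])
      fix i
      have fin: "finite (range (F i))" using F(1)[of i] by (simp add: simple_function_def haar_simps)
      have "F i -` {y} \<in> sets borel" for y
        using simple_functionD(2)[OF F(1)[of i], of "{y}"] by (simp add: haar_simps)
      hence "(\<lambda>x. \<Sum>y\<in>range (F i). y * indicator (F i -` {y} \<inter> pball (- int i)) x) \<in> L2_closure \<mu> (\<Union>j. L2_locconst \<mu> j)"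
        by (intro subspace_fun_sum subspace_L2_closure subspace_Union_locconst indicator_dense)
      also have "(\<lambda>x. \<Sum>y\<in>range (F i). y * indicator (F i -` {y} \<inter> pball (- int i)) x) = (\<lambda>x. F i x * indicator (pball (- int i)) x)"
      proof
        fix x
        have "(\<Sum>y\<in>range (F i). y * indicator (F i -` {y} \<inter> pball (- int i)) x)
          = (\<Sum>y\<in>range (F i). if y = F i x then F i x * indicator (pball (- int i)) x else 0)"
          by (intro sum.cong refl) (auto simp: indicator_def)
        thus "(\<Sum>y\<in>range (F i). y * indicator (F i -` {y} \<inter> pball (- int i)) x) = F i x * indicator (pball (- int i)) x"
          using fin by simp
      qed
      finally show "(\<lambda>x. F i x * indicator (pball (- int i)) x) \<in> L2_closure \<mu> (\<Union>j. L2_locconst \<mu> j)" .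
    next
      fix x :: "'p padic"
      obtain n where n: "x \<in> pball (- int n)" using pball_exhaust by blast
      have "\<forall>\<^sub>F i in sequentially. F i x * indicator (pball (- int i)) x = F i x"
        unfolding eventually_sequentially
        by (intro exI[of _ n]) (auto simp: indicator_def intro: pball_monoD[OF n])
      moreover have "(\<lambda>i. F i x) \<longlonglongrightarrow> f x" using F(2) by (simp add: haar_simps)
      ultimately show "(\<lambda>i. F i x * indicator (pball (- int i)) x) \<longlonglongrightarrow> f x"
        by (subst tendsto_cong)
      show "cmod (F i x * indicator (pball (- int i)) x) \<le> 2 * cmod (f x)" for i
        using F(3)[of x i] norm_ge_zero[of "f x"] by (auto simp: haar_simps indicator_def)
    qed
  qed
qed (rule L2_closure_subset_L2)

end

section \<open>Injectivity of the L2 Fourier transform\<close>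

lemma padic_step_L2:
  fixes \<mu> :: "'p::prime_card padic measure"
  assumes haar: "is_haar \<mu>" and f: "padic_step n m f"
  shows "f \<in> L2 \<mu>"
proof -
  have "integrable \<mu> (\<lambda>x. (cmod (f x))\<^sup>2)"
    using has_bochner_integral_padic_step[OF haar padic_step_map[OF f, of "\<lambda>z. (cmod z)\<^sup>2"]]
    by (auto intro: has_bochner_integral_integrable dest: has_bochner_integral_iff[THEN iffD1])
  thus ?thesis using padic_step_borel[OF f] by (simp add: L2_def borel_measurable_haar[OF haar])
qed

lemma padic_step_char_integrable:
  fixes \<mu> :: "'p::prime_card padic measure"
  assumes haar: "is_haar \<mu>" and f: "padic_step n m f"
  shows "integrable \<mu> (\<lambda>x. padic_char (\<xi> * x) * f x)"
proof -
  obtain M where M: "\<xi> \<in> pball (- int M)" using pball_exhaust by blast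
  have "padic_step n (max m M) (\<lambda>x. padic_char (\<xi> * x) * f x)"
    by (rule padic_step_char_mult[OF padic_step_mono[OF f] pball_monoD[OF M]]) auto
  from has_bochner_integral_padic_step[OF haar this] show ?thesis by (simp add: has_bochner_integral_iff)
qed

text \<open>The differences h k - f0 are step functions, so Plancherel makes their norm equal to the
  distance of the transform of h k from g. Hence the sequence h converges both to f and to
  f0.\<close>

lemma fourier_L2_unique:
  fixes \<mu> :: "'p::prime_card padic measure"
  assumes haar: "is_haar \<mu>" and f: "is_fourier_L2 \<mu> f g"
    and f0: "padic_step n m f0" and g: "padic_fourier \<mu> f0 = g"
  shows "AE x in \<mu>. f x = f0 x"
proof -
  obtain h where f2: "f \<in> L2 \<mu>" and h: "\<And>k::nat. padic_test_function (h k)"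
    and hf: "(\<lambda>k. L2_norm \<mu> (h k - f)) \<longlonglongrightarrow> 0"
    and hg: "(\<lambda>k. L2_norm \<mu> (padic_fourier \<mu> (h k) - g)) \<longlonglongrightarrow> 0"
    using f unfolding is_fourier_L2_def by blast
  have f02: "f0 \<in> L2 \<mu>" by (rule padic_step_L2[OF haar f0])
  have hstep: "\<exists>N. padic_step N N (h k)" for k by (rule padic_test_function_step[OF h])
  have h2: "h k \<in> L2 \<mu>" for k using hstep padic_step_L2[OF haar] by blast
  have iso: "L2_sq \<mu> (\<lambda>x. h k x - f0 x) = (L2_norm \<mu> (padic_fourier \<mu> (h k) - g))\<^sup>2" for k
  proof -
    obtain N where N: "padic_step N N (h k)" using hstep by blast
    define M where "M = max N (max n m)"
    have st: "padic_step M M (h k)" "padic_step M M f0"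
      by (rule padic_step_mono[OF N], simp_all add: M_def, rule padic_step_mono[OF f0], simp_all)
    have "padic_fourier \<mu> (\<lambda>x. h k x - f0 x) = padic_fourier \<mu> (h k) - g"
    proof
      fix \<xi>
      show "padic_fourier \<mu> (\<lambda>x. h k x - f0 x) \<xi> = (padic_fourier \<mu> (h k) - g) \<xi>"
        unfolding g[symmetric] fun_diff_def padic_fourier_def right_diff_distrib
        by (rule Bochner_Integration.integral_diff) (rule padic_step_char_integrable[OF haar st(1)], rule padic_step_char_integrable[OF haar st(2)])
    qed
    thus ?thesis using padic_plancherel_step[OF haar padic_step_diff[OF st]]
      by (simp add: L2_sq_eq[symmetric] L2_sq_def)
  qed
  have "(\<lambda>k. 2 * (L2_norm \<mu> (h k - f))\<^sup>2 + 2 * (L2_norm \<mu> (padic_fourier \<mu> (h k) - g))\<^sup>2) \<longlonglongrightarrow> 2 * 0\<^sup>2 + 2 * 0\<^sup>2"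
    by (intro tendsto_intros hf hg)
  moreover have "L2_sq \<mu> (\<lambda>x. f x - f0 x) \<le> 2 * (L2_norm \<mu> (h k - f))\<^sup>2 + 2 * (L2_norm \<mu> (padic_fourier \<mu> (h k) - g))\<^sup>2" for k
  proof -
    have "L2_sq \<mu> (\<lambda>x. f x - h k x) = (L2_norm \<mu> (h k - f))\<^sup>2"
      unfolding L2_sq_eq[symmetric] fun_diff_def by (rule L2_sq_commute)
    thus ?thesis using L2_sq_triangle[OF f2 h2[of k] f02] iso[of k] by simp
  qed
  ultimately have "L2_sq \<mu> (\<lambda>x. f x - f0 x) \<le> 0" by (intro LIMSEQ_le_const) auto
  hence "L2_sq \<mu> (\<lambda>x. f x - f0 x) = 0" using L2_sq_nonneg by (rule antisym)
  hence "AE x in \<mu>. f x - f0 x = 0" by (intro L2_sq_eq_0_AE L2_diff f2 f02)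
  thus ?thesis by simp
qed

section \<open>The spaces $V_j$\<close>

context
  fixes \<mu> :: "'p::prime_card padic measure" and \<phi> \<phi>0 :: "'p padic \<Rightarrow> complex" and N :: nat and K :: complex
  assumes haar: "is_haar \<mu>" and \<phi>: "\<phi> \<in> L2 \<mu>" and \<phi>0: "padic_step N 0 \<phi>0" and ae: "AE x in \<mu>. \<phi> x = \<phi>0 x"
    and K: "K \<noteq> 0"
    and corr: "\<And>d. (\<Sum>k<CARD('p) ^ N. \<phi>0 (of_nat k / unif ^ N) * cnj (\<phi>0 (of_nat k / unif ^ N + d)))
      = (if d \<in> pball 0 then K else 0)"
begin

lemma generator_affine: "unif powi i * x - a = unif powi i * x + (- a :: 'p padic)"
  by simp

lemma generator_L2: "(\<lambda>x. \<phi> (unif powi i * x - a)) \<in> L2 \<mu>"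
  unfolding generator_affine by (rule L2_affine[OF haar \<phi>])

lemma generator_AE: "AE x in \<mu>. \<phi> (unif powi i * x - a) = \<phi>0 (unif powi i * x - a)"
  unfolding generator_affine by (rule AE_haar_affine[OF haar ae])

text \<open>Z_p-periodicity of \<phi>0 makes each generator constant on cosets of p^j Z_p, almost
  everywhere, and the target is a closed subspace.\<close>

lemma MRA_spaces_subset_locconst: "MRA_spaces \<mu> \<phi> j \<subseteq> L2_locconst \<mu> j"
proof -
  have "(\<lambda>x. \<phi> (unif powi (- j) * x - a)) \<in> L2_locconst \<mu> j" for a
  proof -
    have "\<exists>c. AE x in \<mu>. x \<in> pdisc b j \<longrightarrow> \<phi> (unif powi (- j) * x - a) = c" for b
    proof -
      have "\<phi>0 (unif powi (- j) * x - a) = \<phi>0 (unif powi (- j) * b - a)" if "x \<in> pdisc b j" for x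
      proof (rule padic_step_cong[OF \<phi>0])
        have "unif powi (- j) * (x - b) \<in> pball 0" using that by (subst pball_powi_mult_iff) (simp add: mem_pdisc_iff)
        thus "unif powi (- j) * x - a - (unif powi (- j) * b - a) \<in> pball (int 0)" by (simp add: algebra_simps)
      qed
      hence "AE x in \<mu>. x \<in> pdisc b j \<longrightarrow> \<phi> (unif powi (- j) * x - a) = \<phi>0 (unif powi (- j) * b - a)"
        using generator_AE[of "- j" a] by (auto elim!: eventually_mono)
      thus ?thesis ..
    qed
    thus ?thesis using generator_L2 by (simp add: L2_locconst_def)
  qed
  hence "cfun.span ((\<lambda>a x. \<phi> (of_nat CARD('p) powi (- j) * x - a)) ` padic_shifts) \<subseteq> L2_locconst \<mu> j"
    by (intro cfun.span_minimal subspace_L2_locconst) auto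
  from L2_closure_mono[OF this, of \<mu>] show ?thesis
    unfolding MRA_spaces_def L2_closure_locconst[OF haar] .
qed

text \<open>The space W acquires in turn all translates of the dilated \<phi>0, the indicators of
  all cosets of p^j Z_p, the truncations of f and finally f.\<close>

lemma L2_locconst_subset_MRA_spaces: "L2_locconst \<mu> j \<subseteq> MRA_spaces \<mu> \<phi> j"
proof
  define S where "S = cfun.span ((\<lambda>a x. \<phi> (of_nat CARD('p) powi (- j) * x - a)) ` (padic_shifts :: 'p padic set))"
  define W where "W = L2_closure \<mu> S"
  have W: "cfun.subspace W" unfolding W_def S_def by (intro subspace_L2_closure cfun.subspace_span)
  \<comment> \<open>An arbitrary translation b is replaced by the shift congruent to it modulo Z_p,
    which periodicity of \<phi>0 does not notice.\<close>
  have gen: "(\<lambda>x. \<phi>0 (unif powi (- j) * x - b)) \<in> W" for b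
  proof -
    obtain a where a: "a \<in> padic_shifts" "b - a \<in> pball 0" using padic_shift_exists[of b] by blast
    have eq: "\<phi>0 (unif powi (- j) * x - b) = \<phi>0 (unif powi (- j) * x - a)" for x
      by (rule padic_step_cong[OF \<phi>0]) (use a(2) in \<open>simp add: pball_diff_commute[of a b]\<close>)
    have "(\<lambda>x. \<phi> (unif powi (- j) * x - a)) \<in> S" unfolding S_def by (rule cfun.span_base) (use a(1) in auto)
    hence "(\<lambda>x. \<phi> (unif powi (- j) * x - a)) \<in> W" unfolding W_def by (rule L2_closure_base[OF _ generator_L2])
    moreover have "(\<lambda>x. \<phi>0 (unif powi (- j) * x - a)) \<in> borel_measurable \<mu>"
      unfolding borel_measurable_haar[OF haar] generator_affine
      by (rule measurable_compose[OF measurable_padic_affine padic_step_borel[OF \<phi>0]])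
    ultimately show ?thesis unfolding eq W_def using generator_AE[of "- j" a] by (rule L2_closure_cong_AE)
  qed
  have ind: "indicator (pdisc b j) \<in> W" for b
  proof -
    \<comment> \<open>The coefficients are read off from the conjugate of \<open>corr\<close> at d =
      p^(-j) * (x - b), which lies in Z_p exactly for x in the disc.\<close>
    have "(\<lambda>x. \<Sum>k<CARD('p) ^ N. (cnj (\<phi>0 (of_nat k / unif ^ N)) / cnj K) *
        \<phi>0 (unif powi (- j) * x - (unif powi (- j) * b - of_nat k / unif ^ N))) \<in> W"
      by (intro subspace_fun_sum W gen)
    also have "(\<lambda>x. \<Sum>k<CARD('p) ^ N. (cnj (\<phi>0 (of_nat k / unif ^ N)) / cnj K) *
        \<phi>0 (unif powi (- j) * x - (unif powi (- j) * b - of_nat k / unif ^ N))) = indicator (pdisc b j)"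
    proof
      fix x
      have "(\<Sum>k<CARD('p) ^ N. (cnj (\<phi>0 (of_nat k / unif ^ N)) / cnj K) *
        \<phi>0 (unif powi (- j) * x - (unif powi (- j) * b - of_nat k / unif ^ N)))
        = (\<Sum>k<CARD('p) ^ N. cnj (\<phi>0 (of_nat k / unif ^ N) * cnj (\<phi>0 (of_nat k / unif ^ N + unif powi (- j) * (x - b)))) / cnj K)"
        by (intro sum.cong refl) (simp add: algebra_simps)
      also have "\<dots> = cnj (if unif powi (- j) * (x - b) \<in> pball 0 then K else 0) / cnj K"
        by (simp only: corr[symmetric] cnj_sum sum_divide_distrib)
      also have "\<dots> = indicator (pdisc b j) x"
        using K by (simp add: pball_powi_mult_iff mem_pdisc_iff indicator_def)
      finally show "(\<Sum>k<CARD('p) ^ N. (cnj (\<phi>0 (of_nat k / unif ^ N)) / cnj K) *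
        \<phi>0 (unif powi (- j) * x - (unif powi (- j) * b - of_nat k / unif ^ N))) = indicator (pdisc b j) x" .
    qed
    finally show ?thesis .
  qed
  fix f assume f: "f \<in> L2_locconst \<mu> j"
  have f2: "f \<in> L2 \<mu>" using f L2_locconst_subset_L2 by blast
  have fb: "f \<in> borel_measurable borel" using L2D(1)[OF f2] by (simp add: borel_measurable_haar[OF haar])
  have "\<exists>c. AE x in \<mu>. x \<in> pdisc b j \<longrightarrow> f x = c" for b using f by (auto simp: L2_locconst_def)
  then obtain c where c: "\<And>b. AE x in \<mu>. x \<in> pdisc b j \<longrightarrow> f x = c b" by metis
  have trunc: "(\<lambda>x. indicator (pball (j - int n)) x * f x) \<in> W" for n
  proof -
    \<comment> \<open>Centers of the p^n cosets of p^j Z_p that make up the ball of exponent j -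
      n.\<close>
    define b where "b k = (unif powi j * (of_nat k / unif ^ n) :: 'p padic)" for k
    let ?Q = "CARD('p) ^ n"
    have mem: "x \<in> pdisc (b k) j \<longleftrightarrow> unif powi (- j) * x - of_nat k / unif ^ n \<in> pball (int 0)" for x k
      using powi_mult_mem_pdisc_iff[of "- j" x "of_nat k / unif ^ n" 0] by (simp add: b_def mem_pdisc_iff)
    have "(\<lambda>x. \<Sum>k<?Q. c (b k) * indicator (pdisc (b k) j) x) \<in> W"
      by (intro subspace_fun_sum W ind)
    moreover have "(\<lambda>x. indicator (pball (j - int n)) x * f x) \<in> borel_measurable \<mu>"
      unfolding borel_measurable_haar[OF haar] using fb by (intro borel_measurable_times borel_measurable_indicator) auto
    moreover have "AE x in \<mu>. (\<Sum>k<?Q. c (b k) * indicator (pdisc (b k) j) x) = indicator (pball (j - int n)) x * f x"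
    proof -
      have "AE x in \<mu>. \<forall>k\<in>{..<?Q}. x \<in> pdisc (b k) j \<longrightarrow> f x = c (b k)"
        by (intro AE_finite_allI c) simp
      thus ?thesis
      proof eventually_elim
        case (elim x)
        have ball: "x \<in> pball (j - int n) \<longleftrightarrow> (\<exists>k<?Q. x \<in> pdisc (b k) j)"
        proof -
          have "x \<in> pball (j - int n) \<longleftrightarrow> unif powi (- j) * x \<in> pball (- int n)"
            by (subst pball_powi_mult_iff) (simp add: algebra_simps)
          thus ?thesis unfolding mem pball_decomp[of n 0, where 'p='p] by (auto simp: mem_pdisc_iff)
        qed
        show ?case
        proof (cases "x \<in> pball (j - int n)")
          case True
          then obtain k where k: "k < ?Q" "x \<in> pdisc (b k) j" using ball by blast
          have ind: "x \<in> pdisc (b l) j \<longleftrightarrow> l = k" if "l < ?Q" for l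
            using padic_approx_unique[of l n 0 k "unif powi (- j) * x"] that k unfolding mem by auto
          have "(\<Sum>k<?Q. c (b k) * indicator (pdisc (b k) j) x) = (\<Sum>l<?Q. if l = k then c (b k) else 0)"
            by (intro sum.cong refl) (simp add: ind indicator_def)
          also have "\<dots> = f x" using k elim by simp
          finally show ?thesis using True by simp
        next
          case False
          thus ?thesis using ball by simp
        qed
      qed
    qed
    ultimately show ?thesis unfolding W_def by (rule L2_closure_cong_AE)
  qed
  have "f \<in> L2_closure \<mu> S"
  proof (rule L2_closure_dominated[OF f2, where C = 1 and h = "\<lambda>n x. indicator (pball (j - int n)) x * f x"])
    show "(\<lambda>x. indicator (pball (j - int n)) x * f x) \<in> L2_closure \<mu> S" for n
      using trunc by (simp add: W_def)
    fix x :: "'p padic"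
    obtain n where n: "x \<in> pball (- int n)" using pball_exhaust by blast
    have "\<forall>\<^sub>F i in sequentially. indicator (pball (j - int i)) x * f x = f x"
      unfolding eventually_sequentially
      \<comment> \<open>The summand \<open>nat j\<close> ensures j - i <= -n for positive j
        too.\<close>
      by (intro exI[of _ "n + nat j"]) (auto simp: indicator_def intro: pball_monoD[OF n])
    thus "(\<lambda>i. indicator (pball (j - int i)) x * f x) \<longlonglongrightarrow> f x" by (rule tendsto_eventually)
    show "cmod (indicator (pball (j - int n)) x * f x) \<le> 1 * cmod (f x)" for n
      by (simp add: indicator_def)
  qed
  thus "f \<in> MRA_spaces \<mu> \<phi> j" by (simp add: MRA_spaces_def S_def)
qed

lemma MRA_spaces_eq_locconst: "MRA_spaces \<mu> \<phi> j = L2_locconst \<mu> j"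
  using MRA_spaces_subset_locconst L2_locconst_subset_MRA_spaces by blast

text \<open>After translation by a the inner product is the autocorrelation at a - b, and distinct
  shifts are incongruent modulo Z_p.\<close>

lemma inner_shifts:
  assumes a: "a \<in> padic_shifts" and b: "b \<in> padic_shifts"
  shows "L2_inner \<mu> (\<lambda>x. \<phi> (x - a)) (\<lambda>x. \<phi> (x - b)) = (if a = b then K else 0)"
proof -
  have [measurable]: "cnj \<in> borel_measurable borel"
    by (intro borel_measurable_continuous_onI continuous_on_cnj continuous_on_id)
  have meas: "(\<lambda>x. \<phi>0 (x + d)) \<in> borel_measurable borel" for d
    using measurable_compose[OF measurable_padic_affine[of 1 d] padic_step_borel[OF \<phi>0]] by simp
  have meas\<phi>: "(\<lambda>x. \<phi> (x - d)) \<in> borel_measurable borel" for d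
    using L2D(1)[OF generator_L2[of 0 d]] by (simp add: borel_measurable_haar[OF haar])
  have "L2_inner \<mu> (\<lambda>x. \<phi> (x - a)) (\<lambda>x. \<phi> (x - b)) = (LINT x|\<mu>. \<phi>0 (x + - a) * cnj (\<phi>0 (x + - b)))"
    unfolding L2_inner_def
  proof (rule integral_cong_AE)
    show "AE x in \<mu>. \<phi> (x - a) * cnj (\<phi> (x - b)) = \<phi>0 (x + - a) * cnj (\<phi>0 (x + - b))"
      using generator_AE[of 0 a] generator_AE[of 0 b] by eventually_elim simp
    show "(\<lambda>x. \<phi>0 (x + - a) * cnj (\<phi>0 (x + - b))) \<in> borel_measurable \<mu>"
      unfolding borel_measurable_haar[OF haar] by (intro borel_measurable_times measurable_compose[OF meas] meas) measurable
    show "(\<lambda>x. \<phi> (x - a) * cnj (\<phi> (x - b))) \<in> borel_measurable \<mu>"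
      unfolding borel_measurable_haar[OF haar] by (intro borel_measurable_times measurable_compose[OF meas\<phi>] meas\<phi>) measurable
  qed
  also have "\<dots> = (LINT x|\<mu>. \<phi>0 (x + a + - a) * cnj (\<phi>0 (x + a + - b)))"
    by (rule integral_haar_translate[OF haar, symmetric])
      (intro borel_measurable_times measurable_compose[OF meas] meas, measurable)
  also have "\<dots> = (LINT x|\<mu>. \<phi>0 x * cnj (\<phi>0 (x + (a - b))))" by (simp add: algebra_simps)
  \<comment> \<open>The integrand is Z_p-periodic and cosets of Z_p have measure 1, so the integral
    is the plain sum over representatives.\<close>
  also have "\<dots> = (\<Sum>k<CARD('p) ^ N. \<phi>0 (of_nat k / unif ^ N) * cnj (\<phi>0 (of_nat k / unif ^ N + (a - b))))"
  proof -
    have "\<phi>0 (x + z + (a - b)) = \<phi>0 (x + (a - b))" if "z \<in> pball (int 0)" for x z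
      by (rule padic_step_cong[OF \<phi>0]) (use that in simp)
    hence "padic_step N 0 (\<lambda>x. \<phi>0 x * cnj (\<phi>0 (x + (a - b))))"
      by (intro padic_step_mult_periodic[OF \<phi>0]) simp
    from has_bochner_integral_integral_eq[OF has_bochner_integral_padic_step[OF haar this]] show ?thesis by simp
  qed
  also have "\<dots> = (if a - b \<in> pball 0 then K else 0)" by (rule corr)
  also have "a - b \<in> pball 0 \<longleftrightarrow> a = b"
  proof
    assume ab: "a - b \<in> pball 0"
    obtain k m where k: "k < CARD('p) ^ m" "a = of_nat k / unif ^ m" using a by (auto simp: padic_shifts_eq)
    obtain l n where l: "l < CARD('p) ^ n" "b = of_nat l / unif ^ n" using b by (auto simp: padic_shifts_eq)
    \<comment> \<open>Over a common denominator both numerators stay below p^M, so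
      \<open>padic_approx_unique\<close> applies.\<close>
    define M where "M = max m n"
    define k' l' where "k' = k * CARD('p) ^ (M - m)" and "l' = l * CARD('p) ^ (M - n)"
    have a': "a = of_nat k' / unif ^ M" using frac_extend[of m M "int k", where 'p='p] by (simp add: k(2) k'_def M_def)
    have b': "b = of_nat l' / unif ^ M" using frac_extend[of n M "int l", where 'p='p] by (simp add: l(2) l'_def M_def)
    have "k' < CARD('p) ^ m * CARD('p) ^ (M - m)" unfolding k'_def using k(1) by simp
    hence k'l: "k' < CARD('p) ^ (M + 0)" by (simp add: M_def flip: power_add)
    have "l' < CARD('p) ^ n * CARD('p) ^ (M - n)" unfolding l'_def using l(1) by simp
    hence l'l: "l' < CARD('p) ^ (M + 0)" by (simp add: M_def flip: power_add)
    have "k' = l'" by (rule padic_approx_unique[OF k'l l'l, of a]) (use ab a' b' in simp_all)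
    thus "a = b" using a' b' by simp
  qed simp
  finally show ?thesis .
qed

end

section \<open>Assembly of the multiresolution analysis\<close>

lemma is_MRA_locconst:
  fixes \<mu> :: "'p::prime_card padic measure"
  assumes haar: "is_haar \<mu>" and V: "\<And>j. V j = L2_locconst \<mu> j"
    and g: "g \<in> V 0" "L2_orthonormal_basis \<mu> padic_shifts (\<lambda>a x. g (x - a)) (V 0)"
  shows "is_MRA \<mu> V"
  unfolding is_MRA_def
proof (intro conjI allI)
  show "L2_closed_subspace \<mu> (V j)" for j
    using L2_closed_subspace_closure[OF subspace_L2_locconst[of \<mu> j], of \<mu>] by (simp add: V L2_closure_locconst[OF haar])
  show "V j \<subseteq> V (j + 1)" for j unfolding V by (rule L2_locconst_mono) simp
  show "L2_closure \<mu> (\<Union>j. V j) = L2 \<mu>" unfolding V by (rule Union_L2_locconst_dense[OF haar])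
  show "(\<Inter>j. V j) = {f \<in> L2 \<mu>. AE x in \<mu>. f x = 0}" unfolding V by (rule Inter_L2_locconst[OF haar])
  show "f \<in> V j \<longleftrightarrow> (\<lambda>x. f (inverse (of_nat CARD('p)) * x)) \<in> V (j + 1)" for j f
    unfolding V by (rule L2_locconst_dilate_iff[OF haar])
  show "\<exists>g\<in>V 0. L2_orthonormal_basis \<mu> padic_shifts (\<lambda>a x. g (x - a)) (V 0)" using g by blast
qed

theorem mainTheorem1:
  fixes \<mu> :: "'p::prime_card padic measure"
    and s :: nat and \<beta> :: "nat \<Rightarrow> complex"
    and m\<^sub>0 :: "'p padic \<Rightarrow> complex"
    and \<phi> \<phi>hat :: "'p padic \<Rightarrow> complex"
  assumes "is_haar \<mu>"
    and "s \<ge> 1"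
    and "m\<^sub>0 = padic_mask s \<beta>"
    and "m\<^sub>0 0 = 1"
    and "\<forall>k \<in> {1..CARD('p) ^ s - 1}. \<not> CARD('p) dvd k \<longrightarrow>
           m\<^sub>0 (of_nat k / of_nat CARD('p) ^ s) = 0"
    and "\<forall>k \<in> {1..CARD('p) ^ s - 1}. CARD('p) dvd k \<longrightarrow>
           cmod (m\<^sub>0 (of_nat k / of_nat CARD('p) ^ s)) = 1"
    and "\<phi> \<in> L2 \<mu>"
    and "is_fourier_L2 \<mu> \<phi> \<phi>hat"
    and "\<forall>\<xi>. \<phi>hat \<xi> =
           \<phi>hat 0 * prodinf (\<lambda>i. m\<^sub>0 (\<xi> / of_nat CARD('p) powi (int s - int (Suc i))))"
    and "\<phi>hat 0 \<noteq> 0"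
  shows "is_MRA \<mu> (MRA_spaces \<mu> \<phi>)"
proof -
  note haar = assms(1)
  define N where "N = s - 1"
  define C where "C = cmod (\<phi>hat 0)"
  have C: "C > 0" using assms(10) by (simp add: C_def)
  have step: "padic_step 0 N \<phi>hat"
    unfolding N_def by (rule mask_product_properties(1)[OF assms(2-6) assms(9)])
  have modulus: "cmod (\<phi>hat \<xi>) = C" if "\<xi> \<in> pball 0" for \<xi>
    unfolding C_def by (rule mask_product_properties(2)[OF assms(2-6) assms(9) that])
  define \<phi>0 where "\<phi>0 = padic_synth N \<phi>hat"
  have \<phi>0: "padic_step N 0 \<phi>0" unfolding \<phi>0_def by (rule padic_step_synth)
  have ae: "AE x in \<mu>. \<phi> x = \<phi>0 x"
    using fourier_L2_unique[OF haar assms(8) \<phi>0] padic_fourier_synth[OF haar step] by (simp add: \<phi>0_def)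
  have corr: "(\<Sum>k<CARD('p) ^ N. \<phi>0 (of_nat k / unif ^ N) * cnj (\<phi>0 (of_nat k / unif ^ N + d)))
      = (if d \<in> pball 0 then of_real (C\<^sup>2) else 0)" for d
    unfolding \<phi>0_def by (rule padic_synth_correlation[OF modulus])
  have V: "MRA_spaces \<mu> \<phi> j = L2_locconst \<mu> j" for j
    by (rule MRA_spaces_eq_locconst[OF haar assms(7) \<phi>0 ae _ corr]) (use C in simp)
  \<comment> \<open>By \<open>corr\<close> at 0 the squared norm of \<phi> is C^2, so division by C
    normalizes the shifts.\<close>
  define g where "g x = \<phi> x / of_real C" for x
  define g0 where "g0 x = \<phi>0 x / of_real C" for x
  have g2: "g \<in> L2 \<mu>" using L2_scale[OF assms(7), of "1 / of_real C"] by (simp add: g_def[abs_def])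
  have g0: "padic_step N 0 g0" unfolding g0_def[abs_def] by (rule padic_step_map[OF \<phi>0]) simp
  have gae: "AE x in \<mu>. g x = g0 x" using ae by eventually_elim (simp add: g_def g0_def)
  have gcorr: "(\<Sum>k<CARD('p) ^ N. g0 (of_nat k / unif ^ N) * cnj (g0 (of_nat k / unif ^ N + d)))
      = (if d \<in> pball 0 then 1 else 0)" for d
  proof -
    have "(\<Sum>k<CARD('p) ^ N. g0 (of_nat k / unif ^ N) * cnj (g0 (of_nat k / unif ^ N + d)))
      = (\<Sum>k<CARD('p) ^ N. \<phi>0 (of_nat k / unif ^ N) * cnj (\<phi>0 (of_nat k / unif ^ N + d))) / of_real (C\<^sup>2)"
      unfolding sum_divide_distrib by (intro sum.cong refl) (simp add: g0_def power2_eq_square)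
    thus ?thesis using C by (simp only: corr) simp
  qed
  \<comment> \<open>The same identification, now with constant 1, shows that g and \<phi> generate
    the same spaces.\<close>
  have Vg: "MRA_spaces \<mu> g j = L2_locconst \<mu> j" for j
    by (rule MRA_spaces_eq_locconst[OF haar g2 g0 gae _ gcorr]) simp
  have gV: "(\<lambda>x. g (x - a)) \<in> L2_locconst \<mu> 0" if "a \<in> padic_shifts" for a
  proof -
    have "(\<lambda>x. g (x - a)) \<in> L2 \<mu>" using generator_L2[OF haar g2 g0 gae _ gcorr, of 0 a] by simp
    moreover have "(\<lambda>x. g (x - a)) \<in> cfun.span ((\<lambda>a x. g (of_nat CARD('p) powi (- 0) * x - a)) ` padic_shifts)"
      using that by (intro cfun.span_base) auto
    ultimately show ?thesis unfolding Vg[symmetric] MRA_spaces_def by (intro L2_closure_base)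
  qed
  \<comment> \<open>The empty digit string, k = n = 0; it puts g itself into V_0.\<close>
  have "0 \<in> (padic_shifts :: 'p padic set)" unfolding padic_shifts_eq by (rule CollectI, rule exI[of _ 0], rule exI[of _ 0]) simp
  from gV[OF this] have "g \<in> MRA_spaces \<mu> \<phi> 0" by (simp add: V)
  moreover have "L2_orthonormal_basis \<mu> padic_shifts (\<lambda>a x. g (x - a)) (MRA_spaces \<mu> \<phi> 0)"
    unfolding L2_orthonormal_basis_def
  proof (intro conjI ballI)
    show "(\<lambda>x. g (x - a)) \<in> MRA_spaces \<mu> \<phi> 0" if "a \<in> padic_shifts" for a using gV[OF that] by (simp add: V)
    show "L2_inner \<mu> (\<lambda>x. g (x - a)) (\<lambda>x. g (x - b)) = (if a = b then 1 else 0)"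
      if "a \<in> padic_shifts" "b \<in> padic_shifts" for a b
      by (rule inner_shifts[OF haar g2 g0 gae _ gcorr that]) simp
    show "L2_closure \<mu> (cfun.span ((\<lambda>a x. g (x - a)) ` padic_shifts)) = MRA_spaces \<mu> \<phi> 0"
      using Vg[of 0] V[of 0] by (simp add: MRA_spaces_def)
  qed
  ultimately show ?thesis by (rule is_MRA_locconst[OF haar V])
qed

end
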